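(* Let $m,n$ be positive integers with $n\ge 2m$, and let $B_1\subset\mathbb{R}^n$ be the open unit ball. Let $u\in C^{2m}(B_1\setminus\{0\})$ solve \[ (-\Delta)^m u=f(x)\quad\text{in }B_1\setminus\{0\}, \] where $f$ satisfies $\int_{B_1\setminus\{0\}}|x|^{s}|f(x)|\,dx<+\infty$ for some integer $0\le s\le 2m-1$. If $\int_{B_1\setminus\{0\}}u^{+}(x)\,dx<+\infty$, where $u^{+}=\max\{u,0\}$, then there exist constants $a_\beta\in\mathbb{R}$ for multi-indices $|\beta|\le 2m-1$ and a function $h\in C^\infty(B_1)$ with $(-\Delta)^m h=0$ in $B_1$ such that \[ u(x)=N(x)+h(x)+\sum_{|\beta|\le 2m-1}a_\beta D^\beta\phi(x)\quad\text{for }x\in B_1\setminus\{0\}, \] where $\phi$ and $N$ are defined below.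
   Context: The fundamental solution of $(-\Delta)^m$ in $\mathbb{R}^n$ is $\phi(x)=c\,|x|^{2m-n}$ if $n>2m$ and $\phi(x)=c\ln\frac{5}{|x|}$ if $n=2m$, with $c=c(m,n)>0$ the normalizing constant making $(-\Delta)^m\phi=\delta_0$. For $x\ne0$, $y\ne x$, set \[ \psi(x,y)=\phi(x-y)-\sum_{|\beta|\le s-1}\frac{(-y)^\beta}{\beta!}D^\beta\phi(x) \] (the sum is absent when $s=0$), and $N(x)=\int_{\{|y|\le1\}}\psi(x,y)f(y)\,dy$ for $x\ne0$. Multi-index notation: $y^\beta=y_1^{\beta_1}\cdots y_n^{\beta_n}$, $\beta!=\beta_1!\cdots\beta_n!$. *)

theory Defs
  imports "HOL-Analysis.Analysis"
begin

definition pd :: "'n::finite \<Rightarrow> (real^'n \<Rightarrow> real) \<Rightarrow> real^'n \<Rightarrow> real" where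
  "pd i g x = deriv (\<lambda>t. g (x + t *\<^sub>R axis i 1)) 0"

text \<open>Class C^k on a set (meant for open sets): all partial derivatives of order
  at most k exist and are continuous.\<close>
fun Ck :: "nat \<Rightarrow> (real^'n::finite) set \<Rightarrow> (real^'n \<Rightarrow> real) \<Rightarrow> bool" where
  "Ck 0 S g = continuous_on S g"
| "Ck (Suc k) S g = (continuous_on S g \<and>
     (\<forall>i. \<forall>x\<in>S. (\<lambda>t. g (x + t *\<^sub>R axis i 1)) differentiable (at 0)) \<and>
     (\<forall>i. Ck k S (pd i g)))"

definition Cinf :: "(real^'n::finite) set \<Rightarrow> (real^'n \<Rightarrow> real) \<Rightarrow> bool" where
  "Cinf S g = (\<forall>k. Ck k S g)"

definition mabs :: "('n::finite \<Rightarrow> nat) \<Rightarrow> nat" where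
  "mabs \<beta> = (\<Sum>i\<in>UNIV. \<beta> i)"

definition mfact :: "('n::finite \<Rightarrow> nat) \<Rightarrow> real" where
  "mfact \<beta> = (\<Prod>i\<in>UNIV. fact (\<beta> i))"

definition mpow :: "real^'n::finite \<Rightarrow> ('n \<Rightarrow> nat) \<Rightarrow> real" where
  "mpow y \<beta> = (\<Prod>i\<in>UNIV. (y $ i) ^ (\<beta> i))"

definition idx_enum :: "'n::finite list" where
  "idx_enum = (SOME xs. distinct xs \<and> set xs = UNIV)"

definition Dm :: "('n::finite \<Rightarrow> nat) \<Rightarrow> (real^'n \<Rightarrow> real) \<Rightarrow> real^'n \<Rightarrow> real" where
  "Dm \<beta> g = foldr pd (concat (map (\<lambda>i. replicate (\<beta> i) i) idx_enum)) g"

definition lap :: "(real^'n::finite \<Rightarrow> real) \<Rightarrow> real^'n \<Rightarrow> real" where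
  "lap g x = (\<Sum>i\<in>UNIV. pd i (pd i g) x)"

definition polylap :: "nat \<Rightarrow> (real^'n::finite \<Rightarrow> real) \<Rightarrow> real^'n \<Rightarrow> real" where
  "polylap m g = ((\<lambda>h x. - lap h x) ^^ m) g"

text \<open>Normalizing constant c(m,n) with (-Delta)^m phi = delta_0.\<close>
definition fs_const :: "nat \<Rightarrow> nat \<Rightarrow> real" where
  "fs_const m n = (if n = 2*m then 1 / (2 ^ (2*m - 1) * pi ^ m * fact (m - 1))
                   else Gamma (real n / 2 - real m) / (4 ^ m * pi powr (real n / 2) * Gamma (real m)))"

text \<open>Fundamental solution phi of (-Delta)^m in R^n (n >= 2m).\<close>
definition phi :: "nat \<Rightarrow> real^'n::finite \<Rightarrow> real" where
  "phi m x = (if CARD('n) > 2*m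
              then fs_const m CARD('n) * norm x powr (real (2*m) - real CARD('n))
              else fs_const m CARD('n) * ln (5 / norm x))"

definition psi :: "nat \<Rightarrow> nat \<Rightarrow> real^'n::finite \<Rightarrow> real^'n \<Rightarrow> real" where
  "psi m s x y = phi m (x - y)
     - (\<Sum>\<beta>\<in>{\<beta>::'n\<Rightarrow>nat. mabs \<beta> < s}. mpow (- y) \<beta> / mfact \<beta> * Dm \<beta> (phi m) x)"

definition Npot :: "nat \<Rightarrow> nat \<Rightarrow> (real^'n::finite \<Rightarrow> real) \<Rightarrow> real^'n \<Rightarrow> real" where
  "Npot m s f x = integral (cball 0 1) (\<lambda>y. psi m s x y * f y)"

end

theory Submission
  imports Defs "HOL-Library.Multiset"
begin

text \<open>
  Everything is tested against compactly supported \<open>C\<^sup>2\<^sup>m\<close> functions, so only \<open>\<integral> \<partial>\<^sub>i g = 0\<close> is needed, never a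
  boundary integral. Truncate \<open>u\<close> away from the unit sphere to a compactly supported \<open>U\<close> on the punctured space
  and put \<open>F = (-\<Delta>)\<^sup>m U\<close>. Testing with iterated radial solutions of Poisson equations with right-hand side
  increasing to \<open>1\<close>, which are \<open>O(|y|\<^sup>2\<^sup>m)\<close>, bounds the mean of \<open>U\<close>; as \<open>u\<^sup>+\<close> is integrable,
  so is \<open>U\<close>. Let \<open>P\<^sub>x\<close> be the Taylor polynomial of degree \<open>2m - 1\<close> of \<open>y \<mapsto> \<phi>(x - y)\<close> at \<open>0\<close>. For a version
  \<open>V\<close> of \<open>U\<close> truncated near \<open>0\<close> the fundamental solution gives
  \<open>V(x) = \<integral> \<phi>(x - y) (-\<Delta>)\<^sup>m V(y) dy = \<integral> (\<phi>(x - y) - P\<^sub>x(y)) (-\<Delta>)\<^sup>m V(y) dy\<close>, because \<open>(-\<Delta>)\<^sup>m P\<^sub>x = 0\<close>.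
  The new kernel is \<open>O(|y|\<^sup>2\<^sup>m)\<close> together with its derivatives, so the integrability of \<open>U\<close> lets the inner truncation
  be removed: \<open>U(x) = \<integral> (\<phi>(x - y) - P\<^sub>x(y)) F(y) dy\<close> for \<open>x \<noteq> 0\<close>. The Taylor terms of order at least \<open>s\<close> yield
  multiples of \<open>D\<^sup>\<beta> \<phi>(x)\<close>, and replacing \<open>F\<close> by \<open>f\<close> only changes the density where \<open>|y| \<ge> R\<close>, which contributes a
  function that is smooth and polyharmonic for \<open>|x| < R\<close> and further multiples of \<open>D\<^sup>\<beta> \<phi>(x)\<close>.
\<close>

section \<open>Partial derivatives and the classes Ck\<close>

text \<open>Two obstacles shape the argument. No derivative of \<open>u\<close> is controlled near
  the unit sphere, so boundary terms there cannot be estimated. This forces one truncation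
  \<open>U R\<close> for each \<open>R < 1\<close>, and the polyharmonic remainder
  \<open>rest R\<close> is known only for |x| < R. Gluing these remainders needs coefficients
  independent of \<open>R\<close>. Two truncations differ by a compactly supported function that
  vanishes near 0, so its m-fold Laplacian has zero moments of every order below 2m. At the origin
  only \<open>u\<close> itself is integrable, while a cutoff at scale e has derivatives of order j
  as large as e^(-j). A kernel flat to order 2m absorbs exactly this loss. Hence the Taylor
  polynomial has degree 2m - 1, although \<open>f\<close> alone would ask only for s - 1; the
  surplus terms have finite moments because of the weight |y|^s. A bound on the positive part
  suffices because the radial test functions are nonnegative: bounding their pairing with
  \<open>u\<close> in absolute value, whatever the sign (-1)^m, bounds the negative part by the
  positive part plus a constant.\<close>

definition has_pd :: "(real^'n::finite \<Rightarrow> real) \<Rightarrow> 'n \<Rightarrow> real \<Rightarrow> real^'n \<Rightarrow> bool" where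
  "has_pd g i d x \<longleftrightarrow> ((\<lambda>t. g (x + t *\<^sub>R axis i 1)) has_real_derivative d) (at 0)"

text \<open>\<open>deriv\<close> is total, so a value of \<open>pd\<close> alone does not tell that
  the derivative exists. The calculus is done with the relation \<open>has_pd\<close> and carried
  over to \<open>pd\<close> here.\<close>

lemma has_pd_imp_pd: "has_pd g i d x \<Longrightarrow> pd i g x = d"
  unfolding has_pd_def pd_def by (rule DERIV_imp_deriv)

lemma differentiable_imp_has_pd:
  "(\<lambda>t. g (x + t *\<^sub>R axis i 1)) differentiable (at (0::real)) \<Longrightarrow> has_pd g i (pd i g x) x"
  unfolding has_pd_def pd_def using DERIV_deriv_iff_real_differentiable by blast

lemma Ck_Suc_has_pd: "Ck (Suc k) S g \<Longrightarrow> x \<in> S \<Longrightarrow> has_pd g i (pd i g x) x"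
  by (auto intro: differentiable_imp_has_pd)

lemma has_pd_line:
  assumes "has_pd g i d (x + s *\<^sub>R axis i 1)"
  shows "((\<lambda>t. g (x + t *\<^sub>R axis i 1)) has_real_derivative d) (at s)"
proof -
  have "((\<lambda>t. g (x + s *\<^sub>R axis i 1 + (t - s) *\<^sub>R axis i 1)) has_real_derivative d) (at s)"
    using DERIV_shift[of "\<lambda>t. g (x + s *\<^sub>R axis i 1 + (t - s) *\<^sub>R axis i 1)" d 0 s]
      assms unfolding has_pd_def by simp
  then show ?thesis by (simp add: scaleR_left_diff_distrib)
qed

lemma eventually_line_in_open:
  fixes x :: "real^'n::finite"
  assumes "open S" "x \<in> S"
  shows "eventually (\<lambda>t::real. x + t *\<^sub>R v \<in> S) (nhds 0)"
proof -
  have "((\<lambda>t::real. x + t *\<^sub>R v) \<longlongrightarrow> x + 0 *\<^sub>R v) (nhds 0)"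
    by (intro tendsto_intros filterlim_ident)
  then show ?thesis
    using assms topological_tendstoD[of "\<lambda>t::real. x + t *\<^sub>R v" x "nhds 0" S] by simp
qed

lemma has_pd_cong:
  assumes "open S" "x \<in> S" "\<And>y. y \<in> S \<Longrightarrow> g y = h y"
  shows "has_pd g i d x \<longleftrightarrow> has_pd h i d x"
  unfolding has_pd_def
  by (rule DERIV_cong_ev)
     (use eventually_line_in_open[OF assms(1,2), of "axis i 1"] assms(3) in
      \<open>auto elim: eventually_mono\<close>)

lemma pd_cong:
  assumes "open S" "x \<in> S" "\<And>y. y \<in> S \<Longrightarrow> g y = h y"
  shows "pd i g x = pd i h x"
  unfolding pd_def
  by (rule deriv_cong_ev)
     (use eventually_line_in_open[OF assms(1,2), of "axis i 1"] assms(3) in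
      \<open>auto elim: eventually_mono\<close>)

lemma Ck_cong:
  assumes "open S" "\<And>y. y \<in> S \<Longrightarrow> g y = h y" "Ck k S g"
  shows "Ck k S h"
  using assms(2,3)
proof (induction k arbitrary: g h)
  case 0
  then show ?case by (metis Ck.simps(1) continuous_on_cong)
next
  case (Suc k)
  have "continuous_on S h"
    using Suc.prems by (metis Ck.simps(2) continuous_on_cong)
  moreover have "(\<lambda>t::real. h (x + t *\<^sub>R axis i 1)) differentiable (at 0)" if "x \<in> S" for i x
    using Ck_Suc_has_pd[where i=i, OF Suc.prems(2) that] has_pd_cong[where g=g and h=h and i=i, OF assms(1) that] Suc.prems(1)
    unfolding has_pd_def real_differentiable_def by blast
  moreover have "Ck k S (pd i h)" for i
  proof (rule Suc.IH)
    show "pd i g y = pd i h y" if "y \<in> S" for y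
      using pd_cong[OF assms(1) that Suc.prems(1)] by simp
    show "Ck k S (pd i g)" using Suc.prems(2) by simp
  qed
  ultimately show ?case by simp
qed

lemma Ck_continuous_on: "Ck k S g \<Longrightarrow> continuous_on S g"
  by (cases k) auto

lemma Ck_pd: "Ck (Suc k) S g \<Longrightarrow> Ck k S (pd i g)"
  by simp

text \<open>Allows explicit candidates \<open>d\<close> for the derivatives; as \<open>S\<close> is
  open, only their values on \<open>S\<close> matter.\<close>

lemma Ck_SucI:
  assumes "open S" "continuous_on S g"
    and "\<And>i x. x \<in> S \<Longrightarrow> has_pd g i (d i x) x" "\<And>i. Ck k S (d i)"
  shows "Ck (Suc k) S g"
proof -
  have "Ck k S (pd i g)" for i
    using has_pd_imp_pd[OF assms(3)] by (intro Ck_cong[OF assms(1) _ assms(4)]) auto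
  then show ?thesis
    using assms(2,3) by (auto simp: has_pd_def real_differentiable_def)
qed

lemma Ck_SucD: "Ck (Suc k) S g \<Longrightarrow> Ck k S g"
  by (induction k arbitrary: g) auto

lemma Ck_le: "Ck k S g \<Longrightarrow> j \<le> k \<Longrightarrow> Ck j S g"
proof (induction k)
  case (Suc k)
  then show ?case using Ck_SucD le_Suc_eq by metis
qed auto

lemma Ck_subset: "Ck k S g \<Longrightarrow> T \<subseteq> S \<Longrightarrow> Ck k T g"
  by (induction k arbitrary: g) (auto intro: continuous_on_subset)

text \<open>Serves to patch a formula that is smooth off a bad point with a neighbourhood of that
  point on which the function is 0.\<close>

lemma Ck_local:
  assumes "\<And>x. x \<in> S \<Longrightarrow> \<exists>T. open T \<and> x \<in> T \<and> Ck k T g"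
  shows "Ck k S g"
  using assms
proof (induction k arbitrary: g)
  case 0
  have "continuous_on S g"
  proof (rule continuous_at_imp_continuous_on, rule ballI)
    fix x assume "x \<in> S"
    then obtain T where "open T" "x \<in> T" "continuous_on T g" using 0 by auto
    then show "isCont g x" by (simp add: continuous_on_eq_continuous_at)
  qed
  then show ?case by simp
next
  case (Suc k)
  have "continuous_on S g"
  proof (rule continuous_at_imp_continuous_on, rule ballI)
    fix x assume "x \<in> S"
    then obtain T where "open T" "x \<in> T" "continuous_on T g" using Suc.prems by force
    then show "isCont g x" by (simp add: continuous_on_eq_continuous_at)
  qed
  moreover have "Ck k S (pd i g)" for i
    by (rule Suc.IH) (use Suc.prems in force)
  ultimately show ?case using Suc.prems by force
qed

declare Ck.simps(2) [simp del]

section \<open>Differentiation rules and closure properties of \<open>Ck\<close>\<close>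

lemma has_pd_const: "has_pd (\<lambda>x. c) i 0 x"
  by (simp add: has_pd_def)

lemma has_pd_add: "has_pd g i a x \<Longrightarrow> has_pd h i b x \<Longrightarrow> has_pd (\<lambda>y. g y + h y) i (a + b) x"
  by (auto simp: has_pd_def intro: derivative_intros)

lemma has_pd_mult:
  "has_pd g i a x \<Longrightarrow> has_pd h i b x \<Longrightarrow> has_pd (\<lambda>y. g y * h y) i (a * h x + g x * b) x"
  unfolding has_pd_def by (auto intro!: derivative_eq_intros)

lemma has_pd_compose:
  assumes "(q has_real_derivative b) (at (g x))" "has_pd g i a x"
  shows "has_pd (\<lambda>y. q (g y)) i (b * a) x"
  using DERIV_chain2[of q b "\<lambda>t. g (x + t *\<^sub>R axis i 1)" 0 a UNIV] assms
  unfolding has_pd_def by simp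

lemma has_pd_affine:
  assumes "has_pd g i d (a + c *\<^sub>R y)"
  shows "has_pd (\<lambda>y. g (a + c *\<^sub>R y)) i (c * d) y"
proof -
  have "((\<lambda>t. g (a + c *\<^sub>R y + t *\<^sub>R axis i 1)) has_real_derivative d) (at (c * 0))"
    using assms by (simp add: has_pd_def)
  from DERIV_chain2[where g="\<lambda>t. c * t" and x=0 and s=UNIV and Db=c, OF this]
  have "((\<lambda>t. g (a + c *\<^sub>R y + (c * t) *\<^sub>R axis i 1)) has_real_derivative d * c) (at 0)"
    by (auto intro!: derivative_eq_intros)
  then show ?thesis by (simp add: has_pd_def algebra_simps)
qed

lemma has_pd_nth: "has_pd (\<lambda>x. x $ j) i (if i = j then 1 else 0) x"
  unfolding has_pd_def by (auto simp: axis_def intro!: derivative_eq_intros)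

lemma pd_const [simp]: "pd i (\<lambda>x. c) = (\<lambda>x. 0)"
  using has_pd_imp_pd[OF has_pd_const] by blast

lemma Ck_const: "Ck k S (\<lambda>x. c)"
  by (induction k arbitrary: c) (auto simp: Ck.simps(2) intro: continuous_on_const)

lemma Ck_nth: "open S \<Longrightarrow> Ck k S (\<lambda>x. x $ j)"
proof (cases k)
  case (Suc l)
  assume "open S"
  then show ?thesis unfolding Suc
    by (rule Ck_SucI[OF _ _ has_pd_nth]) (auto intro: continuous_intros Ck_const)
qed (auto intro: continuous_intros)

lemma Ck_add:
  assumes "open S" "Ck k S g" "Ck k S h"
  shows "Ck k S (\<lambda>x. g x + h x)"
  using assms(2,3)
proof (induction k arbitrary: g h)
  case 0 then show ?case by (auto intro: continuous_intros)
next
  case (Suc k)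
  show ?case
  proof (rule Ck_SucI[OF assms(1) _ has_pd_add[OF Ck_Suc_has_pd[OF Suc.prems(1)] Ck_Suc_has_pd[OF Suc.prems(2)]]])
    show "continuous_on S (\<lambda>x. g x + h x)"
      by (intro continuous_intros Suc.prems[THEN Ck_continuous_on])
    show "Ck k S (\<lambda>x. pd i g x + pd i h x)" for i
      by (intro Suc.IH Ck_pd Suc.prems)
  qed auto
qed

lemma Ck_mult:
  assumes "open S" "Ck k S g" "Ck k S h"
  shows "Ck k S (\<lambda>x. g x * h x)"
  using assms(2,3)
proof (induction k arbitrary: g h)
  case 0 then show ?case by (auto intro: continuous_intros)
next
  case (Suc k)
  show ?case
  proof (rule Ck_SucI[OF assms(1) _ has_pd_mult[OF Ck_Suc_has_pd[OF Suc.prems(1)] Ck_Suc_has_pd[OF Suc.prems(2)]]])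
    show "continuous_on S (\<lambda>x. g x * h x)"
      by (intro continuous_on_mult Suc.prems[THEN Ck_continuous_on])
    show "Ck k S (\<lambda>x. pd i g x * h x + g x * pd i h x)" for i
      by (intro Ck_add Suc.IH assms Ck_pd Suc.prems Suc.prems[THEN Ck_SucD])
  qed auto
qed

lemma Ck_cmult: "open S \<Longrightarrow> Ck k S g \<Longrightarrow> Ck k S (\<lambda>x. c * g x)"
  by (intro Ck_mult Ck_const)

lemma Ck_uminus: "open S \<Longrightarrow> Ck k S g \<Longrightarrow> Ck k S (\<lambda>x. - g x)"
  using Ck_cmult[of S k g "-1"] by simp

lemma Ck_diff: "open S \<Longrightarrow> Ck k S g \<Longrightarrow> Ck k S h \<Longrightarrow> Ck k S (\<lambda>x. g x - h x)"
  using Ck_add[OF _ _ Ck_uminus, of S k g h] by simp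

lemma Ck_sum:
  assumes "open S" "\<And>a. a \<in> A \<Longrightarrow> Ck k S (g a)"
  shows "Ck k S (\<lambda>x. \<Sum>a\<in>A. g a x)"
  using assms(2) by (induction A rule: infinite_finite_induct) (auto intro!: Ck_const Ck_add assms(1))

lemma Ck_prod:
  assumes "open S" "\<And>a. a \<in> A \<Longrightarrow> Ck k S (g a)"
  shows "Ck k S (\<lambda>x. \<Prod>a\<in>A. g a x)"
  using assms(2) by (induction A rule: infinite_finite_induct) (auto intro!: Ck_const Ck_mult assms(1))

lemma Ck_power: "open S \<Longrightarrow> Ck k S g \<Longrightarrow> Ck k S (\<lambda>x. g x ^ j)"
  by (induction j) (auto intro!: Ck_const Ck_mult)

lemma Ck_affine:
  assumes "open S" "Ck k S g"
  shows "Ck k {y. a + c *\<^sub>R y \<in> S} (\<lambda>y. g (a + c *\<^sub>R y))"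
  using assms(2)
proof (induction k arbitrary: g)
  case 0
  then show ?case
    by (auto intro!: continuous_on_compose2[of S g] continuous_intros)
next
  case (Suc k)
  have op: "open {y. a + c *\<^sub>R y \<in> S}"
    using open_vimage[OF assms(1), of "\<lambda>y. a + c *\<^sub>R y"]
    by (simp add: vimage_def continuous_intros)
  show ?case
  proof (rule Ck_SucI[OF op _ has_pd_affine[OF Ck_Suc_has_pd[OF Suc.prems]]])
    show "continuous_on {y. a + c *\<^sub>R y \<in> S} (\<lambda>y. g (a + c *\<^sub>R y))"
      using Ck_continuous_on[OF Suc.prems] by (auto intro!: continuous_on_compose2[of S g] continuous_intros)
    show "Ck k {y. a + c *\<^sub>R y \<in> S} (\<lambda>y. c * pd i g (a + c *\<^sub>R y))" for i
      by (intro Ck_cmult op Suc.IH Ck_pd Suc.prems)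
  qed auto
qed

lemma Ck_powr:
  assumes "open S" "Ck k S g" "\<And>x. x \<in> S \<Longrightarrow> g x > 0"
  shows "Ck k S (\<lambda>x. g x powr a)"
  using assms(2)
proof (induction k arbitrary: a)
  case 0
  have "continuous_on S (\<lambda>x. g x powr a)"
    by (intro continuous_on_powr Ck_continuous_on[OF 0] continuous_on_const ballI)
       (metis assms(3) less_irrefl)
  then show ?case by simp
next
  case (Suc k)
  have pos: "x \<in> S \<Longrightarrow> ((\<lambda>t. t powr a) has_real_derivative a * g x powr (a - 1)) (at (g x))" for x
    using assms(3) has_real_derivative_powr by blast
  show ?case
  proof (rule Ck_SucI[OF assms(1) _ has_pd_compose[OF pos Ck_Suc_has_pd[OF Suc.prems]]])
    show "continuous_on S (\<lambda>x. g x powr a)"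
      by (intro continuous_on_powr Ck_continuous_on[OF Suc.prems] continuous_on_const ballI)
         (metis assms(3) less_irrefl)
    show "Ck k S (\<lambda>x. a * g x powr (a - 1) * pd i g x)" for i
      by (intro Ck_mult Ck_const assms(1) Suc.IH Ck_pd Suc.prems Suc.prems[THEN Ck_SucD])
  qed auto
qed

lemma Ck_ln:
  assumes "open S" "Ck k S g" "\<And>x. x \<in> S \<Longrightarrow> g x > 0"
  shows "Ck k S (\<lambda>x. ln (g x))"
proof (cases k)
  case 0
  have "continuous_on S (\<lambda>x. ln (g x))"
    by (intro continuous_on_ln Ck_continuous_on[OF assms(2)] ballI) (metis assms(3) less_irrefl)
  with 0 show ?thesis by simp
next
  case (Suc j)
  have pos: "x \<in> S \<Longrightarrow> (ln has_real_derivative g x powr (- 1)) (at (g x))" for x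
    using DERIV_ln[of "g x"] assms(3)[of x] by (simp add: powr_minus)
  show ?thesis unfolding Suc
  proof (rule Ck_SucI[OF assms(1) _ has_pd_compose[OF pos Ck_Suc_has_pd[OF assms(2)[unfolded Suc]]]])
    show "continuous_on S (\<lambda>x. ln (g x))"
      by (intro continuous_on_ln Ck_continuous_on[OF assms(2)] ballI) (metis assms(3) less_irrefl)
    show "Ck j S (\<lambda>x. g x powr - 1 * pd i g x)" for i
      by (intro Ck_mult Ck_powr assms(1,3) Ck_pd assms(2)[unfolded Suc] assms(2)[unfolded Suc, THEN Ck_SucD])
  qed auto
qed

text \<open>Only \<open>s = 0\<close> needs an argument: there the difference quotient is at most
  |h|^(j+1), and this exponent is positive because the power is at least 2.\<close>

lemma DERIV_pos_power:
  "((\<lambda>t::real. (max 0 t) ^ Suc (Suc j)) has_real_derivative real (Suc (Suc j)) * (max 0 s) ^ Suc j) (at s)"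
proof -
  consider "s > 0" | "s < 0" | "s = 0" by linarith
  then show ?thesis
  proof cases
    case 1
    have "((\<lambda>t::real. t ^ Suc (Suc j)) has_real_derivative real (Suc (Suc j)) * s ^ Suc j) (at s)"
      by (rule derivative_eq_intros refl | simp)+
    moreover have "\<forall>\<^sub>F t in nhds s. t ^ Suc (Suc j) = (max 0 t) ^ Suc (Suc j)"
      using eventually_gt_at_top order_tendstoD(1)[OF filterlim_ident 1]
      by (auto elim!: eventually_mono simp: max_def)
    ultimately show ?thesis using DERIV_cong_ev[of s s] 1 by (auto simp: max_def)
  next
    case 2
    have "((\<lambda>t::real. 0) has_real_derivative 0) (at s)" by simp
    moreover have "\<forall>\<^sub>F t in nhds s. 0 = (max 0 t) ^ Suc (Suc j)"
      using order_tendstoD(2)[OF filterlim_ident 2]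
      by (auto elim!: eventually_mono simp: max_def)
    ultimately show ?thesis using DERIV_cong_ev[of s s "\<lambda>t. 0" "\<lambda>t. (max 0 t) ^ Suc (Suc j)" 0 0] 2
      by (auto simp: max_def)
  next
    case 3
    have "((\<lambda>h::real. max 0 h ^ Suc (Suc j) / h) \<longlongrightarrow> 0) (at 0)"
    proof (rule Lim_null_comparison)
      have "\<bar>max 0 h ^ Suc (Suc j) / h\<bar> \<le> \<bar>h\<bar> ^ Suc j" if "h \<noteq> 0" for h :: real
      proof (cases "h > 0")
        case False
        then have 0: "max 0 h ^ Suc (Suc j) = 0" by simp
        show ?thesis unfolding 0 by (metis abs_zero div_0 zero_le_power_abs)
      qed simp
      then show "\<forall>\<^sub>F h in at 0. norm (max 0 h ^ Suc (Suc j) / h) \<le> \<bar>h\<bar> ^ Suc j"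
        by (auto simp: eventually_at_filter)
      have "((\<lambda>h::real. \<bar>h\<bar> ^ Suc j) \<longlongrightarrow> \<bar>0\<bar> ^ Suc j) (at 0)"
        by (intro tendsto_intros)
      then show "((\<lambda>h::real. \<bar>h\<bar> ^ Suc j) \<longlongrightarrow> 0) (at 0)" by simp
    qed
    then show ?thesis using 3 by (simp add: DERIV_def)
  qed
qed

text \<open>Each differentiation lowers the exponent by one; \<open>k < j\<close> leaves a positive
  exponent after \<open>k\<close> of them.\<close>

lemma Ck_pos_power:
  assumes "open S" "Ck k S g" "k < j"
  shows "Ck k S (\<lambda>x. (max 0 (g x)) ^ j)"
  using assms(2,3)
proof (induction k arbitrary: j)
  case 0
  then show ?case by (auto intro!: continuous_intros)
next
  case (Suc k)
  obtain l where j: "j = Suc (Suc l)" using Suc.prems(2) by (metis Suc_lessE less_Suc_eq_0_disj not_less_eq)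
  show ?case unfolding j
  proof (rule Ck_SucI[OF assms(1) _ has_pd_compose[OF DERIV_pos_power Ck_Suc_has_pd[OF Suc.prems(1)]]])
    show "continuous_on S (\<lambda>x. max 0 (g x) ^ Suc (Suc l))"
      using Ck_continuous_on[OF Suc.prems(1)] by (intro continuous_intros)
    show "Ck k S (\<lambda>x. real (Suc (Suc l)) * max 0 (g x) ^ Suc l * pd i g x)" for i
      using Suc.prems(2) j by (intro Ck_mult Ck_const assms(1) Suc.IH Ck_pd Suc.prems(1) Suc.prems(1)[THEN Ck_SucD]) auto
  qed auto
qed

lemma norm_power2_eq_sum: "(norm (x :: real^'n::finite))\<^sup>2 = (\<Sum>i\<in>UNIV. (x $ i)\<^sup>2)"
  by (simp add: norm_vec_def L2_set_def sum_nonneg)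

lemma Ck_norm2: "open S \<Longrightarrow> Ck k S (\<lambda>x. (norm (x :: real^'n::finite))\<^sup>2)"
  unfolding norm_power2_eq_sum by (intro Ck_sum Ck_power Ck_nth)

lemma has_pd_norm2: "has_pd (\<lambda>x. (norm (x :: real^'n::finite))\<^sup>2) i (2 * x $ i) x"
proof -
  have "((\<lambda>t. \<Sum>j\<in>UNIV. ((x + t *\<^sub>R axis i 1) $ j)\<^sup>2) has_real_derivative
      (\<Sum>j\<in>UNIV. if j = i then 2 * x $ i else 0)) (at 0)"
    by (rule DERIV_sum) (auto simp: axis_def intro!: derivative_eq_intros)
  then show ?thesis unfolding has_pd_def norm_power2_eq_sum by simp
qed

section \<open>The Laplacian and its powers: locality and linearity\<close>

lemma Ck_lap: "open S \<Longrightarrow> Ck (Suc (Suc k)) S g \<Longrightarrow> Ck k S (lap g)"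
  unfolding lap_def[abs_def] by (intro Ck_sum Ck_pd)

lemma polylap_0 [simp]: "polylap 0 g = g"
  by (simp add: polylap_def)

lemma polylap_Suc: "polylap (Suc m) g = (\<lambda>x. - lap (polylap m g) x)"
  by (simp add: polylap_def)

lemma Ck_polylap: "open S \<Longrightarrow> Ck (2 * m + k) S g \<Longrightarrow> Ck k S (polylap m g)"
  by (induction m arbitrary: k) (auto simp: polylap_Suc simp del: Ck.simps(2) intro!: Ck_uminus Ck_lap)

lemma lap_cong:
  assumes "open S" "x \<in> S" "\<And>y. y \<in> S \<Longrightarrow> g y = h y"
  shows "lap g x = lap h x"
  unfolding lap_def by (intro sum.cong refl pd_cong[OF assms(1)] assms)

lemma polylap_cong:
  assumes "open S" "x \<in> S" "\<And>y. y \<in> S \<Longrightarrow> g y = h y"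
  shows "polylap m g x = polylap m h x"
  using assms(2)
  by (induction m arbitrary: x) (auto simp: polylap_Suc assms intro!: lap_cong[OF assms(1)])

lemma pd_add:
  "Ck (Suc k) S g \<Longrightarrow> Ck (Suc k) S h \<Longrightarrow> x \<in> S \<Longrightarrow> pd i (\<lambda>y. g y + h y) x = pd i g x + pd i h x"
  by (intro has_pd_imp_pd has_pd_add Ck_Suc_has_pd)

lemma pd_mult:
  "Ck (Suc k) S g \<Longrightarrow> Ck (Suc k) S h \<Longrightarrow> x \<in> S \<Longrightarrow> pd i (\<lambda>y. g y * h y) x = pd i g x * h x + g x * pd i h x"
  by (intro has_pd_imp_pd has_pd_mult Ck_Suc_has_pd)

lemma pd_cmult: "Ck (Suc k) S g \<Longrightarrow> x \<in> S \<Longrightarrow> pd i (\<lambda>y. c * g y) x = c * pd i g x"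
  using has_pd_imp_pd[OF has_pd_mult[OF has_pd_const Ck_Suc_has_pd]] by fastforce

lemma lap_add:
  assumes "open S" "Ck 2 S g" "Ck 2 S h" "x \<in> S"
  shows "lap (\<lambda>y. g y + h y) x = lap g x + lap h x"
proof -
  have 2: "Ck (Suc (Suc 0)) S g" "Ck (Suc (Suc 0)) S h" using assms by (simp_all add: numeral_2_eq_2)
  have "pd i (pd i (\<lambda>y. g y + h y)) x = pd i (pd i g) x + pd i (pd i h) x" for i
    using pd_cong[where i=i and h="\<lambda>y. pd i g y + pd i h y" and g="pd i (\<lambda>y. g y + h y)", OF assms(1,4)]
      pd_add[OF 2] pd_add[OF Ck_pd[OF 2(1)] Ck_pd[OF 2(2)] assms(4), of i i i]
    by simp
  then show ?thesis by (simp add: lap_def sum.distrib)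
qed

lemma lap_cmult:
  assumes "open S" "Ck 2 S g" "x \<in> S"
  shows "lap (\<lambda>y. c * g y) x = c * lap g x"
proof -
  have 2: "Ck (Suc (Suc 0)) S g" using assms by (simp_all add: numeral_2_eq_2)
  have "pd i (pd i (\<lambda>y. c * g y)) x = c * pd i (pd i g) x" for i
    using pd_cong[where i=i and h="\<lambda>y. c * pd i g y" and g="pd i (\<lambda>y. c * g y)", OF assms(1,3)]
      pd_cmult[OF 2] pd_cmult[OF Ck_pd[OF 2] assms(3), of i c i]
    by simp
  then show ?thesis by (simp add: lap_def sum_distrib_left)
qed

lemma lap_const [simp]: "lap (\<lambda>x. c) = (\<lambda>x. 0)"
  by (simp add: lap_def[abs_def])

lemma polylap_add:
  assumes "open S" "Ck (2 * m) S g" "Ck (2 * m) S h" "x \<in> S"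
  shows "polylap m (\<lambda>y. g y + h y) x = polylap m g x + polylap m h x"
  using assms(2-)
proof (induction m arbitrary: x)
  case (Suc m)
  have m: "Ck (2 * m) S g" "Ck (2 * m) S h" "Ck (2 * m + 2) S g" "Ck (2 * m + 2) S h"
    using Suc.prems(1,2) Ck_le[of "2 * Suc m" S _ "2 * m"] by auto
  have "lap (polylap m (\<lambda>y. g y + h y)) x = lap (\<lambda>y. polylap m g y + polylap m h y) x"
    by (intro lap_cong[OF assms(1)] Suc m)
  also have "\<dots> = lap (polylap m g) x + lap (polylap m h) x"
    by (intro lap_add[OF assms(1)] Ck_polylap assms(1) m Suc.prems)
  finally show ?case by (simp add: polylap_Suc)
qed simp

lemma polylap_cmult:
  assumes "open S" "Ck (2 * m) S g" "x \<in> S"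
  shows "polylap m (\<lambda>y. c * g y) x = c * polylap m g x"
  using assms(2-)
proof (induction m arbitrary: x)
  case (Suc m)
  have m: "Ck (2 * m) S g" "Ck (2 * m + 2) S g"
    using Suc.prems(1) Ck_le[of "2 * Suc m" S _ "2 * m"] by auto
  have "lap (polylap m (\<lambda>y. c * g y)) x = lap (\<lambda>y. c * polylap m g y) x"
    by (intro lap_cong[OF assms(1)] Suc m)
  also have "\<dots> = c * lap (polylap m g) x"
    by (intro lap_cmult[OF assms(1)] Ck_polylap assms(1) m Suc.prems)
  finally show ?case by (simp add: polylap_Suc)
qed simp

lemma polylap_const: "m \<ge> 1 \<Longrightarrow> polylap m (\<lambda>x. c) = (\<lambda>x. 0)"
  by (induction m rule: dec_induct) (auto simp: polylap_Suc)

lemma polylap_sum: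
  assumes "open S" "\<And>a. a \<in> A \<Longrightarrow> Ck (2 * m) S (g a)" "x \<in> S" 
  shows "polylap m (\<lambda>y. \<Sum>a\<in>A. g a y) x = (\<Sum>a\<in>A. polylap m (g a) x)"
  using assms(2)
proof (induction A rule: infinite_finite_induct)
  case (insert a A)
  then show ?case using assms by (simp add: polylap_add[OF assms(1)] Ck_sum)
qed (cases m; simp add: polylap_const)+

lemma polylap_diff:
  assumes "open S" "Ck (2 * m) S g" "Ck (2 * m) S h" "x \<in> S"
  shows "polylap m (\<lambda>y. g y - h y) x = polylap m g x - polylap m h x"
  using polylap_add[OF assms(1,2) Ck_cmult[OF assms(1,3)] assms(4), of "-1"]
    polylap_cmult[OF assms(1,3,4), of "-1"] by simp

lemma pd_affine:
  assumes "Ck (Suc k) S g" "a + c *\<^sub>R y \<in> S"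
  shows "pd i (\<lambda>y. g (a + c *\<^sub>R y)) y = c * pd i g (a + c *\<^sub>R y)"
  by (intro has_pd_imp_pd has_pd_affine Ck_Suc_has_pd[OF assms])

section \<open>Mixed partial derivatives and multi-indices\<close>

text \<open>The mean value inequality for \<open>g\<close> minus the linear function with slope
  \<open>D\<close>. The symmetric interval covers both signs of \<open>c\<close>; with
  \<open>D = 0\<close> it bounds difference quotients.\<close>

lemma has_pd_line_bound:
  fixes z :: "real^'n::finite"
  assumes "\<And>t. \<bar>t\<bar> \<le> \<bar>c\<bar> \<Longrightarrow> has_pd g i (d t) (z + t *\<^sub>R axis i 1)"
    and "\<And>t. \<bar>t\<bar> \<le> \<bar>c\<bar> \<Longrightarrow> \<bar>d t - D\<bar> \<le> e"
  shows "\<bar>g (z + c *\<^sub>R axis i 1) - g z - D * c\<bar> \<le> e * \<bar>c\<bar>"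
proof -
  let ?q = "\<lambda>t. g (z + t *\<^sub>R axis i 1) - D * t"
  have "norm (?q c - ?q 0) \<le> e * norm (c - 0)"
  proof (rule field_differentiable_bound[where S="cball 0 \<bar>c\<bar>" and f'="\<lambda>t. d t - D"])
    fix t :: real assume t: "t \<in> cball 0 \<bar>c\<bar>"
    show "(?q has_field_derivative d t - D) (at t within cball 0 \<bar>c\<bar>)"
    proof (rule has_field_derivative_at_within)
      have 1: "((\<lambda>t. g (z + t *\<^sub>R axis i 1)) has_real_derivative d t) (at t)"
        using t by (intro has_pd_line assms(1)) simp
      have 2: "((\<lambda>t. D * t) has_real_derivative D) (at t)"
        by (auto intro!: derivative_eq_intros)
      show "(?q has_real_derivative d t - D) (at t)"
        by (rule DERIV_diff[OF 1 2])
    qed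
    show "norm (d t - D) \<le> e" using assms(2)[of t] t by simp
  qed auto
  then show ?thesis by simp
qed

lemma Ck_1_has_derivative:
  fixes g :: "real^'n::finite \<Rightarrow> real"
  assumes S: "open S" and g: "Ck (Suc 0) S g" and x: "x \<in> S"
  shows "(g has_derivative (\<lambda>v. \<Sum>i\<in>UNIV. pd i g x * v $ i)) (at x)"
  unfolding has_derivative_at_alt
proof (intro conjI allI impI)
  show "bounded_linear (\<lambda>v. \<Sum>i\<in>UNIV. pd i g x * v $ i)"
    by (intro bounded_linear_sum bounded_linear_const_mult bounded_linear_vec_nth)
next
  fix e :: real assume e: "e > 0"
  \<comment> \<open>The error is spent once per coordinate.\<close>
  define e' where "e' = e / real CARD('n)"
  have e': "e' > 0" using e by (simp add: e'_def)
  have "\<forall>\<^sub>F y in nhds x. y \<in> S \<and> (\<forall>i\<in>UNIV. \<bar>pd i g y - pd i g x\<bar> < e')"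
  proof (intro eventually_conj eventually_ball_finite ballI)
    show "\<forall>\<^sub>F y in nhds x. y \<in> S" using S x by (rule eventually_nhds_in_open)
    fix i
    have "isCont (pd i g) x"
      using Ck_continuous_on[OF Ck_pd[OF g, of i]] S x continuous_on_eq_continuous_at by blast
    then have "((\<lambda>y. pd i g y) \<longlongrightarrow> pd i g x) (nhds x)"
      by (simp add: continuous_at tendsto_at_iff_tendsto_nhds)
    from tendstoD[OF this e'] show "\<forall>\<^sub>F y in nhds x. \<bar>pd i g y - pd i g x\<bar> < e'"
      by (simp add: dist_real_def)
  qed auto
  then obtain d where d: "d > 0" and S': "\<And>y. dist y x < d \<Longrightarrow> y \<in> S"
    and close: "\<And>y i. dist y x < d \<Longrightarrow> \<bar>pd i g y - pd i g x\<bar> < e'"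
    unfolding eventually_nhds_metric by auto
  have "norm (g y - g x - (\<Sum>i\<in>UNIV. pd i g x * (y - x) $ i)) \<le> e * norm (y - x)" if y: "norm (y - x) < d" for y
  proof -
    define v where "v = y - x"
    \<comment> \<open>\<open>z I\<close> keeps the coordinates of the increment that lie in
      \<open>I\<close>. Adding one index moves along one axis, where only a partial derivative is
      involved.\<close>
    define z where "z I = (\<chi> j. if j \<in> I then v $ j else 0)" for I :: "'n set"
    have "\<bar>g (x + z I) - g x - (\<Sum>i\<in>I. pd i g x * v $ i)\<bar> \<le> real (card I) * (e' * norm v)" if "finite I" for I
      using that
    proof (induction I)
      case empty
      have "z {} = 0" by (simp add: z_def vec_eq_iff)
      then show ?case by simp
    next
      case (insert i I)
      have zi: "z (insert i I) = z I + (v $ i) *\<^sub>R axis i 1"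
        using insert.hyps by (auto simp: z_def vec_eq_iff axis_def)
      have nz: "norm (z I + t *\<^sub>R axis i 1) \<le> norm v" if "\<bar>t\<bar> \<le> \<bar>v $ i\<bar>" for t
        using insert.hyps that by (intro norm_le_componentwise_cart) (auto simp: z_def axis_def)
      have "dist (x + z I + t *\<^sub>R axis i 1) x < d" if "\<bar>t\<bar> \<le> \<bar>v $ i\<bar>" for t
        using nz[OF that] y by (simp add: dist_norm v_def add.assoc)
      then have "\<bar>g (x + z I + (v $ i) *\<^sub>R axis i 1) - g (x + z I) - pd i g x * (v $ i)\<bar> \<le> e' * \<bar>v $ i\<bar>"
        by (intro has_pd_line_bound[where d="\<lambda>t. pd i g (x + z I + t *\<^sub>R axis i 1)"])
           (auto intro!: Ck_Suc_has_pd[OF g] S' less_imp_le close)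
      also have "\<dots> \<le> e' * norm v" using e' component_le_norm_cart[of v i] by simp
      finally show ?case using insert by (simp add: zi add.assoc distrib_right)
    qed
    from this[of UNIV] have "\<bar>g (x + z UNIV) - g x - (\<Sum>i\<in>UNIV. pd i g x * v $ i)\<bar> \<le> e * norm v"
      by (simp add: e'_def)
    moreover have "x + z UNIV = y" by (simp add: z_def v_def vec_eq_iff)
    ultimately show ?thesis by (simp add: v_def)
  qed
  then show "\<exists>d>0. \<forall>y. norm (y - x) < d \<longrightarrow> norm (g y - g x - (\<Sum>i\<in>UNIV. pd i g x * (y - x) $ i)) \<le> e * norm (y - x)"
    using d by blast
qed

text \<open>Two applications of the mean value theorem: first in direction \<open>i\<close> to the
  difference in direction \<open>j\<close>, then in direction \<open>j\<close> to
  \<open>pd i g\<close>. The left-hand side is symmetric in \<open>i\<close> and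
  \<open>j\<close>.\<close>

lemma double_difference:
  fixes g :: "real^'n::finite \<Rightarrow> real"
  assumes S: "ball x r \<subseteq> S" and g: "Ck (Suc (Suc 0)) S g" and s: "0 < s" "2 * s < r"
  shows "\<exists>p. dist p x \<le> 2 * s \<and>
    g (x + s *\<^sub>R axis i 1 + s *\<^sub>R axis j 1) - g (x + s *\<^sub>R axis i 1) - g (x + s *\<^sub>R axis j 1) + g x
      = s * s * pd j (pd i g) p"
proof -
  have dst: "dist (x + a *\<^sub>R axis i 1 + b *\<^sub>R axis j 1) x \<le> 2 * s" if "0 \<le> a" "a \<le> s" "0 \<le> b" "b \<le> s" for a b
  proof -
    have "norm (a *\<^sub>R axis i 1 + b *\<^sub>R axis j (1::real)) \<le> a + b"
      using that norm_triangle_ineq[of "a *\<^sub>R axis i 1" "b *\<^sub>R axis j (1::real)"] by simp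
    then show ?thesis using that by (simp add: dist_norm add.assoc)
  qed
  have inS: "x + a *\<^sub>R axis i 1 + b *\<^sub>R axis j 1 \<in> S" if "0 \<le> a" "a \<le> s" "0 \<le> b" "b \<le> s" for a b
    using dst[OF that] s S by (auto simp: dist_commute)
  define q where "q t = g (x + s *\<^sub>R axis j 1 + t *\<^sub>R axis i 1) - g (x + t *\<^sub>R axis i 1)" for t
  have "\<exists>t>0. t < s \<and> q s - q 0 = (s - 0) * (pd i g (x + s *\<^sub>R axis j 1 + t *\<^sub>R axis i 1) - pd i g (x + t *\<^sub>R axis i 1))"
  proof (rule MVT2[OF s(1)])
    fix t assume t: "0 \<le> t" "t \<le> s"
    show "(q has_real_derivative pd i g (x + s *\<^sub>R axis j 1 + t *\<^sub>R axis i 1) - pd i g (x + t *\<^sub>R axis i 1)) (at t)"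
      unfolding q_def
      using inS[of t s] inS[of t 0] t s
      by (intro DERIV_diff has_pd_line Ck_Suc_has_pd[OF g]) (auto simp: add_ac)
  qed
  then obtain t where t: "0 < t" "t < s" and
    1: "q s - q 0 = s * (pd i g (x + s *\<^sub>R axis j 1 + t *\<^sub>R axis i 1) - pd i g (x + t *\<^sub>R axis i 1))" by auto
  let ?p = "\<lambda>b. pd i g (x + t *\<^sub>R axis i 1 + b *\<^sub>R axis j 1)"
  have "\<exists>b>0. b < s \<and> ?p s - ?p 0 = (s - 0) * pd j (pd i g) (x + t *\<^sub>R axis i 1 + b *\<^sub>R axis j 1)"
  proof (rule MVT2[OF s(1)])
    fix b assume b: "0 \<le> b" "b \<le> s"
    show "(?p has_real_derivative pd j (pd i g) (x + t *\<^sub>R axis i 1 + b *\<^sub>R axis j 1)) (at b)"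
      using inS[of t b] t b
      by (intro has_pd_line Ck_Suc_has_pd[OF Ck_pd[OF g]]) (auto simp: add_ac)
  qed
  then obtain b where b: "0 < b" "b < s" and
    2: "?p s - ?p 0 = s * pd j (pd i g) (x + t *\<^sub>R axis i 1 + b *\<^sub>R axis j 1)" by auto
  have "q s - q 0 = s * s * pd j (pd i g) (x + t *\<^sub>R axis i 1 + b *\<^sub>R axis j 1)"
    using 1 2 by (simp add: add_ac)
  then show ?thesis
    using dst[of t b] t b by (intro exI[of _ "x + t *\<^sub>R axis i 1 + b *\<^sub>R axis j 1"]) (auto simp: q_def add_ac)
qed

text \<open>One and the same second difference is \<open>s * s\<close> times either mixed
  derivative, taken at points that tend to \<open>x\<close>; continuity does the rest.\<close>

lemma pd_commute:
  fixes g :: "real^'n::finite \<Rightarrow> real"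
  assumes S: "open S" and g: "Ck (Suc (Suc 0)) S g" and x: "x \<in> S"
  shows "pd i (pd j g) x = pd j (pd i g) x"
proof (rule ccontr)
  assume ne: "pd i (pd j g) x \<noteq> pd j (pd i g) x"
  \<comment> \<open>Half the gap: two values within \<open>e\<close> of the two different limits
    cannot coincide.\<close>
  define e where "e = \<bar>pd i (pd j g) x - pd j (pd i g) x\<bar> / 2"
  have e: "e > 0" using ne by (simp add: e_def)
  obtain r where r: "r > 0" "ball x r \<subseteq> S" using S x openE by blast
  have "\<exists>d>0. \<forall>y. dist y x < d \<longrightarrow> \<bar>pd a (pd b g) y - pd a (pd b g) x\<bar> < e" for a b
  proof -
    have "isCont (pd a (pd b g)) x"
      using Ck_continuous_on[OF Ck_pd[OF Ck_pd[OF g]]] S x continuous_on_eq_continuous_at by blast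
    then show ?thesis unfolding continuous_at_eps_delta using e by (simp add: dist_real_def)
  qed
  then obtain d1 d2 where d: "d1 > 0" "d2 > 0"
    "\<And>y. dist y x < d1 \<Longrightarrow> \<bar>pd i (pd j g) y - pd i (pd j g) x\<bar> < e"
    "\<And>y. dist y x < d2 \<Longrightarrow> \<bar>pd j (pd i g) y - pd j (pd i g) x\<bar> < e" by metis
  define s where "s = min r (min d1 d2) / 4"
  have s: "0 < s" "2 * s < r" "2 * s < d1" "2 * s < d2" using r d by (auto simp: s_def)
  obtain p where p: "dist p x \<le> 2 * s"
    "g (x + s *\<^sub>R axis i 1 + s *\<^sub>R axis j 1) - g (x + s *\<^sub>R axis i 1) - g (x + s *\<^sub>R axis j 1) + g x
      = s * s * pd j (pd i g) p" using double_difference[OF r(2) g s(1,2)] by blast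
  obtain p' where p': "dist p' x \<le> 2 * s"
    "g (x + s *\<^sub>R axis j 1 + s *\<^sub>R axis i 1) - g (x + s *\<^sub>R axis j 1) - g (x + s *\<^sub>R axis i 1) + g x
      = s * s * pd i (pd j g) p'" using double_difference[OF r(2) g s(1,2)] by blast
  have "g (x + s *\<^sub>R axis j 1 + s *\<^sub>R axis i 1) = g (x + s *\<^sub>R axis i 1 + s *\<^sub>R axis j 1)"
    by (simp add: add_ac)
  then have "s * s * pd j (pd i g) p = s * s * pd i (pd j g) p'"
    using p(2) p'(2) by linarith
  then have "pd j (pd i g) p = pd i (pd j g) p'" using s by simp
  moreover have "\<bar>pd i (pd j g) p' - pd i (pd j g) x\<bar> < e" "\<bar>pd j (pd i g) p - pd j (pd i g) x\<bar> < e"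
    using d p p' s by (meson le_less_trans)+
  ultimately show False by (simp add: e_def abs_if split: if_splits)
qed

section \<open>Iterated derivatives of smooth functions and multi-indices\<close>

lemma Cinf_Ck: "Cinf S g \<Longrightarrow> Ck k S g"
  by (simp add: Cinf_def)

lemma Cinf_pd: "Cinf S g \<Longrightarrow> Cinf S (pd i g)"
  unfolding Cinf_def using Ck_pd by blast

lemma foldr_pd_cong:
  assumes "open S" "x \<in> S" "\<And>y. y \<in> S \<Longrightarrow> g y = h y"
  shows "foldr pd w g x = foldr pd w h x"
  using assms(2) by (induction w arbitrary: x) (auto simp: assms(3) intro!: pd_cong[OF assms(1)])

lemma Ck_foldr_pd: "Ck (length w + k) S g \<Longrightarrow> Ck k S (foldr pd w g)"
  by (induction w arbitrary: k) (auto intro!: Ck_pd)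

lemma Cinf_foldr_pd: "Cinf S g \<Longrightarrow> Cinf S (foldr pd w g)"
  by (induction w) (auto intro: Cinf_pd)

lemma pd_foldr_pd_commute:
  assumes "open S" "Cinf S g" "x \<in> S"
  shows "pd i (foldr pd w g) x = foldr pd w (pd i g) x"
  using assms(3)
proof (induction w arbitrary: x)
  case (Cons a w)
  have "pd i (pd a (foldr pd w g)) x = pd a (pd i (foldr pd w g)) x"
    by (intro pd_commute[OF assms(1) _ Cons.prems] Cinf_Ck Cinf_foldr_pd assms(2))
  also have "\<dots> = pd a (foldr pd w (pd i g)) x"
    by (rule pd_cong[OF assms(1) Cons.prems]) (rule Cons.IH)
  finally show ?case by simp
qed simp

lemma foldr_pd_mset:
  assumes "open S" "Cinf S g" "x \<in> S" "mset w = mset w'"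
  shows "foldr pd w g x = foldr pd w' g x"
  using assms(3,4)
proof (induction w arbitrary: w' x)
  case (Cons i w)
  have "i \<in> set w'" using Cons.prems(2) by (metis list.set_intros(1) set_mset_mset)
  then obtain u v where w': "w' = u @ i # v" by (meson split_list)
  have m: "mset w = mset (u @ v)" using Cons.prems(2) by (simp add: w')
  have c: "Cinf S (foldr pd v g)" by (intro Cinf_foldr_pd assms)
  have "pd i (foldr pd w g) x = pd i (foldr pd (u @ v) g) x"
    by (rule pd_cong[OF assms(1) Cons.prems(1)]) (rule Cons.IH[OF _ m])
  also have "\<dots> = foldr pd u (pd i (foldr pd v g)) x"
    using pd_foldr_pd_commute[OF assms(1) c Cons.prems(1)] by simp
  finally show ?case by (simp add: w')
qed simp

lemma idx_enum: "distinct (idx_enum :: 'n::finite list)" "set (idx_enum :: 'n list) = UNIV"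
proof -
  have "\<exists>xs :: 'n list. distinct xs \<and> set xs = UNIV"
    using finite_distinct_list[of "UNIV :: 'n set"] by auto
  from someI_ex[OF this] show "distinct (idx_enum :: 'n list)" "set (idx_enum :: 'n list) = UNIV"
    by (auto simp: idx_enum_def)
qed

lemma count_concat_replicate:
  "distinct xs \<Longrightarrow> count (mset (concat (map (\<lambda>i. replicate (\<beta> i) i) xs))) j = (if j \<in> set xs then \<beta> j else 0)"
  by (induction xs) (auto simp: count_replicate_mset)

text \<open>\<open>Dm\<close> differentiates in an arbitrarily chosen order of the indices.
  Derivatives commute, so only the multiset of directions counts and the choice is
  immaterial.\<close>

lemma foldr_pd_eq_Dm:
  assumes "open S" "Cinf S g" "x \<in> S"
  shows "foldr pd w g x = Dm (count (mset w)) g x"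
  unfolding Dm_def
  by (rule foldr_pd_mset[OF assms], rule multiset_eqI)
     (simp add: count_concat_replicate[OF idx_enum(1)] idx_enum(2))

lemma mabs_count: "mabs (count (mset w)) = length (w :: 'n::finite list)"
proof -
  have "(\<Sum>i\<in>UNIV. count (mset w) i) = (\<Sum>i\<in>set w. count (mset w) i)"
    by (rule sum.mono_neutral_right) (auto simp: not_in_iff)
  then show ?thesis unfolding mabs_def
    using size_multiset_overloaded_eq[of "mset w"] by simp
qed

lemma finite_mabs_le: "finite {\<beta> :: 'n::finite \<Rightarrow> nat. mabs \<beta> \<le> k}"
proof (rule finite_subset)
  show "{\<beta> :: 'n \<Rightarrow> nat. mabs \<beta> \<le> k} \<subseteq> PiE UNIV (\<lambda>_. {..k})"
  proof (clarsimp simp: PiE_def)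
    fix \<beta> :: "'n \<Rightarrow> nat" and i assume b: "mabs \<beta> \<le> k"
    have "\<beta> i \<le> mabs \<beta>" unfolding mabs_def by (rule member_le_sum) auto
    then show "\<beta> i \<le> k" using b by simp
  qed
qed (auto intro: finite_PiE)

lemma finite_mabs_less: "finite {\<beta> :: 'n::finite \<Rightarrow> nat. mabs \<beta> < k}"
  by (rule finite_subset[OF _ finite_mabs_le[of k]]) auto

section \<open>Monomials\<close>

lemma Ck_mpow: "open S \<Longrightarrow> Ck k S (\<lambda>y. mpow y \<beta>)"
  unfolding mpow_def by (intro Ck_prod Ck_power Ck_nth)

text \<open>The truncated subtraction is harmless: where \<open>\<beta> i = 0\<close> the factor in
  front is 0.\<close>

lemma pd_mpow: "pd i (\<lambda>y. mpow y \<beta>) = (\<lambda>y. real (\<beta> i) * mpow (y :: real^'n::finite) (\<beta>(i := \<beta> i - 1)))"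
proof
  fix y :: "real^'n"
  let ?R = "\<lambda>y::real^'n. \<Prod>j\<in>UNIV - {i}. (y $ j) ^ \<beta> j"
  have split: "mpow z b = (z $ i) ^ b i * (\<Prod>j\<in>UNIV - {i}. (z $ j) ^ b j)" for z :: "real^'n" and b
    unfolding mpow_def by (simp add: prod.remove[of UNIV i])
  have "((\<lambda>t. mpow (y + t *\<^sub>R axis i 1) \<beta>) has_real_derivative
      real (\<beta> i) * (y $ i) ^ (\<beta> i - 1) * ?R y) (at 0)"
  proof -
    have "?R (y + t *\<^sub>R axis i 1) = ?R y" for t
      by (intro prod.cong refl) (auto simp: axis_def)
    then have eq: "mpow (y + t *\<^sub>R axis i 1) \<beta> = (y $ i + t) ^ \<beta> i * ?R y" for t
      by (simp add: split) 
    show ?thesis unfolding eq by (auto intro!: derivative_eq_intros)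
  qed
  moreover have "mpow y (\<beta>(i := \<beta> i - 1)) = (y $ i) ^ (\<beta> i - 1) * ?R y"
    unfolding split by (auto intro!: arg_cong2[where f="(*)"] prod.cong)
  ultimately have "has_pd (\<lambda>y. mpow y \<beta>) i (real (\<beta> i) * mpow y (\<beta>(i := \<beta> i - 1))) y"
    by (simp add: has_pd_def mult.assoc)
  then show "pd i (\<lambda>y. mpow y \<beta>) y = real (\<beta> i) * mpow y (\<beta>(i := \<beta> i - 1))"
    by (rule has_pd_imp_pd)
qed

lemma foldr_pd_cmult: "(\<And>k. Ck k UNIV g) \<Longrightarrow> foldr pd w (\<lambda>y. c * g y) = (\<lambda>y. c * foldr pd w g y)"
proof (induction w)
  case (Cons i w)
  have "Ck (Suc 0) UNIV (foldr pd w g)" by (intro Ck_foldr_pd Cons.prems)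
  then show ?case using Cons by (auto intro!: ext pd_cmult)
qed simp

text \<open>Monomials and derivatives at 0 are dual, so a Taylor polynomial has the prescribed
  derivatives. \<open>foldr\<close> applies the last letter first; peeling from the end therefore
  differentiates the monomial itself.\<close>

lemma foldr_pd_mpow_at_0:
  "foldr pd w (\<lambda>y. mpow y \<beta>) (0 :: real^'n::finite) = (if count (mset w) = \<beta> then mfact \<beta> else 0)"
proof (induction w arbitrary: \<beta> rule: rev_induct)
  case Nil
  show ?case
  proof (cases "\<beta> = (\<lambda>_. 0)")
    case True then show ?thesis by (simp add: mpow_def mfact_def)
  next
    case False
    then obtain i where "\<beta> i \<noteq> 0" by auto
    then have "mpow (0 :: real^'n) \<beta> = 0" unfolding mpow_def by (auto intro!: prod_zero bexI[of _ i])
    moreover have "count (mset []) \<noteq> \<beta>" using False by auto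
    ultimately show ?thesis by (simp only: foldr.simps id_apply if_False)
  qed
next
  case (snoc i w)
  let ?b = "\<beta>(i := \<beta> i - 1)"
  have "foldr pd (w @ [i]) (\<lambda>y. mpow y \<beta>) (0 :: real^'n) = real (\<beta> i) * foldr pd w (\<lambda>y. mpow y ?b) 0"
    by (simp add: pd_mpow foldr_pd_cmult Ck_mpow)
  also have "\<dots> = real (\<beta> i) * (if count (mset w) = ?b then mfact ?b else 0)"
    by (simp only: snoc)
  also have "\<dots> = (if count (mset (w @ [i])) = \<beta> then mfact \<beta> else 0)"
  proof (cases "\<beta> i")
    case 0
    then have "count (mset (w @ [i])) i \<noteq> \<beta> i" by simp
    then show ?thesis using 0 by (auto dest: fun_cong)
  next
    case (Suc k)
    have "count (mset (w @ [i])) = \<beta> \<longleftrightarrow> count (mset w) = ?b"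
    proof
      assume a: "count (mset (w @ [i])) = \<beta>"
      show "count (mset w) = ?b"
      proof
        fix j show "count (mset w) j = ?b j" using fun_cong[OF a, of j] by (cases "j = i") auto
      qed
    next
      assume a: "count (mset w) = ?b"
      show "count (mset (w @ [i])) = \<beta>"
      proof
        fix j show "count (mset (w @ [i])) j = \<beta> j" using fun_cong[OF a, of j] Suc by (cases "j = i") auto
      qed
    qed
    moreover have "real (\<beta> i) * mfact ?b = mfact \<beta>"
    proof -
      have "(\<Prod>j\<in>UNIV - {i}. fact (?b j)) = (\<Prod>j\<in>UNIV - {i}. fact (\<beta> j) :: real)"
        by (intro prod.cong) auto
      then show ?thesis unfolding mfact_def
        by (simp add: prod.remove[of UNIV i] Suc del: fun_upd_apply) (simp add: Suc)
    qed
    ultimately show ?thesis by simp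
  qed
  finally show ?case .
qed

text \<open>Every Laplacian lowers the degree by two, and degree below \<open>2 * m\<close> does not
  survive \<open>m\<close> of them.\<close>

lemma polylap_mpow:
  "mabs \<beta> < 2 * m \<Longrightarrow> polylap m (\<lambda>y. mpow y \<beta>) = (\<lambda>y :: real^'n::finite. 0)"
proof (induction m arbitrary: \<beta>)
  case (Suc m)
  have Suc_eq: "polylap (Suc m) g y = - polylap m (lap g) y" if "Cinf UNIV g" for g :: "real^'n \<Rightarrow> real" and y
  proof -
    have "polylap m (\<lambda>x. - lap g x) y = - polylap m (lap g) y"
      using polylap_cmult[of UNIV m "lap g" y "-1"] Ck_lap[of UNIV "2*m" g] that by (simp add: Cinf_def)
    moreover have "polylap (Suc m) g = polylap m (\<lambda>x. - lap g x)"
      unfolding polylap_def by (simp only: funpow_Suc_right comp_def)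
    ultimately show ?thesis by simp
  qed
  \<comment> \<open>\<open>c i\<close> vanishes for \<open>\<beta> i < 2\<close>, which makes the
    truncated subtractions in \<open>c\<close> and \<open>b\<close> harmless.\<close>
  define c where "c i = real (\<beta> i) * real (\<beta> i - 1)" for i
  define b where "b i = \<beta>(i := \<beta> i - 2)" for i
  have lap: "lap (\<lambda>y. mpow y \<beta>) = (\<lambda>y :: real^'n. \<Sum>i\<in>UNIV. c i * mpow y (b i))"
  proof -
    have "pd i (pd i (\<lambda>y. mpow y \<beta>)) y = c i * mpow y (b i)" for i and y :: "real^'n"
    proof -
      have "pd i (pd i (\<lambda>y. mpow y \<beta>)) y = real (\<beta> i) * pd i (\<lambda>y. mpow y (\<beta>(i := \<beta> i - 1))) y"
        by (subst pd_mpow[of i \<beta>]) (rule pd_cmult[OF Ck_mpow[OF open_UNIV, of "Suc 0"] UNIV_I])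
      also have "\<dots> = c i * mpow y (b i)"
        by (simp add: pd_mpow c_def b_def diff_diff_left numeral_2_eq_2)
      finally show ?thesis .
    qed
    then show ?thesis by (auto simp: lap_def)
  qed
  have "polylap m (lap (\<lambda>y. mpow y \<beta>)) y = 0" for y :: "real^'n"
  proof -
    have "polylap m (lap (\<lambda>y. mpow y \<beta>)) y = (\<Sum>i\<in>UNIV. polylap m (\<lambda>y. c i * mpow y (b i)) y)"
      unfolding lap by (rule polylap_sum[OF open_UNIV Ck_cmult[OF open_UNIV Ck_mpow[OF open_UNIV]] UNIV_I])
    also have "\<dots> = (\<Sum>i\<in>UNIV. c i * polylap m (\<lambda>y. mpow y (b i)) y)"
      by (intro sum.cong refl polylap_cmult[OF open_UNIV] Ck_mpow) auto
    also have "\<dots> = 0"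
    proof (intro sum.neutral ballI)
      fix i
      show "c i * polylap m (\<lambda>y. mpow y (b i)) y = 0"
      proof (cases "\<beta> i \<ge> 2")
        case True
        have "mabs (b i) + 2 = mabs \<beta>"
        proof -
          have "sum (b i) (UNIV - {i}) = sum \<beta> (UNIV - {i})" by (intro sum.cong) (auto simp: b_def)
          then show ?thesis using True unfolding mabs_def by (simp add: sum.remove[of UNIV i]) (simp add: b_def)
        qed
        then show ?thesis using Suc.IH[of "b i"] Suc.prems by simp
      next
        case False
        then have "c i = 0" by (cases "\<beta> i") (auto simp: c_def)
        then show ?thesis by simp
      qed
    qed
    finally show ?thesis .
  qed
  then show ?case using Suc_eq[of "\<lambda>y. mpow y \<beta>"] by (auto simp: Cinf_def Ck_mpow)
qed simp

section \<open>Integration by parts and radial integrals\<close>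

definition csupp :: "(real^'n::finite \<Rightarrow> real) \<Rightarrow> bool" where
  "csupp g \<longleftrightarrow> (\<exists>R>0. \<forall>y. R \<le> norm y \<longrightarrow> g y = 0)"

lemma csupp_mult_left: "csupp h \<Longrightarrow> csupp (\<lambda>y. g y * h y)"
  unfolding csupp_def by (metis mult_zero_right)

lemma csupp_mult_right: "csupp g \<Longrightarrow> csupp (\<lambda>y. g y * h y)"
  unfolding csupp_def by (metis mult_zero_left)

lemma csupp_sum: "(\<And>a. a \<in> A \<Longrightarrow> csupp (g a)) \<Longrightarrow> csupp (\<lambda>y. \<Sum>a\<in>A. g a y)"
proof (induction A rule: infinite_finite_induct)
  case (insert a A)
  obtain R1 where 1: "R1 > 0" "\<And>y. R1 \<le> norm y \<Longrightarrow> g a y = 0"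
    using insert.prems[of a] by (auto simp: csupp_def)
  obtain R2 where 2: "R2 > 0" "\<And>y. R2 \<le> norm y \<Longrightarrow> (\<Sum>a\<in>A. g a y) = 0"
    using insert.IH insert.prems by (auto simp: csupp_def)
  show ?case unfolding csupp_def
    by (rule exI[of _ "max R1 R2"]) (use 1 2 insert.hyps in auto)
qed (auto simp: csupp_def intro: exI[of _ 1])

lemma open_norm_gt: "open {y :: 'a::real_normed_vector. R < norm y}"
  by (intro open_Collect_less continuous_intros)

lemma csupp_pd:
  assumes "csupp g"
  shows "csupp (pd i g)"
proof -
  obtain R where R: "R > 0" "\<And>y. R \<le> norm y \<Longrightarrow> g y = 0" using assms by (auto simp: csupp_def)
  \<comment> \<open>The radius grows because the derivative needs a whole neighbourhood on which
    \<open>g\<close> vanishes.\<close>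
  have "pd i g y = 0" if "R + 1 \<le> norm y" for y
    using pd_cong[OF open_norm_gt[of R], of y g "\<lambda>_. 0" i] that R by auto
  then show ?thesis unfolding csupp_def using R(1) by (intro exI[of _ "R + 1"]) auto
qed

lemma csupp_lap: "csupp g \<Longrightarrow> csupp (lap g)"
  unfolding lap_def[abs_def] by (intro csupp_sum csupp_pd)

lemma csupp_uminus: "csupp g \<Longrightarrow> csupp (\<lambda>y. - g y)"
  by (auto simp: csupp_def)

lemma csupp_polylap: "csupp g \<Longrightarrow> csupp (polylap m g)"
  by (induction m) (auto simp: polylap_Suc intro: csupp_uminus csupp_lap)

lemma integrable_continuous_csupp:
  assumes "continuous_on UNIV g" "csupp g"
  shows "integrable lborel g"
proof -
  obtain R where R: "\<And>y. R \<le> norm y \<Longrightarrow> g y = 0" using assms by (auto simp: csupp_def)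
  have "integrable lborel (\<lambda>y. indicator (cball 0 R) y *\<^sub>R g y)"
    by (rule borel_integrable_compact) (auto intro: continuous_on_subset[OF assms(1)])
  moreover have "(\<lambda>y. indicator (cball 0 R) y *\<^sub>R g y) = g"
    using R by (auto simp: indicator_def fun_eq_iff)
  ultimately show ?thesis by simp
qed

lemma bounded_continuous_csupp:
  assumes "continuous_on UNIV g" "csupp g"
  obtains B where "B > 0" "\<And>y. \<bar>g y\<bar> \<le> B"
proof -
  obtain R where R: "\<And>y. R \<le> norm y \<Longrightarrow> g y = 0" using assms by (auto simp: csupp_def)
  have "compact (g ` cball 0 R)"
    by (rule compact_continuous_image) (auto intro: continuous_on_subset[OF assms(1)])
  then obtain B where B: "B > 0" "\<And>y. norm y \<le> R \<Longrightarrow> \<bar>g y\<bar> \<le> B"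
    using compact_imp_bounded bounded_pos by (metis image_eqI mem_cball_0 real_norm_def)
  have "\<bar>g y\<bar> \<le> B" for y using R[of y] B by (cases "norm y \<le> R") auto
  with B(1) show ?thesis by (rule that)
qed

lemma lborel_integral_affine:
  fixes f :: "'a::euclidean_space \<Rightarrow> real"
  assumes "c \<noteq> 0" "f \<in> borel_measurable borel"
  shows "(\<integral>x. f x \<partial>lborel) = \<bar>c\<bar> ^ DIM('a) * (\<integral>x. f (t + c *\<^sub>R x) \<partial>lborel)"
  by (subst lborel_affine[OF assms(1), of t])
     (simp add: integral_density integral_distr assms(2))

lemma lborel_integrable_affine:
  fixes f :: "'a::euclidean_space \<Rightarrow> real"
  assumes "c \<noteq> 0" "integrable lborel f"
  shows "integrable lborel (\<lambda>x. f (t + c *\<^sub>R x))"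
proof -
  have m: "f \<in> borel_measurable borel" using assms(2) by auto
  have "integrable (density (distr lborel borel (\<lambda>x. t + c *\<^sub>R x)) (\<lambda>_. \<bar>c\<bar> ^ DIM('a))) f"
    using assms(2) by (subst (asm) lborel_affine[OF assms(1), of t])
  then show ?thesis using assms(1) m
    by (simp add: integrable_density integrable_distr_eq)
qed

text \<open>Translation invariance gives every difference quotient integral 0, and the quotients
  converge dominatedly to the derivative. Neither iterated integrals nor boundaries occur.\<close>

lemma integral_pd_eq_0:
  fixes g :: "real^'n::finite \<Rightarrow> real"
  assumes g: "Ck (Suc 0) UNIV g" and cs: "csupp g"
  shows "(\<integral>y. pd i g y \<partial>lborel) = 0"
proof -
  obtain R where R: "R > 0" "\<And>y. R \<le> norm y \<Longrightarrow> g y = 0" using cs by (auto simp: csupp_def)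
  have cg: "continuous_on UNIV g" using g by (rule Ck_continuous_on)
  have cp: "continuous_on UNIV (pd i g)" using Ck_continuous_on[OF Ck_pd[OF g]] .
  obtain B where B: "B > 0" "\<And>y. \<bar>pd i g y\<bar> \<le> B"
    using bounded_continuous_csupp[OF cp csupp_pd[OF cs]] by blast
  \<comment> \<open>Steps of length at most 1 keep all quotients supported in the ball of radius
    \<open>R + 1\<close>.\<close>
  define h where "h k = 1 / real (Suc k)" for k
  have h: "h k > 0" "h k \<le> 1" for k by (auto simp: h_def)
  have h0: "h \<longlonglongrightarrow> 0" unfolding h_def using LIMSEQ_inverse_real_of_nat by (simp add: inverse_eq_divide)
  define q where "q k y = (g (y + h k *\<^sub>R axis i 1) - g y) / h k" for k y
  have int: "integrable lborel g" by (rule integrable_continuous_csupp[OF cg cs])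
  have mg: "g \<in> borel_measurable borel" using cg by (rule borel_measurable_continuous_onI)
  have q0: "(\<integral>y. q k y \<partial>lborel) = 0" for k
  proof -
    have "integrable lborel (\<lambda>y. g (h k *\<^sub>R axis i 1 + 1 *\<^sub>R y))"
      by (rule lborel_integrable_affine[OF _ int]) simp
    then show ?thesis
      using lborel_integral_affine[of 1 g "h k *\<^sub>R axis i 1"] mg int
      unfolding q_def by (simp add: add.commute)
  qed
  have "(\<lambda>k. \<integral>y. q k y \<partial>lborel) \<longlonglongrightarrow> (\<integral>y. pd i g y \<partial>lborel)"
  proof (rule integral_dominated_convergence[where w="\<lambda>y. B * indicator (cball 0 (R + 1)) y"])
    show "pd i g \<in> borel_measurable lborel" using cp by (simp add: borel_measurable_continuous_onI)
    show "q k \<in> borel_measurable lborel" for k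
      unfolding q_def using cg by (auto intro!: borel_measurable_continuous_onI continuous_intros continuous_on_compose2[OF cg] simp: h_def)
    show "integrable lborel (\<lambda>y. B * indicator (cball 0 (R + 1)) y :: real)"
      by (intro integrable_mult_right integrable_real_indicator emeasure_bounded_finite) auto
    show "AE y in lborel. (\<lambda>k. q k y) \<longlonglongrightarrow> pd i g y"
    proof (rule AE_I2)
      fix y
      have "((\<lambda>t. (g (y + (0 + t) *\<^sub>R axis i 1) - g (y + 0 *\<^sub>R axis i 1)) / t) \<longlongrightarrow> pd i g y) (at 0)"
        using Ck_Suc_has_pd[OF g, of y i] unfolding has_pd_def DERIV_def by simp
      moreover have "filterlim h (at 0) sequentially"
        using h0 h(1) by (auto simp: filterlim_at intro!: always_eventually) (metis less_irrefl)
      ultimately show "(\<lambda>k. q k y) \<longlonglongrightarrow> pd i g y"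
        unfolding q_def by (auto dest: filterlim_compose)
    qed
    show "AE y in lborel. norm (q k y) \<le> B * indicator (cball 0 (R + 1)) y" for k
    proof (rule AE_I2)
      fix y
      have "\<bar>g (y + h k *\<^sub>R axis i 1) - g y - 0 * h k\<bar> \<le> B * \<bar>h k\<bar>"
        by (rule has_pd_line_bound[where d="\<lambda>t. pd i g (y + t *\<^sub>R axis i 1)"])
           (auto intro: Ck_Suc_has_pd[OF g] B)
      then have b: "\<bar>q k y\<bar> \<le> B" unfolding q_def using h(1)[of k] by (simp add: field_simps)
      show "norm (q k y) \<le> B * indicator (cball 0 (R + 1)) y"
      proof (cases "norm y \<le> R + 1")
        case False
        have "norm (h k *\<^sub>R axis i (1::real)) \<le> 1" using h[of k] by simp
        then have "R \<le> norm (y + h k *\<^sub>R axis i 1)"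
          using False norm_diff_ineq[of y "h k *\<^sub>R axis i 1"] by linarith
        then have "q k y = 0" unfolding q_def using False R by simp
        then show ?thesis using B by simp
      qed (use b in auto)
    qed
  qed
  then show ?thesis by (simp add: q0 LIMSEQ_const_iff)
qed

lemma integral_by_parts_pd:
  fixes g h :: "real^'n::finite \<Rightarrow> real"
  assumes g: "Ck (Suc 0) UNIV g" and h: "Ck (Suc 0) UNIV h" and cs: "csupp h"
  shows "(\<integral>y. g y * pd i h y \<partial>lborel) = - (\<integral>y. pd i g y * h y \<partial>lborel)"
proof -
  have "(\<integral>y. pd i (\<lambda>y. g y * h y) y \<partial>lborel) = 0"
    by (intro integral_pd_eq_0 Ck_mult g h csupp_mult_left cs open_UNIV)
  moreover have "pd i (\<lambda>y. g y * h y) y = pd i g y * h y + g y * pd i h y" for y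
    by (rule pd_mult[OF g h UNIV_I])
  moreover have "integrable lborel (\<lambda>y. pd i g y * h y)"
    by (intro integrable_continuous_csupp continuous_on_mult csupp_mult_left cs
        Ck_continuous_on[OF Ck_pd[OF g]] Ck_continuous_on[OF h])
  moreover have "integrable lborel (\<lambda>y. g y * pd i h y)"
    by (intro integrable_continuous_csupp continuous_on_mult csupp_mult_left csupp_pd cs
        Ck_continuous_on[OF Ck_pd[OF h]] Ck_continuous_on[OF g])
  ultimately show ?thesis by simp
qed

lemma integral_by_parts_lap:
  fixes g h :: "real^'n::finite \<Rightarrow> real"
  assumes "Ck 2 UNIV g" "Ck 2 UNIV h" "csupp h"
  shows "(\<integral>y. g y * lap h y \<partial>lborel) = (\<integral>y. lap g y * h y \<partial>lborel)"
proof -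
  have g: "Ck (Suc (Suc 0)) UNIV g" and h: "Ck (Suc (Suc 0)) UNIV h"
    using assms by (simp_all add: numeral_2_eq_2)
  have i1: "integrable lborel (\<lambda>y. g y * pd i (pd i h) y)" for i
    by (intro integrable_continuous_csupp continuous_on_mult csupp_mult_left csupp_pd assms
        Ck_continuous_on[OF Ck_pd[OF Ck_pd[OF h]]] Ck_continuous_on[OF g])
  have i2: "integrable lborel (\<lambda>y. pd i (pd i g) y * h y)" for i
    by (intro integrable_continuous_csupp continuous_on_mult csupp_mult_left assms
        Ck_continuous_on[OF Ck_pd[OF Ck_pd[OF g]]] Ck_continuous_on[OF h])
  have eq: "(\<integral>y. g y * pd i (pd i h) y \<partial>lborel) = (\<integral>y. pd i (pd i g) y * h y \<partial>lborel)" for i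
    using integral_by_parts_pd[where i=i, OF Ck_SucD[OF g] Ck_pd[OF h, of i] csupp_pd[OF assms(3)]]
      integral_by_parts_pd[where i=i, OF Ck_pd[OF g, of i] Ck_SucD[OF h] assms(3)] by simp
  have "(\<integral>y. g y * lap h y \<partial>lborel) = (\<Sum>i\<in>UNIV. \<integral>y. g y * pd i (pd i h) y \<partial>lborel)"
    unfolding lap_def sum_distrib_left using i1 by (intro Bochner_Integration.integral_sum) auto
  also have "\<dots> = (\<Sum>i\<in>UNIV. \<integral>y. pd i (pd i g) y * h y \<partial>lborel)" by (simp add: eq)
  also have "\<dots> = (\<integral>y. lap g y * h y \<partial>lborel)"
    unfolding lap_def sum_distrib_right using i2 by (intro Bochner_Integration.integral_sum[symmetric]) auto
  finally show ?thesis .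
qed

lemma polylap_Suc_right: "polylap (Suc m) g = polylap m (\<lambda>x. - lap g x)"
  unfolding polylap_def by (simp only: funpow_Suc_right comp_def)

text \<open>Compact support is asked of \<open>h\<close> only, so that \<open>g\<close> may be a
  polynomial.\<close>

lemma integral_by_parts_polylap:
  fixes g h :: "real^'n::finite \<Rightarrow> real"
  assumes "Ck (2 * m) UNIV g" "Ck (2 * m) UNIV h" "csupp h"
  shows "(\<integral>y. g y * polylap m h y \<partial>lborel) = (\<integral>y. polylap m g y * h y \<partial>lborel)"
  using assms(1,2)
proof (induction m arbitrary: g)
  case (Suc m)
  have m: "Ck (Suc (Suc (2 * m))) UNIV g" "Ck (2 * m + 2) UNIV h" using Suc.prems by simp_all
  have h2: "Ck (2 * m) UNIV h" using Ck_le[OF m(2), of "2 * m"] by simp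
  have lg: "Ck (2 * m) UNIV (\<lambda>y. - lap g y)" by (intro Ck_uminus Ck_lap m open_UNIV)
  have "(\<integral>y. g y * lap (polylap m h) y \<partial>lborel) = (\<integral>y. lap g y * polylap m h y \<partial>lborel)"
    by (intro integral_by_parts_lap Ck_le[OF m(1)] Ck_polylap m(2) csupp_polylap assms open_UNIV) auto
  then have "(\<integral>y. g y * polylap (Suc m) h y \<partial>lborel) = (\<integral>y. - lap g y * polylap m h y \<partial>lborel)"
    by (simp add: polylap_Suc)
  also have "\<dots> = (\<integral>y. polylap (Suc m) g y * h y \<partial>lborel)"
    using Suc.IH[OF lg h2] by (simp add: polylap_Suc_right)
  finally show ?case .
qed simp

lemma polylap_affine:
  fixes g :: "real^'n::finite \<Rightarrow> real"
  assumes "open S" "Ck (2 * m) S g" "a + c *\<^sub>R y \<in> S"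
  shows "polylap m (\<lambda>y. g (a + c *\<^sub>R y)) y = c ^ (2 * m) * polylap m g (a + c *\<^sub>R y)"
  using assms(2,3)
proof (induction m arbitrary: y)
  case (Suc m)
  let ?T = "{y. a + c *\<^sub>R y \<in> S}"
  have op: "open ?T"
    using open_vimage[OF assms(1), of "\<lambda>y. a + c *\<^sub>R y"] by (simp add: vimage_def continuous_intros)
  have m: "Ck (2 * m + 2) S g" "Ck (2 * m) S g" using Suc.prems(1) Ck_le[of "2 * Suc m" S g "2 * m"] by auto
  let ?p = "polylap m g"
  have p2: "Ck (Suc (Suc 0)) S ?p"
    using Ck_polylap[OF assms(1) m(1)] by (simp add: numeral_2_eq_2)
  have p2': "Ck 2 ?T (\<lambda>y. ?p (a + c *\<^sub>R y))"
    using Ck_affine[OF assms(1) p2, of a c] by (simp add: numeral_2_eq_2)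
  have "lap (polylap m (\<lambda>y. g (a + c *\<^sub>R y))) y = lap (\<lambda>y. c ^ (2 * m) * ?p (a + c *\<^sub>R y)) y"
    using Suc.prems by (intro lap_cong[OF op] Suc.IH m) auto
  also have "\<dots> = c ^ (2 * m) * lap (\<lambda>y. ?p (a + c *\<^sub>R y)) y"
    using Suc.prems by (intro lap_cmult[OF op p2']) auto
  also have "lap (\<lambda>y. ?p (a + c *\<^sub>R y)) y = c * c * lap ?p (a + c *\<^sub>R y)"
  proof -
    have "pd i (pd i (\<lambda>y. ?p (a + c *\<^sub>R y))) y = c * c * pd i (pd i ?p) (a + c *\<^sub>R y)" for i
    proof -
      have "pd i (pd i (\<lambda>y. ?p (a + c *\<^sub>R y))) y = pd i (\<lambda>y. c * pd i ?p (a + c *\<^sub>R y)) y"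
        using Suc.prems(2) by (intro pd_cong[OF op] pd_affine[OF p2]) auto
      also have "\<dots> = c * pd i (\<lambda>y. pd i ?p (a + c *\<^sub>R y)) y"
        using Suc.prems(2) by (intro pd_cmult[OF Ck_affine[OF assms(1) Ck_pd[OF p2]]]) auto
      also have "\<dots> = c * (c * pd i (pd i ?p) (a + c *\<^sub>R y))"
        using Suc.prems(2) by (subst pd_affine[OF Ck_pd[OF p2]]) auto
      finally show ?thesis by simp
    qed
    then show ?thesis by (simp add: lap_def sum_distrib_left)
  qed
  finally show ?case by (simp add: polylap_Suc algebra_simps power2_eq_square)
qed simp

section \<open>Polar coordinates for radial integrands\<close>

lemma distr_lborel_norm:
  "distr (lborel :: 'a::euclidean_space measure) borel norm
   = density lborel (\<lambda>r. ennreal (real DIM('a) * unit_ball_vol DIM('a) * r ^ (DIM('a) - 1) * indicator {0..} r))"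
proof -
  let ?n = "DIM('a)"
  let ?d = "\<lambda>r::real. ennreal (real ?n * unit_ball_vol ?n * r ^ (?n - 1) * indicator {0..} r)"
  have 1: "emeasure (distr (lborel :: 'a measure) borel norm) {..a} = emeasure (lborel :: 'a measure) (cball 0 a)" for a
    by (subst emeasure_distr) (auto intro!: arg_cong[where f="emeasure lborel"])
  \<comment> \<open>Half-lines generate the Borel sets and are stable under intersection, so
    agreement on them suffices: one side is the volume of a ball, the other the integral of its
    derivative in the radius.\<close>
  have em: "emeasure (distr (lborel :: 'a measure) borel norm) {..a} = emeasure (density lborel ?d) {..a}" for a :: real
  proof -
    have 2: "emeasure (density lborel ?d) {..a} = (\<integral>\<^sup>+ r. ?d r * indicator {..a} r \<partial>lborel)"
      by (subst emeasure_density) auto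
    show ?thesis
    proof (cases "a \<ge> 0")
      case True
      have "(\<integral>\<^sup>+ r. ?d r * indicator {..a} r \<partial>lborel)
          = (\<integral>\<^sup>+ r. ennreal (real ?n * unit_ball_vol ?n * r ^ (?n - 1)) * indicator {0..a} r \<partial>lborel)"
        by (intro nn_integral_cong) (auto simp: indicator_def)
      also have "\<dots> = ennreal (unit_ball_vol ?n * a ^ ?n - unit_ball_vol ?n * 0 ^ ?n)"
        using True
        by (intro nn_integral_FTC_Icc) (auto intro!: derivative_eq_intros mult_nonneg_nonneg unit_ball_vol_nonneg)
      also have "\<dots> = emeasure (lborel :: 'a measure) (cball 0 a)"
        using True by (simp add: emeasure_cball)
      finally show ?thesis by (simp only: 1 2)
    next
      case False
      have "?d r * indicator {..a} r = 0" for r using False by (auto simp: indicator_def)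
      then have "(\<integral>\<^sup>+ r. ?d r * indicator {..a} r \<partial>lborel) = 0" by (simp only: nn_integral_const mult_zero_left)
      then show ?thesis using False by (simp only: 1 2) simp
    qed
  qed
  show ?thesis
  proof (rule measure_eqI_generator_eq[where E="range atMost" and \<Omega>=UNIV and A="\<lambda>i::nat. {..real i}"])
    show "Int_stable (range (atMost :: real \<Rightarrow> _))" by (auto simp: Int_stable_def)
    show "sets (distr (lborel :: 'a measure) borel norm) = sigma_sets UNIV (range atMost)"
      unfolding sets_distr borel_eq_atMost by (auto simp: sets_measure_of image_def)
    show "sets (density lborel ?d) = sigma_sets UNIV (range atMost)"
      unfolding sets_density sets_lborel borel_eq_atMost by (auto simp: sets_measure_of image_def)
    show "(\<Union>i. {..real i}) = UNIV" by (auto simp: real_arch_simple)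
    show "emeasure (distr (lborel :: 'a measure) borel norm) {..real i} \<noteq> \<infinity>" for i
      by (simp add: 1 emeasure_cball)
  qed (auto simp: em)
qed

lemma nn_integral_radial:
  fixes g :: "real \<Rightarrow> ennreal"
  assumes [measurable]: "g \<in> borel_measurable borel"
  shows "(\<integral>\<^sup>+ y. g (norm (y :: 'a::euclidean_space)) \<partial>lborel)
    = (\<integral>\<^sup>+ r. ennreal (real DIM('a) * unit_ball_vol DIM('a) * r ^ (DIM('a) - 1) * indicator {0..} r) * g r \<partial>lborel)"
proof -
  have "(\<integral>\<^sup>+ y. g (norm (y :: 'a)) \<partial>lborel) = (\<integral>\<^sup>+ r. g r \<partial>distr (lborel :: 'a measure) borel norm)"
    by (subst nn_integral_distr) auto
  also have "\<dots> = (\<integral>\<^sup>+ r. ennreal (real DIM('a) * unit_ball_vol DIM('a) * r ^ (DIM('a) - 1) * indicator {0..} r) * g r \<partial>lborel)"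
    unfolding distr_lborel_norm by (subst nn_integral_density) auto
  finally show ?thesis .
qed

text \<open>The radial density turns the integrand into a multiple of r^(b + n - 1), integrable at 0
  exactly under the hypothesis.\<close>

lemma integrable_norm_powr:
  assumes b: "b > - real DIM('a::euclidean_space)"
  shows "integrable lborel (\<lambda>y::'a. norm y powr b * indicator (cball 0 R) y)"
proof (rule integrableI_nonneg)
  let ?n = "DIM('a)" and ?g = "\<lambda>r. ennreal (r powr b * indicator {..R} r)"
  let ?c = "real ?n * unit_ball_vol ?n"
  show "(\<lambda>y::'a. norm y powr b * indicator (cball 0 R) y) \<in> borel_measurable lborel"
    by (intro borel_measurable_times borel_measurable_indicator) auto
  have c: "?c \<ge> 0" by simp
  have "(\<integral>\<^sup>+ y. ennreal (norm (y::'a) powr b * indicator (cball 0 R) y) \<partial>lborel) = (\<integral>\<^sup>+ y. ?g (norm (y::'a)) \<partial>lborel)"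
    by (intro nn_integral_cong) (auto simp: indicator_def)
  also have "\<dots> = (\<integral>\<^sup>+ r. ennreal (?c * r ^ (?n - 1) * indicator {0..} r) * ?g r \<partial>lborel)"
    by (rule nn_integral_radial) simp
  also have "\<dots> = (\<integral>\<^sup>+ r. ennreal (indicator {0..max 0 R} r * (?c * r powr (b + real ?n - 1))) \<partial>lborel)"
  proof (rule nn_integral_cong)
    fix r :: real
    have "r ^ (?n - 1) * r powr b = r powr (b + real ?n - 1)" if "r > 0"
      using that by (simp add: powr_realpow[symmetric] powr_add[symmetric] of_nat_diff Suc_le_eq algebra_simps)
    then show "ennreal (?c * r ^ (?n - 1) * indicator {0..} r) * ?g r
       = ennreal (indicator {0..max 0 R} r * (?c * r powr (b + real ?n - 1)))"
      by (cases "r > 0") (auto simp: indicator_def ennreal_mult'[symmetric] mult.assoc)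
  qed
  also have "\<dots> = ennreal (?c * (max 0 R powr (b + real ?n - 1 + 1) / (b + real ?n - 1 + 1)))"
  proof (rule nn_integral_has_integral_lebesgue)
    show "0 \<le> ?c * r powr (b + real ?n - 1)" for r using c by (intro mult_nonneg_nonneg) auto
    show "((\<lambda>r. ?c * r powr (b + real ?n - 1)) has_integral
        ?c * (max 0 R powr (b + real ?n - 1 + 1) / (b + real ?n - 1 + 1))) {0..max 0 R}"
      by (rule has_integral_mult_right[OF has_integral_powr_from_0]) (use b in auto)
  qed
  finally show "(\<integral>\<^sup>+ y. ennreal (norm (y::'a) powr b * indicator (cball 0 R) y) \<partial>lborel) < \<infinity>" by simp
qed auto

text \<open>Up to a constant the integrand is the Laplacian of (1 + |z|^2)^(1 - n/2), or of ln (1 +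
  |z|^2) when n = 2: the regularised fundamental solution at scale 1.\<close>

lemma integral_bubble:
  defines "n \<equiv> real DIM('a::euclidean_space)"
  shows "integrable lborel (\<lambda>z::'a. (1 + (norm z)\<^sup>2) powr (- n / 2 - 1))"
    and "(\<integral>z. (1 + (norm (z::'a))\<^sup>2) powr (- n / 2 - 1) \<partial>lborel) = unit_ball_vol n"
proof -
  let ?g = "\<lambda>r. ennreal ((1 + r\<^sup>2) powr (- n / 2 - 1))"
  let ?V = "unit_ball_vol n"
  \<comment> \<open>An antiderivative of the radial density \<open>?f\<close>. For r > 0 it equals
    \<open>?V\<close> times (r^2 / (1 + r^2))^(n/2), so it climbs from 0 to
    \<open>?V\<close>.\<close>
  let ?F = "\<lambda>r::real. ?V * (r ^ DIM('a) * (1 + r\<^sup>2) powr (- n / 2))"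
  let ?f = "\<lambda>r::real. n * ?V * r ^ (DIM('a) - 1) * (1 + r\<^sup>2) powr (- n / 2 - 1)"
  have n: "n > 0" by (simp add: n_def)
  have pos: "1 + r\<^sup>2 > 0" for r :: real by (simp add: add_pos_nonneg)
  have deriv: "(?F has_real_derivative ?f r) (at r)" for r
  proof -
    have "(?F has_real_derivative ?V * (n * r ^ (DIM('a) - 1) * (1 + r\<^sup>2) powr (- n / 2)
        + r ^ DIM('a) * ((- n / 2) * (1 + r\<^sup>2) powr (- n / 2 - 1) * (2 * r)))) (at r)"
      using pos[of r] by (auto intro!: derivative_eq_intros simp: n_def)
    moreover have "?V * (n * r ^ (DIM('a) - 1) * (1 + r\<^sup>2) powr (- n / 2)
        + r ^ DIM('a) * ((- n / 2) * (1 + r\<^sup>2) powr (- n / 2 - 1) * (2 * r))) = ?f r"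
    proof -
      have 1: "(1 + r\<^sup>2) powr (- n / 2) = (1 + r\<^sup>2) powr (- n / 2 - 1) * (1 + r\<^sup>2)"
        using pos[of r] powr_add[of "1 + r\<^sup>2" "- n / 2 - 1" 1] by simp
      have 2: "r ^ DIM('a) * r = r ^ (DIM('a) - 1) * r\<^sup>2"
        by (cases "DIM('a)") (auto simp: power2_eq_square)
      have "?V * (n * p * (X * (1 + r\<^sup>2)) + q * ((- n / 2) * X * (2 * r))) = n * ?V * X * (p * (1 + r\<^sup>2) - q * r)"
        for p q X :: real by (simp add: algebra_simps)
      then show ?thesis unfolding 1 by (simp only: 2) (simp add: algebra_simps)
    qed
    ultimately show ?thesis by (rule DERIV_cong)
  qed
  have lim: "(?F \<longlongrightarrow> ?V * 1) at_top"
  proof (rule tendsto_mult_left)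
    have "((\<lambda>r::real. (r\<^sup>2 / (1 + r\<^sup>2)) powr (n / 2)) \<longlongrightarrow> 1 powr (n / 2)) at_top"
    proof (rule tendsto_powr)
      have "((\<lambda>r::real. 1 - inverse (1 + r\<^sup>2)) \<longlongrightarrow> 1 - 0) at_top"
        by (intro tendsto_diff tendsto_const tendsto_inverse_0_at_top filterlim_tendsto_add_at_top[OF tendsto_const]
            filterlim_pow_at_top filterlim_ident) auto
      then show "((\<lambda>r::real. r\<^sup>2 / (1 + r\<^sup>2)) \<longlongrightarrow> 1) at_top"
        by (rule filterlim_cong[THEN iffD1, rotated -1]) (auto simp: field_simps pos less_imp_neq[symmetric, OF pos])
    qed auto
    moreover have "\<forall>\<^sub>F r in at_top. (r\<^sup>2 / (1 + r\<^sup>2)) powr (n / 2) = r ^ DIM('a) * (1 + r\<^sup>2) powr (- n / 2)"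
      using eventually_gt_at_top[of 0]
    proof eventually_elim
      case (elim r)
      have "r\<^sup>2 = r powr 2" using elim by simp
      then have "(r\<^sup>2) powr (n / 2) = r powr n"
        by (simp only: powr_powr) simp
      then have "(r\<^sup>2) powr (n / 2) = r ^ DIM('a)"
        using elim by (simp add: n_def powr_realpow)
      moreover have "(r\<^sup>2 / (1 + r\<^sup>2)) powr (n / 2) = (r\<^sup>2) powr (n / 2) / (1 + r\<^sup>2) powr (n / 2)"
        by (rule powr_divide)
      moreover have "(1 + r\<^sup>2) powr (- n / 2) = 1 / (1 + r\<^sup>2) powr (n / 2)"
        using powr_minus_divide[of "1 + r\<^sup>2" "n / 2"] by simp
      ultimately show ?case by simp
    qed
    ultimately show "((\<lambda>r::real. r ^ DIM('a) * (1 + r\<^sup>2) powr (- n / 2)) \<longlongrightarrow> 1) at_top"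
      using tendsto_cong by fastforce
  qed
  have "(\<integral>\<^sup>+ z. ?g (norm (z::'a)) \<partial>lborel)
      = (\<integral>\<^sup>+ r. ennreal (n * ?V * r ^ (DIM('a) - 1) * indicator {0..} r) * ?g r \<partial>lborel)"
    unfolding n_def by (rule nn_integral_radial) simp
  also have "\<dots> = (\<integral>\<^sup>+ r. ennreal (?f r) * indicator {0..} r \<partial>lborel)"
    using n by (intro nn_integral_cong) (auto simp: indicator_def ennreal_mult'[symmetric])
  also have "\<dots> = ennreal (?V * 1 - ?F 0)"
    by (rule nn_integral_FTC_atLeast[OF _ deriv _ lim]) (use n in \<open>auto intro!: mult_nonneg_nonneg\<close>)
  finally have nn: "(\<integral>\<^sup>+ z. ?g (norm (z::'a)) \<partial>lborel) = ennreal ?V"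
    using DIM_positive[where 'a='a] by (simp add: power_0_left)
  show "integrable lborel (\<lambda>z::'a. (1 + (norm z)\<^sup>2) powr (- n / 2 - 1))"
  proof (rule integrableI_nonneg)
    show "(\<integral>\<^sup>+ z. ?g (norm (z::'a)) \<partial>lborel) < \<infinity>" unfolding nn by simp
  qed auto
  show "(\<integral>z. (1 + (norm (z::'a))\<^sup>2) powr (- n / 2 - 1) \<partial>lborel) = ?V"
  proof (rule integral_eq_nn_integral[THEN trans])
    show "enn2real (\<integral>\<^sup>+ z. ?g (norm (z::'a)) \<partial>lborel) = ?V" unfolding nn using n by simp
  qed auto
qed

section \<open>Regularised fundamental solutions\<close>

text \<open>The variable |y|^2 is polynomial in the coordinates, unlike |y|, so the origin needs no
  special treatment where \<open>Q\<close> is regular at 0. \<open>T\<close> confines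
  \<open>Q\<close> to the values that |y|^2 takes on \<open>S\<close>.\<close>

lemma lap_radial:
  fixes y :: "real^'n::finite"
  assumes S: "open S" "y \<in> S" and T: "\<And>y. y \<in> S \<Longrightarrow> (norm y)\<^sup>2 \<in> T"
    and Q: "\<And>t. t \<in> T \<Longrightarrow> (Q has_real_derivative Q' t) (at t)"
    and Q': "\<And>t. t \<in> T \<Longrightarrow> (Q' has_real_derivative Q'' t) (at t)"
  shows "lap (\<lambda>y. Q ((norm y)\<^sup>2)) y = 4 * (norm y)\<^sup>2 * Q'' ((norm y)\<^sup>2) + 2 * real CARD('n) * Q' ((norm y)\<^sup>2)"
proof -
  have 1: "pd i (\<lambda>y. Q ((norm y)\<^sup>2)) y = Q' ((norm y)\<^sup>2) * (2 * y $ i)" if "y \<in> S" for i and y :: "real^'n"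
    by (intro has_pd_imp_pd has_pd_compose Q T that has_pd_norm2)
  have 2: "pd i (pd i (\<lambda>y. Q ((norm y)\<^sup>2))) y = Q'' ((norm y)\<^sup>2) * (2 * y $ i) * (2 * y $ i) + Q' ((norm y)\<^sup>2) * 2" for i
  proof -
    have "has_pd (\<lambda>y. 2 * y $ i) i (0 * y $ i + 2 * (if i = i then 1 else 0)) y"
      by (intro has_pd_mult has_pd_const has_pd_nth)
    then have "has_pd (\<lambda>y. Q' ((norm y)\<^sup>2) * (2 * y $ i)) i
        (Q'' ((norm y)\<^sup>2) * (2 * y $ i) * (2 * y $ i) + Q' ((norm y)\<^sup>2) * (0 * y $ i + 2 * (if i = i then 1 else 0))) y"
      by (intro has_pd_mult[where g="\<lambda>y. Q' ((norm y)\<^sup>2)"] has_pd_compose Q' T S has_pd_norm2)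
    from has_pd_imp_pd[OF this] show ?thesis
      using pd_cong[where i=i and h="\<lambda>y. Q' ((norm y)\<^sup>2) * (2 * y $ i)" and g="pd i (\<lambda>y. Q ((norm y)\<^sup>2))", OF S 1] by simp
  qed
  have "lap (\<lambda>y. Q ((norm y)\<^sup>2)) y = (\<Sum>i\<in>UNIV. 4 * Q'' ((norm y)\<^sup>2) * (y $ i)\<^sup>2 + 2 * Q' ((norm y)\<^sup>2))"
    unfolding lap_def 2 by (intro sum.cong refl) (simp add: power2_eq_square)
  also have "\<dots> = 4 * Q'' ((norm y)\<^sup>2) * (norm y)\<^sup>2 + 2 * real CARD('n) * Q' ((norm y)\<^sup>2)"
    by (simp add: sum.distrib sum_distrib_left[symmetric] norm_power2_eq_sum)
  finally show ?thesis by simp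
qed

text \<open>Split into a term of the expected shape and a correction carrying the factor
  \<open>d\<close>. The first coefficient vanishes at the harmonic exponent 2a = 2 - n, where only
  the correction remains. The case \<open>d = 0\<close> off the origin serves \<open>phi\<close>
  itself.\<close>

lemma lap_shifted_norm_powr:
  fixes y :: "real^'n::finite"
  assumes "d > 0 \<or> d = 0 \<and> y \<noteq> 0"
  shows "lap (\<lambda>y. ((norm y)\<^sup>2 + d) powr a) y
    = 2 * a * (2 * a - 2 + real CARD('n)) * ((norm y)\<^sup>2 + d) powr (a - 1)
      - 4 * a * (a - 1) * (d * ((norm y)\<^sup>2 + d) powr (a - 1 - 1))"
proof -
  define S :: "(real^'n) set" where "S = (if d > 0 then UNIV else - {0})"
  have S: "open S" "y \<in> S" using assms by (auto simp: S_def)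
  have pos: "0 < (norm z)\<^sup>2 + d" if "z \<in> S" for z
    using that assms by (auto simp: S_def add_nonneg_pos add_pos_nonneg split: if_splits)
  have "lap (\<lambda>y. ((norm y)\<^sup>2 + d) powr a) y =
    4 * (norm y)\<^sup>2 * (a * ((a - 1) * ((norm y)\<^sup>2 + d) powr (a - 1 - 1))) + 2 * real CARD('n) * (a * ((norm y)\<^sup>2 + d) powr (a - 1))"
    by (rule lap_radial[OF S, where T="{-d<..}" and Q="\<lambda>t. (t + d) powr a" and Q'="\<lambda>t. a * (t + d) powr (a - 1)"
         and Q''="\<lambda>t. a * ((a - 1) * (t + d) powr (a - 1 - 1))"])
       (use pos in \<open>auto intro!: derivative_eq_intros simp: minus_less_iff less_diff_eq\<close>, smt (verit))
  also have "\<dots> = 2 * a * (2 * a - 2 + real CARD('n)) * ((norm y)\<^sup>2 + d) powr (a - 1)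
      - 4 * a * (a - 1) * (d * ((norm y)\<^sup>2 + d) powr (a - 1 - 1))"
  proof -
    have "((norm y)\<^sup>2 + d) powr (a - 1) = ((norm y)\<^sup>2 + d) * ((norm y)\<^sup>2 + d) powr (a - 1 - 1)"
      using pos[OF S(2)] powr_add[of "(norm y)\<^sup>2 + d" 1 "a - 1 - 1"] by simp
    then show ?thesis by (simp only:) (simp add: algebra_simps)
  qed
  finally show ?thesis .
qed

lemma lap_shifted_norm_ln:
  fixes y :: "real^'n::finite"
  assumes "d > 0 \<or> d = 0 \<and> y \<noteq> 0"
  shows "lap (\<lambda>y. ln ((norm y)\<^sup>2 + d) / 2) y
    = (real CARD('n) - 2) * ((norm y)\<^sup>2 + d) powr (- 1) + 2 * (d * ((norm y)\<^sup>2 + d) powr (- 2))"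
proof -
  define S :: "(real^'n) set" where "S = (if d > 0 then UNIV else - {0})"
  have S: "open S" "y \<in> S" using assms by (auto simp: S_def)
  have pos: "0 < (norm z)\<^sup>2 + d" if "z \<in> S" for z
    using that assms by (auto simp: S_def add_nonneg_pos add_pos_nonneg split: if_splits)
  have "lap (\<lambda>y. ln ((norm y)\<^sup>2 + d) / 2) y =
    4 * (norm y)\<^sup>2 * (- (((norm y)\<^sup>2 + d) powr (- 1 - 1)) / 2) + 2 * real CARD('n) * (((norm y)\<^sup>2 + d) powr (- 1) / 2)"
  proof (rule lap_radial[OF S, where T="{-d<..}" and Q="\<lambda>t. ln (t + d) / 2" and Q'="\<lambda>t. (t + d) powr (- 1) / 2"
         and Q''="\<lambda>t. - ((t + d) powr (- 1 - 1)) / 2"])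
    show "(norm z)\<^sup>2 \<in> {- d<..}" if "z \<in> S" for z using pos[OF that] by simp
    show "((\<lambda>t. ln (t + d) / 2) has_real_derivative (t + d) powr (- 1) / 2) (at t)" if "t \<in> {- d<..}" for t
      using that by (auto intro!: derivative_eq_intros simp: powr_minus field_simps)
    show "((\<lambda>t. (t + d) powr (- 1) / 2) has_real_derivative - ((t + d) powr (- 1 - 1)) / 2) (at t)"
      if "t \<in> {- d<..}" for t
    proof -
      have "((\<lambda>t. (t + d) powr (- 1)) has_real_derivative (- 1) * (t + d) powr (- 1 - 1)) (at t)"
        by (rule DERIV_shift[THEN iffD1, OF has_real_derivative_powr]) (use that in simp)
      from DERIV_cdivide[OF this, of 2] show ?thesis by (rule DERIV_cong) simp
    qed
  qed
  also have "\<dots> = (real CARD('n) - 2) * ((norm y)\<^sup>2 + d) powr (- 1) + 2 * (d * ((norm y)\<^sup>2 + d) powr (- 2))"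
  proof -
    have "((norm y)\<^sup>2 + d) powr (- 1) = ((norm y)\<^sup>2 + d) * ((norm y)\<^sup>2 + d) powr (- 2)"
      using pos[OF S(2)] powr_add[of "(norm y)\<^sup>2 + d" 1 "- 2"] by simp
    then show ?thesis by (simp only:) (simp add: algebra_simps)
  qed
  finally show ?thesis .
qed

lemma Ck_shifted_norm_powr: "d > 0 \<Longrightarrow> Ck k UNIV (\<lambda>y :: real^'n::finite. ((norm y)\<^sup>2 + d) powr a)"
  by (intro Ck_powr Ck_add Ck_norm2 Ck_const) (auto intro: add_nonneg_pos)

lemma Ck_shifted_norm_ln: "d > 0 \<Longrightarrow> Ck k UNIV (\<lambda>y :: real^'n::finite. ln ((norm y)\<^sup>2 + d) / 2)"
proof -
  assume "d > 0"
  then have "Ck k UNIV (\<lambda>y :: real^'n. 1 / 2 * ln ((norm y)\<^sup>2 + d))"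
    by (intro Ck_cmult Ck_ln Ck_add Ck_norm2 Ck_const) (auto intro: add_nonneg_pos)
  then show ?thesis by simp
qed

text \<open>The origin is exempt from the pointwise hypotheses because it is a null set and the
  limits may be singular there.\<close>

lemma integral_against_csupp_tendsto:
  fixes h :: "real^'n::finite \<Rightarrow> real"
  assumes h: "continuous_on UNIV h" and R: "\<And>y. R \<le> norm y \<Longrightarrow> h y = 0"
    and m: "\<And>k. s k \<in> borel_measurable borel" "L \<in> borel_measurable borel"
    and lim: "\<And>y. y \<noteq> 0 \<Longrightarrow> (\<lambda>k. s k y) \<longlonglongrightarrow> L y"
    and dom: "\<And>k y. y \<noteq> 0 \<Longrightarrow> norm y \<le> R \<Longrightarrow> \<bar>s k y\<bar> \<le> W y"
    and W: "integrable lborel (\<lambda>y. W y * indicator (cball 0 R) y)"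
  shows "(\<lambda>k. \<integral>y. s k y * h y \<partial>lborel) \<longlonglongrightarrow> (\<integral>y. L y * h y \<partial>lborel)"
    and "integrable lborel (\<lambda>y. L y * h y)"
    and "integrable lborel (\<lambda>y. s k y * h y)"
proof -
  have hm [measurable]: "h \<in> borel_measurable borel" using h by (rule borel_measurable_continuous_onI)
  note m [measurable]
  have "csupp h" unfolding csupp_def using R by (intro exI[of _ "max R 1"]) auto
  then obtain B where B: "B > 0" "\<And>y. \<bar>h y\<bar> \<le> B" using bounded_continuous_csupp[OF h] by blast
  have b: "\<bar>s k y * h y\<bar> \<le> B * (W y * indicator (cball 0 R) y)" if "y \<noteq> 0" for k y
  proof (cases "norm y \<le> R")
    case True
    then show ?thesis using mult_mono[OF dom[OF that True, of k] B(2)[of y]] dom[OF that True, of k]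
      by (simp add: abs_mult mult.commute)
  qed (use R in auto)
  have AE: "AE y :: real^'n in lborel. y \<noteq> 0" by (rule AE_lborel_singleton)
  have BW: "integrable lborel (\<lambda>y. B * (W y * indicator (cball 0 R) y))" using W by simp
  have lm: "AE y in lborel. (\<lambda>k. s k y * h y) \<longlonglongrightarrow> L y * h y"
    using AE by eventually_elim (intro tendsto_mult_right lim)
  have bd: "AE y in lborel. norm (s k y * h y) \<le> B * (W y * indicator (cball 0 R) y)" for k
    using AE by eventually_elim (use b in simp)
  show "(\<lambda>k. \<integral>y. s k y * h y \<partial>lborel) \<longlonglongrightarrow> (\<integral>y. L y * h y \<partial>lborel)"
    by (rule integral_dominated_convergence[OF _ _ BW lm bd]) auto
  show "integrable lborel (\<lambda>y. L y * h y)"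
    by (rule integrable_dominated_convergence[OF _ _ BW lm bd]) auto
  show "integrable lborel (\<lambda>y. s k y * h y)"
    by (rule Bochner_Integration.integrable_bound[OF BW]) (use bd[of k] in \<open>auto elim: eventually_mono\<close>)
qed

lemma norm_powr_double: "(norm (y :: 'a::real_normed_vector)) powr (2 * b) = ((norm y)\<^sup>2) powr b"
proof (cases "y = 0")
  case False
  then have "(norm y)\<^sup>2 = norm y powr 2" by simp
  then show ?thesis by (simp only: powr_powr)
qed simp

text \<open>For \<open>b \<ge> 0\<close> the second summand dominates, for \<open>b < 0\<close> the
  first; the sum serves both signs.\<close>

lemma shifted_powr_le:
  fixes t d M b :: real
  assumes "0 < t" "t \<le> M" "0 < d" "d \<le> 1"
  shows "(t + d) powr b \<le> t powr b + (M + 1) powr b"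
proof (cases "b \<ge> 0")
  case True
  then have "(t + d) powr b \<le> (M + 1) powr b" using assms by (intro powr_mono2) auto
  then show ?thesis by (simp add: add_increasing)
next
  case False
  then have "(t + d) powr b \<le> t powr b" using assms by (intro powr_mono2') auto
  then show ?thesis by (simp add: add_increasing2)
qed

lemma integrable_indicator_cball: "integrable lborel (\<lambda>y :: 'a::euclidean_space. c * indicator (cball 0 R) y :: real)"
  by (intro integrable_mult_right integrable_real_indicator emeasure_bounded_finite) auto

text \<open>Above the critical exponent the correction term disappears in the limit: it tends to 0
  off the origin and is at most ((norm y)^2 + d)^b, because the factor \<open>d\<close> is at most
  (norm y)^2 + d.\<close>

lemma regularised_powr_tendsto:
  fixes h :: "real^'n::finite \<Rightarrow> real"
  assumes h: "continuous_on UNIV h" "csupp h" and b: "2 * b > - real CARD('n)"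
    and d: "\<And>k. 0 < d k" "\<And>k. d k \<le> 1" "d \<longlonglongrightarrow> 0"
  shows "(\<lambda>k. \<integral>y. ((norm y)\<^sup>2 + d k) powr b * h y \<partial>lborel) \<longlonglongrightarrow> (\<integral>y. norm y powr (2 * b) * h y \<partial>lborel)" (is ?A)
    and "(\<lambda>k. \<integral>y. (d k * ((norm y)\<^sup>2 + d k) powr (b - 1)) * h y \<partial>lborel) \<longlonglongrightarrow> 0" (is ?B)
    and "integrable lborel (\<lambda>y. norm y powr (2 * b) * h y)" (is ?C)
    and "integrable lborel (\<lambda>y. ((norm y)\<^sup>2 + d k) powr b * h y)" (is ?D)
    and "integrable lborel (\<lambda>y. (d k * ((norm y)\<^sup>2 + d k) powr (b - 1)) * h y)" (is ?E)
proof -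
  obtain R where R: "R > 0" "\<And>y. R \<le> norm y \<Longrightarrow> h y = 0" using h(2) by (auto simp: csupp_def)
  let ?W = "\<lambda>y :: real^'n. norm y powr (2 * b) + (R\<^sup>2 + 1) powr b"
  have W: "integrable lborel (\<lambda>y. ?W y * indicator (cball 0 R) y)"
    unfolding distrib_right
    by (intro Bochner_Integration.integrable_add integrable_norm_powr integrable_indicator_cball) (use b in simp)
  have dom: "\<bar>((norm y)\<^sup>2 + d k) powr b\<bar> \<le> ?W y" if "y \<noteq> 0" "norm y \<le> R" for k and y :: "real^'n"
    using shifted_powr_le[of "(norm y)\<^sup>2" "R\<^sup>2" "d k" b] that d(1,2)[of k]
      power_mono[of "norm y" R 2] by (simp add: norm_powr_double)
  have lim: "(\<lambda>k. ((norm y)\<^sup>2 + d k) powr b) \<longlonglongrightarrow> norm y powr (2 * b)" if "y \<noteq> 0" for b and y :: "real^'n"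
  proof -
    have "(\<lambda>k. ((norm y)\<^sup>2 + d k) powr b) \<longlonglongrightarrow> ((norm y)\<^sup>2 + 0) powr b"
      using that by (intro tendsto_intros d) auto
    then show ?thesis by (simp add: norm_powr_double)
  qed
  have m: "(\<lambda>y :: real^'n. ((norm y)\<^sup>2 + c) powr b) \<in> borel_measurable borel" for c b
    by measurable
  have m': "(\<lambda>y :: real^'n. norm y powr b) \<in> borel_measurable borel" for b by measurable
  note 1 = integral_against_csupp_tendsto[OF h(1) R(2) m m' lim dom W]
  show ?A by (rule 1(1))
  show ?C by (rule 1(2))
  show ?D by (rule 1(3))
  have dom': "\<bar>d k * ((norm y)\<^sup>2 + d k) powr (b - 1)\<bar> \<le> ?W y" if "y \<noteq> 0" "norm y \<le> R" for k and y :: "real^'n"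
  proof -
    have p: "0 < (norm y)\<^sup>2 + d k" using d(1)[of k] by (simp add: add_nonneg_pos)
    have "d k * ((norm y)\<^sup>2 + d k) powr (b - 1) \<le> ((norm y)\<^sup>2 + d k) * ((norm y)\<^sup>2 + d k) powr (b - 1)"
      by (intro mult_right_mono) auto
    also have "\<dots> = ((norm y)\<^sup>2 + d k) powr b"
      using p powr_add[of "(norm y)\<^sup>2 + d k" 1 "b - 1"] by simp
    also have "\<dots> \<le> ?W y" using dom[OF that, of k] by simp
    finally show ?thesis using d(1)[of k] by simp
  qed
  have lim': "(\<lambda>k. d k * ((norm y)\<^sup>2 + d k) powr (b - 1)) \<longlonglongrightarrow> 0" if "y \<noteq> 0" for y :: "real^'n"
    using tendsto_mult[OF d(3) lim[OF that, of "b - 1"]] by simp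
  have m2: "(\<lambda>y :: real^'n. d k * ((norm y)\<^sup>2 + d k) powr (b - 1)) \<in> borel_measurable borel" for k
    by measurable
  note 2 = integral_against_csupp_tendsto[OF h(1) R(2) m2 borel_measurable_const lim' dom' W]
  show ?B using 2(1) by simp
  show ?E by (rule 2(3))
qed

lemma abs_ln_le: "0 < z \<Longrightarrow> \<bar>ln z\<bar> \<le> 1 / z + z" for z :: real
  using ln_le_minus_one[of z] ln_le_minus_one[of "1 / z"] by (auto simp: ln_div abs_if) (smt (verit) zero_less_divide_1_iff)+

lemma regularised_ln_tendsto:
  fixes h :: "real^'n::finite \<Rightarrow> real"
  assumes h: "continuous_on UNIV h" "csupp h" and n: "CARD('n) \<ge> 2"
    and d: "\<And>k. 0 < d k" "\<And>k. d k \<le> 1" "d \<longlonglongrightarrow> 0"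
  shows "(\<lambda>k. \<integral>y. (ln ((norm y)\<^sup>2 + d k) / 2) * h y \<partial>lborel) \<longlonglongrightarrow> (\<integral>y. ln (norm y) * h y \<partial>lborel)"
    and "integrable lborel (\<lambda>y. ln (norm y) * h y)"
proof -
  obtain R where R: "R > 0" "\<And>y. R \<le> norm y \<Longrightarrow> h y = 0" using h(2) by (auto simp: csupp_def)
  \<comment> \<open>The logarithm is dominated by 1/|y|, locally integrable in dimension at least 2,
    plus a constant.\<close>
  let ?W = "\<lambda>y :: real^'n. norm y powr (- 1) + (R + ln (R\<^sup>2 + 1))"
  have W: "integrable lborel (\<lambda>y. ?W y * indicator (cball 0 R) y)"
    unfolding distrib_right[of "_ powr _"]
    by (intro Bochner_Integration.integrable_add integrable_norm_powr integrable_indicator_cball) (use n in simp)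
  have dom: "\<bar>ln ((norm y)\<^sup>2 + d k) / 2\<bar> \<le> ?W y" if y: "y \<noteq> 0" "norm y \<le> R" for k and y :: "real^'n"
  proof -
    have t: "0 < (norm y)\<^sup>2" using y by simp
    have "(norm y)\<^sup>2 \<le> R\<^sup>2" using y by (simp add: power_mono)
    then have u: "ln ((norm y)\<^sup>2 + d k) \<le> ln (R\<^sup>2 + 1)"
      using t d(1,2)[of k] by (intro ln_mono) (auto intro: add_nonneg_pos)
    have l: "ln ((norm y)\<^sup>2) \<le> ln ((norm y)\<^sup>2 + d k)" using t d(1)[of k] add_pos_pos[OF t d(1)[of k]] by (intro ln_mono) auto
    have "ln ((norm y)\<^sup>2) = 2 * ln (norm y)" using y by (simp add: ln_realpow)
    moreover have "\<bar>ln (norm y)\<bar> \<le> norm y powr (- 1) + R"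
      using abs_ln_le[of "norm y"] y by (simp add: powr_minus inverse_eq_divide)
    moreover have "0 \<le> ln (R\<^sup>2 + 1)" by simp
    ultimately show ?thesis using u l R(1) by linarith
  qed
  have lim: "(\<lambda>k. ln ((norm y)\<^sup>2 + d k) / 2) \<longlonglongrightarrow> ln (norm y)" if "y \<noteq> 0" for y :: "real^'n"
  proof -
    have "(\<lambda>k. ln ((norm y)\<^sup>2 + d k) / 2) \<longlonglongrightarrow> ln ((norm y)\<^sup>2 + 0) / 2"
      using that by (intro tendsto_intros d) auto
    then show ?thesis using that by (simp add: ln_realpow)
  qed
  have m: "(\<lambda>y :: real^'n. ln ((norm y)\<^sup>2 + c) / 2) \<in> borel_measurable borel" for c by measurable
  have m': "(\<lambda>y :: real^'n. ln (norm y)) \<in> borel_measurable borel" by measurable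
  note 1 = integral_against_csupp_tendsto[OF h(1) R(2) m m' lim dom W]
  show "(\<lambda>k. \<integral>y. (ln ((norm y)\<^sup>2 + d k) / 2) * h y \<partial>lborel) \<longlonglongrightarrow> (\<integral>y. ln (norm y) * h y \<partial>lborel)"
    by (rule 1(1))
  show "integrable lborel (\<lambda>y. ln (norm y) * h y)" by (rule 1(2))
qed

text \<open>At the critical exponent the correction is scale invariant: the substitution y = sqrt(d)
  z turns it into the fixed profile of \<open>integral_bubble\<close>, tested against
  \<open>h\<close> on ever smaller balls. It is an approximate point mass.\<close>

lemma bubble_tendsto:
  fixes h :: "real^'n::finite \<Rightarrow> real"
  assumes h: "continuous_on UNIV h" "csupp h"
    and d: "\<And>k. 0 < d k" "\<And>k. d k \<le> 1" "d \<longlonglongrightarrow> 0"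
  shows "(\<lambda>k. \<integral>y. (d k * ((norm y)\<^sup>2 + d k) powr (- real CARD('n) / 2 - 1)) * h y \<partial>lborel)
    \<longlonglongrightarrow> unit_ball_vol CARD('n) * h 0"
proof -
  let ?a = "- real CARD('n) / 2 - 1"
  obtain B where B: "B > 0" "\<And>y. \<bar>h y\<bar> \<le> B" using bounded_continuous_csupp[OF h] by blast
  have hm [measurable]: "h \<in> borel_measurable borel" using h(1) by (rule borel_measurable_continuous_onI)
  have eq: "(\<integral>y. (d k * ((norm y)\<^sup>2 + d k) powr ?a) * h y \<partial>lborel)
      = (\<integral>z. (1 + (norm z)\<^sup>2) powr ?a * h (sqrt (d k) *\<^sub>R z) \<partial>lborel)" for k
  proof -
    let ?s = "sqrt (d k)"
    have s: "?s > 0" "?s\<^sup>2 = d k" using d(1)[of k] by auto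
    have m: "(\<lambda>y. (d k * ((norm y)\<^sup>2 + d k) powr ?a) * h y) \<in> borel_measurable borel" by measurable
    have "(\<integral>y. (d k * ((norm y)\<^sup>2 + d k) powr ?a) * h y \<partial>lborel)
      = \<bar>?s\<bar> ^ DIM(real^'n) * (\<integral>z. (d k * ((norm (0 + ?s *\<^sub>R z))\<^sup>2 + d k) powr ?a) * h (0 + ?s *\<^sub>R z) \<partial>lborel)"
      by (rule lborel_integral_affine[OF _ m]) (use s in auto)
    also have "\<dots> = (\<integral>z. \<bar>?s\<bar> ^ DIM(real^'n) * ((d k * ((norm (0 + ?s *\<^sub>R z))\<^sup>2 + d k) powr ?a) * h (0 + ?s *\<^sub>R z)) \<partial>lborel)"
      by simp
    also have "\<dots> = (\<integral>z. (1 + (norm z)\<^sup>2) powr ?a * h (?s *\<^sub>R z) \<partial>lborel)"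
    proof (rule Bochner_Integration.integral_cong[OF refl])
      fix z :: "real^'n"
      have "(norm (?s *\<^sub>R z))\<^sup>2 + d k = d k * (1 + (norm z)\<^sup>2)"
        using s d(1)[of k] by (simp add: power_mult_distrib algebra_simps)
      then have 1: "((norm (?s *\<^sub>R z))\<^sup>2 + d k) powr ?a = d k powr ?a * (1 + (norm z)\<^sup>2) powr ?a"
        using d(1)[of k] by (simp add: powr_mult)
      \<comment> \<open>The powers of \<open>d k\<close> cancel: n/2 from the Jacobian, 1 from the
        prefactor, -n/2 - 1 from the profile.\<close>
      have "?s ^ CARD('n) = d k powr (real CARD('n) / 2)"
        using d(1)[of k] by (simp add: powr_half_sqrt[symmetric] powr_realpow[symmetric] powr_powr)
      then have "?s ^ CARD('n) * (d k * d k powr ?a) = d k powr (real CARD('n) / 2) * (d k powr 1 * d k powr ?a)"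
        using d(1)[of k] by simp
      also have "\<dots> = d k powr 0" unfolding powr_add[symmetric] by (rule arg_cong) simp
      finally have "?s ^ CARD('n) * (d k * d k powr ?a) = 1" using d(1)[of k] by simp
      then have "?s ^ CARD('n) * (d k * (d k powr ?a * q) * r) = q * r" for q r
        by (metis (no_types, opaque_lifting) mult.assoc mult_1)
      then show "\<bar>?s\<bar> ^ DIM(real^'n) * ((d k * ((norm (0 + ?s *\<^sub>R z))\<^sup>2 + d k) powr ?a) * h (0 + ?s *\<^sub>R z))
          = (1 + (norm z)\<^sup>2) powr ?a * h (?s *\<^sub>R z)"
        using 1 s by simp
    qed
    finally show ?thesis .
  qed
  have bub: "integrable lborel (\<lambda>z::real^'n. (1 + (norm z)\<^sup>2) powr ?a)"
    and bubv: "(\<integral>z. (1 + (norm (z::real^'n))\<^sup>2) powr ?a \<partial>lborel) = unit_ball_vol CARD('n)"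
    using integral_bubble[where 'a="real^'n"] by simp_all
  have "(\<lambda>k. \<integral>z. (1 + (norm z)\<^sup>2) powr ?a * h (sqrt (d k) *\<^sub>R z) \<partial>lborel)
      \<longlonglongrightarrow> (\<integral>z. (1 + (norm (z::real^'n))\<^sup>2) powr ?a * h 0 \<partial>lborel)"
  proof (rule integral_dominated_convergence[where w="\<lambda>z. (1 + (norm z)\<^sup>2) powr ?a * B"])
    show "integrable lborel (\<lambda>z::real^'n. (1 + (norm z)\<^sup>2) powr ?a * B)" using bub by simp
    show "AE z in lborel. (\<lambda>k. (1 + (norm z)\<^sup>2) powr ?a * h (sqrt (d k) *\<^sub>R z)) \<longlonglongrightarrow> (1 + (norm z)\<^sup>2) powr ?a * h 0"
    proof (intro AE_I2 tendsto_mult_left)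
      fix z :: "real^'n"
      have "(\<lambda>k. sqrt (d k) *\<^sub>R z) \<longlonglongrightarrow> sqrt 0 *\<^sub>R z" by (intro tendsto_intros d)
      then have "(\<lambda>k. sqrt (d k) *\<^sub>R z) \<longlonglongrightarrow> 0" by simp
      moreover have "isCont h 0" using h(1) by (simp add: continuous_on_eq_continuous_at)
      ultimately show "(\<lambda>k. h (sqrt (d k) *\<^sub>R z)) \<longlonglongrightarrow> h 0" by (rule isCont_tendsto_compose[rotated])
    qed
    show "AE z in lborel. norm ((1 + (norm z)\<^sup>2) powr ?a * h (sqrt (d k) *\<^sub>R z)) \<le> (1 + (norm z)\<^sup>2) powr ?a * B" for k
      using B(2) by (intro AE_I2) (simp add: abs_mult mult_left_mono)
  qed auto
  then show ?thesis unfolding eq using bubv by simp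
qed

lemma harmonic_seq:
  defines "d \<equiv> (\<lambda>k::nat. 1 / real (Suc k))"
  shows "0 < d k" "d k \<le> 1" "d \<longlonglongrightarrow> 0"
  using LIMSEQ_inverse_real_of_nat by (auto simp: d_def inverse_eq_divide)

section \<open>Weak Laplacians of powers and of the logarithm of the norm\<close>

lemma integral_norm_powr_lap:
  fixes h :: "real^'n::finite \<Rightarrow> real"
  assumes h: "Ck 2 UNIV h" "csupp h" and a: "a > 1 - real CARD('n) / 2"
  shows "(\<integral>y. norm y powr (2 * a) * lap h y \<partial>lborel)
    = 2 * a * (2 * a - 2 + real CARD('n)) * (\<integral>y. norm y powr (2 * a - 2) * h y \<partial>lborel)"
proof -
  have lh: "continuous_on UNIV (lap h)" "csupp (lap h)"
    using Ck_lap[of UNIV 0 h] h by (auto simp: numeral_2_eq_2 intro: csupp_lap)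
  have ch: "continuous_on UNIV h" using h(1) by (rule Ck_continuous_on)
  let ?d = "\<lambda>k::nat. 1 / real (Suc k)"
  let ?A = "2 * a * (2 * a - 2 + real CARD('n))"
  have b: "2 * a > - real CARD('n)" "2 * (a - 1) > - real CARD('n)" using a by auto
  note L1 = regularised_powr_tendsto[OF lh b(1) harmonic_seq]
  note L2 = regularised_powr_tendsto[OF ch h(2) b(2) harmonic_seq]
  have eq: "(\<integral>y. ((norm y)\<^sup>2 + ?d k) powr a * lap h y \<partial>lborel)
      = ?A * (\<integral>y. ((norm y)\<^sup>2 + ?d k) powr (a - 1) * h y \<partial>lborel)
        - 4 * a * (a - 1) * (\<integral>y. (?d k * ((norm y)\<^sup>2 + ?d k) powr (a - 1 - 1)) * h y \<partial>lborel)" for k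
  proof -
    have dk: "?d k > 0" by simp
    have "(\<integral>y. ((norm y)\<^sup>2 + ?d k) powr a * lap h y \<partial>lborel) = (\<integral>y. lap (\<lambda>y. ((norm y)\<^sup>2 + ?d k) powr a) y * h y \<partial>lborel)"
      by (rule integral_by_parts_lap[OF Ck_shifted_norm_powr[OF dk] h])
    also have "\<dots> = (\<integral>y. ?A * (((norm y)\<^sup>2 + ?d k) powr (a - 1) * h y)
        - 4 * a * (a - 1) * ((?d k * ((norm y)\<^sup>2 + ?d k) powr (a - 1 - 1)) * h y) \<partial>lborel)"
      by (subst lap_shifted_norm_powr) (use dk in \<open>auto simp: left_diff_distrib mult.assoc\<close>)
    also have "\<dots> = ?A * (\<integral>y. ((norm y)\<^sup>2 + ?d k) powr (a - 1) * h y \<partial>lborel)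
        - 4 * a * (a - 1) * (\<integral>y. (?d k * ((norm y)\<^sup>2 + ?d k) powr (a - 1 - 1)) * h y \<partial>lborel)"
      using L2(4)[of k] L2(5)[of k]
      by (subst Bochner_Integration.integral_diff) (simp_all only: integrable_mult_right integral_mult_right_zero)
    finally show ?thesis .
  qed
  have "(\<lambda>k. ?A * (\<integral>y. ((norm y)\<^sup>2 + ?d k) powr (a - 1) * h y \<partial>lborel)
        - 4 * a * (a - 1) * (\<integral>y. (?d k * ((norm y)\<^sup>2 + ?d k) powr (a - 1 - 1)) * h y \<partial>lborel))
      \<longlonglongrightarrow> ?A * (\<integral>y. norm y powr (2 * (a - 1)) * h y \<partial>lborel) - 4 * a * (a - 1) * 0"
    by (intro tendsto_diff tendsto_mult_left L2)
  from LIMSEQ_unique[OF L1(1)[unfolded eq] this] show ?thesis by (simp add: right_diff_distrib)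
qed

text \<open>With 2a = 2 - n the main term of the regularised Laplacian is absent, and its correction
  is the bubble that concentrates at 0.\<close>

lemma integral_norm_powr_lap_critical:
  fixes h :: "real^'n::finite \<Rightarrow> real"
  assumes h: "Ck 2 UNIV h" "csupp h"
  defines "n \<equiv> real CARD('n)"
  shows "(\<integral>y. norm y powr (2 - n) * lap h y \<partial>lborel) = - n * (n - 2) * unit_ball_vol n * h 0"
proof -
  have lh: "continuous_on UNIV (lap h)" "csupp (lap h)"
    using Ck_lap[of UNIV 0 h] h by (auto simp: numeral_2_eq_2 intro: csupp_lap)
  have ch: "continuous_on UNIV h" using h(1) by (rule Ck_continuous_on)
  let ?d = "\<lambda>k::nat. 1 / real (Suc k)"
  define a where "a = 1 - n / 2"
  have b: "2 * a > - real CARD('n)" by (simp add: a_def n_def)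
  note L1 = regularised_powr_tendsto[OF lh b harmonic_seq]
  note L2 = bubble_tendsto[OF ch h(2) harmonic_seq]
  have aa: "a - 1 - 1 = - real CARD('n) / 2 - 1" "2 * a - 2 + real CARD('n) = 0" by (simp_all add: a_def n_def)
  have eq: "(\<integral>y. ((norm y)\<^sup>2 + ?d k) powr a * lap h y \<partial>lborel)
      = - 4 * a * (a - 1) * (\<integral>y. (?d k * ((norm y)\<^sup>2 + ?d k) powr (- real CARD('n) / 2 - 1)) * h y \<partial>lborel)" for k
  proof -
    have dk: "?d k > 0" by simp
    have "(\<integral>y. ((norm y)\<^sup>2 + ?d k) powr a * lap h y \<partial>lborel) = (\<integral>y. lap (\<lambda>y. ((norm y)\<^sup>2 + ?d k) powr a) y * h y \<partial>lborel)"
      by (rule integral_by_parts_lap[OF Ck_shifted_norm_powr[OF dk] h])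
    also have "\<dots> = (\<integral>y. - 4 * a * (a - 1) * ((?d k * ((norm y)\<^sup>2 + ?d k) powr (- real CARD('n) / 2 - 1)) * h y) \<partial>lborel)"
      by (subst lap_shifted_norm_powr) (use dk in \<open>auto simp: aa left_diff_distrib mult.assoc\<close>)
    finally show ?thesis by simp
  qed
  have "(\<lambda>k. - 4 * a * (a - 1) * (\<integral>y. (?d k * ((norm y)\<^sup>2 + ?d k) powr (- real CARD('n) / 2 - 1)) * h y \<partial>lborel))
      \<longlonglongrightarrow> - 4 * a * (a - 1) * (unit_ball_vol (real CARD('n)) * h 0)"
    by (intro tendsto_mult_left L2)
  from LIMSEQ_unique[OF L1(1)[unfolded eq] this]
  have "(\<integral>y. norm y powr (2 * a) * lap h y \<partial>lborel) = - 4 * a * (a - 1) * (unit_ball_vol n * h 0)"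
    by (simp add: n_def)
  moreover have "2 * a = 2 - n" by (simp add: a_def)
  moreover have "- 4 * a * (a - 1) = - n * (n - 2)" by (simp add: a_def field_simps)
  ultimately show ?thesis by simp
qed

text \<open>For n > 2 the correction dies out and a power remains; for n = 2 the main term has
  coefficient 0 and the correction is the bubble, whose mass is the area of the unit disc.\<close>

lemma integral_ln_norm_lap:
  fixes h :: "real^'n::finite \<Rightarrow> real"
  assumes h: "Ck 2 UNIV h" "csupp h"
  shows "CARD('n) > 2 \<Longrightarrow> (\<integral>y. ln (norm y) * lap h y \<partial>lborel) = (real CARD('n) - 2) * (\<integral>y. norm y powr (- 2) * h y \<partial>lborel)"
    and "CARD('n) = 2 \<Longrightarrow> (\<integral>y. ln (norm y) * lap h y \<partial>lborel) = 2 * pi * h 0"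
proof -
  have lh: "continuous_on UNIV (lap h)" "csupp (lap h)"
    using Ck_lap[of UNIV 0 h] h by (auto simp: numeral_2_eq_2 intro: csupp_lap)
  have ch: "continuous_on UNIV h" using h(1) by (rule Ck_continuous_on)
  let ?d = "\<lambda>k::nat. 1 / real (Suc k)"
  have "(\<integral>y. ln ((norm y)\<^sup>2 + ?d k) / 2 * lap h y \<partial>lborel) = (\<integral>y. lap (\<lambda>y. ln ((norm y)\<^sup>2 + ?d k) / 2) y * h y \<partial>lborel)" for k
    by (rule integral_by_parts_lap[OF Ck_shifted_norm_ln h]) simp
  then have eq: "(\<integral>y. ln ((norm y)\<^sup>2 + ?d k) / 2 * lap h y \<partial>lborel)
     = (\<integral>y. (real CARD('n) - 2) * (((norm y)\<^sup>2 + ?d k) powr (- 1) * h y) + 2 * ((?d k * ((norm y)\<^sup>2 + ?d k) powr (- 2)) * h y) \<partial>lborel)" for k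
    by (subst (asm) lap_shifted_norm_ln) (auto simp: distrib_right mult.assoc)
  {
    assume n: "CARD('n) > 2"
    note L1 = regularised_ln_tendsto[OF lh less_imp_le[OF n] harmonic_seq]
    have b: "2 * (- 1) > - real CARD('n)" using n by simp
    note L2 = regularised_powr_tendsto[OF ch h(2) b harmonic_seq]
    have eq': "(\<integral>y. ln ((norm y)\<^sup>2 + ?d k) / 2 * lap h y \<partial>lborel)
       = (real CARD('n) - 2) * (\<integral>y. ((norm y)\<^sup>2 + ?d k) powr (- 1) * h y \<partial>lborel) + 2 * (\<integral>y. (?d k * ((norm y)\<^sup>2 + ?d k) powr (- 1 - 1)) * h y \<partial>lborel)" for k
      unfolding eq using L2(4)[of k] L2(5)[of k]
      by (subst Bochner_Integration.integral_add) (simp_all del: times_divide_eq_left)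
    have "(\<lambda>k. (real CARD('n) - 2) * (\<integral>y. ((norm y)\<^sup>2 + ?d k) powr (- 1) * h y \<partial>lborel) + 2 * (\<integral>y. (?d k * ((norm y)\<^sup>2 + ?d k) powr (- 1 - 1)) * h y \<partial>lborel))
      \<longlonglongrightarrow> (real CARD('n) - 2) * (\<integral>y. norm y powr (2 * (- 1)) * h y \<partial>lborel) + 2 * 0"
      by (intro tendsto_add tendsto_mult_left L2)
    from LIMSEQ_unique[OF L1(1)[unfolded eq'] this]
    show "(\<integral>y. ln (norm y) * lap h y \<partial>lborel) = (real CARD('n) - 2) * (\<integral>y. norm y powr (- 2) * h y \<partial>lborel)" by simp
  }
  {
    assume n: "CARD('n) = 2"
    note L1 = regularised_ln_tendsto[OF lh eq_refl[OF n[symmetric]] harmonic_seq]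
    note L2 = bubble_tendsto[OF ch h(2) harmonic_seq]
    have "(\<lambda>k. 2 * (\<integral>y. (?d k * ((norm y)\<^sup>2 + ?d k) powr (- real CARD('n) / 2 - 1)) * h y \<partial>lborel))
      \<longlonglongrightarrow> 2 * (unit_ball_vol (real CARD('n)) * h 0)"
      by (intro tendsto_mult_left L2)
    moreover have "(\<integral>y. ln ((norm y)\<^sup>2 + ?d k) / 2 * lap h y \<partial>lborel)
        = 2 * (\<integral>y. (?d k * ((norm y)\<^sup>2 + ?d k) powr (- real CARD('n) / 2 - 1)) * h y \<partial>lborel)" for k
      unfolding eq by (simp add: n)
    ultimately have "(\<integral>y. ln (norm y) * lap h y \<partial>lborel) = 2 * (unit_ball_vol (real CARD('n)) * h 0)"
      using LIMSEQ_unique[OF L1(1)] by (simp only:)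
    then show "(\<integral>y. ln (norm y) * lap h y \<partial>lborel) = 2 * pi * h 0"
      using unit_ball_vol_even[of 1] by (simp add: n)
  }
qed

section \<open>The fundamental solution of the polyharmonic operator\<close>

lemma Gamma_plus1_pos: "0 < x \<Longrightarrow> Gamma (x + 1) = x * Gamma x" for x :: real
  by (rule Gamma_plus1) (meson nonpos_Ints_nonpos not_le)

text \<open>Moving one Laplacian onto |y|^(2k+2-n) yields the factor (n - 2k - 2)(2k) and the power
  for \<open>k\<close>; by the functional equation of Gamma, \<open>fs_const\<close> obeys the same
  recursion. The point mass appears in the base case only.\<close>

lemma integral_norm_powr_polylap:
  fixes h :: "real^'n::finite \<Rightarrow> real"
  assumes "k \<ge> 1" "CARD('n) > 2 * k" "Ck (2 * k) UNIV h" "csupp h"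
  shows "fs_const k CARD('n) * (\<integral>y. norm y powr (real (2 * k) - real CARD('n)) * polylap k h y \<partial>lborel) = h 0"
  using assms
proof (induction k rule: nat_induct_at_least)
  case base
  let ?n = "real CARD('n)"
  have n: "?n > 2" using base by linarith
  have "(\<integral>y. norm y powr (real (2 * 1) - ?n) * polylap 1 h y \<partial>lborel) = ?n * (?n - 2) * unit_ball_vol ?n * h 0"
    using integral_norm_powr_lap_critical[of h] base by (simp add: polylap_Suc)
  moreover have "fs_const 1 CARD('n) * (?n * (?n - 2) * unit_ball_vol ?n) = 1"
  proof -
    \<comment> \<open>Two steps of the functional equation relate the Gamma value in the ball volume
      to the one in \<open>fs_const\<close>.\<close>
    have G: "Gamma (?n / 2 + 1) = (?n / 2) * ((?n / 2 - 1) * Gamma (?n / 2 - 1))"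
      using Gamma_plus1_pos[of "?n / 2"] Gamma_plus1_pos[of "?n / 2 - 1"] n by simp
    define g where "g = Gamma (?n / 2 - 1)"
    have g: "g > 0" unfolding g_def using n by (intro Gamma_real_pos) simp
    have fs: "fs_const 1 CARD('n) = g / (4 * pi powr (?n / 2))"
      using base by (simp add: fs_const_def g_def)
    have V: "unit_ball_vol ?n = pi powr (?n / 2) / (?n / 2 * ((?n / 2 - 1) * g))"
      unfolding unit_ball_vol_def G g_def ..
    have "?n - 2 \<noteq> 0" using n by simp
    then show ?thesis using n g unfolding fs V by (simp add: field_simps)
  qed
  ultimately show ?case by (metis mult.assoc mult_1)
next
  case (Suc k)
  let ?n = "real CARD('n)"
  have k: "2 * Suc k < CARD('n)" using Suc.prems by simp
  then have n: "?n > 2 * real (Suc k)" by (metis of_nat_less_iff of_nat_mult of_nat_numeral)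
  have hk: "Ck (2 * k) UNIV h" "Ck (2 * k + 2) UNIV h"
    using Suc.prems(2) Ck_le[of "2 * Suc k" UNIV h "2 * k"] by simp_all
  let ?a = "real (Suc k) - ?n / 2"
  have a: "2 * ?a = real (2 * Suc k) - ?n" "2 * ?a - 2 = real (2 * k) - ?n" "2 * ?a - 2 + ?n = 2 * real k" by auto
  have "(\<integral>y. norm y powr (2 * ?a) * lap (polylap k h) y \<partial>lborel)
      = 2 * ?a * (2 * ?a - 2 + ?n) * (\<integral>y. norm y powr (2 * ?a - 2) * polylap k h y \<partial>lborel)"
    using Suc.hyps by (intro integral_norm_powr_lap Ck_polylap hk csupp_polylap Suc.prems) auto
  then have 1: "(\<integral>y. norm y powr (real (2 * Suc k) - ?n) * polylap (Suc k) h y \<partial>lborel)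
      = (?n - real (2 * Suc k)) * (2 * real k) * (\<integral>y. norm y powr (real (2 * k) - ?n) * polylap k h y \<partial>lborel)"
    unfolding a by (simp add: polylap_Suc left_diff_distrib)
  have 2: "fs_const (Suc k) CARD('n) * ((?n - real (2 * Suc k)) * (2 * real k)) = fs_const k CARD('n)"
  proof -
    have "Gamma (?n / 2 - real k) = (?n / 2 - real (Suc k)) * Gamma (?n / 2 - real (Suc k))"
      using Gamma_plus1_pos[of "?n / 2 - real (Suc k)"] n by (simp add: algebra_simps)
    moreover have "Gamma (real (Suc k)) = real k * Gamma (real k)"
      using Gamma_plus1_pos[of "real k"] Suc.hyps by (simp add: algebra_simps)
    ultimately have fs: "fs_const (Suc k) CARD('n) = Gamma (?n / 2 - real (Suc k)) / (4 * 4 ^ k * pi powr (?n / 2) * (real k * Gamma (real k)))"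
      "fs_const k CARD('n) = (?n / 2 - real (Suc k)) * Gamma (?n / 2 - real (Suc k)) / (4 ^ k * pi powr (?n / 2) * Gamma (real k))"
      using k by (simp_all add: fs_const_def)
    have G: "Gamma (real k) \<noteq> 0"
      by (rule less_imp_neq[symmetric], rule Gamma_real_pos) (use Suc.hyps in simp)
    have x: "?n - real (2 * Suc k) = 2 * (?n / 2 - real (Suc k))" by simp
    have gen: "g / (4 * q * P * (r * G)) * (2 * x * (2 * r)) = x * g / (q * P * G)"
      if "r \<noteq> 0" "G \<noteq> 0" "P \<noteq> 0" "q \<noteq> 0" for g q P r G x :: real
      using that by (simp add: field_simps)
    show ?thesis unfolding fs x by (rule gen) (use G Suc.hyps in auto)
  qed
  have "fs_const k CARD('n) * (\<integral>y. norm y powr (real (2 * k) - ?n) * polylap k h y \<partial>lborel) = h 0"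
    by (rule Suc.IH) (use k hk Suc.prems in auto)
  then show ?case unfolding 1 by (simp only: mult.assoc[symmetric] 2[unfolded mult.assoc[symmetric]])
qed

text \<open>The new case is n = 2m: one Laplacian turns the logarithm into a multiple of |y|^(-2),
  which is the power belonging to m - 1. For m = 1 the logarithm already produces the point
  mass.\<close>

lemma integral_phi_polylap_at_0:
  fixes h :: "real^'n::finite \<Rightarrow> real"
  assumes m: "m \<ge> 1" "CARD('n) \<ge> 2 * m" and h: "Ck (2 * m) UNIV h" "csupp h"
  shows "(\<integral>y. phi m y * polylap m h y \<partial>lborel) = h 0"
proof (cases "CARD('n) > 2 * m")
  case True
  then have "phi m y * polylap m h y = fs_const m CARD('n) * (norm y powr (real (2 * m) - real CARD('n)) * polylap m h y)"
    for y :: "real^'n" by (simp add: phi_def)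
  then show ?thesis using integral_norm_powr_polylap[OF m(1) True h] by (simp only: integral_mult_right_zero)
next
  case False
  then have n: "CARD('n) = 2 * m" using m by simp
  have cp: "continuous_on UNIV (polylap m h)" using Ck_polylap[of UNIV m 0 h] h by simp
  have i0: "integrable lborel (polylap m h)"
    by (intro integrable_continuous_csupp cp csupp_polylap h)
  have i1: "integrable lborel (\<lambda>y. ln (norm y) * polylap m h y)"
    by (rule regularised_ln_tendsto(2)[OF cp csupp_polylap[OF h(2)] _ harmonic_seq]) (use n m in simp)
  \<comment> \<open>Removes the additive constant with ln 5 from \<open>phi\<close>.\<close>
  have const: "(\<integral>y. polylap m h y \<partial>lborel) = 0"
    using integral_by_parts_polylap[OF Ck_const[of "2*m" UNIV 1] h] m by (simp add: polylap_const)
  let ?c = "fs_const m (2 * m)"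
  have AE: "AE y :: real^'n in lborel. y \<noteq> 0" by (rule AE_lborel_singleton)
  have "(\<integral>y. phi m y * polylap m h y \<partial>lborel)
      = (\<integral>y. ?c * ln 5 * polylap m h y - ?c * (ln (norm y) * polylap m h y) \<partial>lborel)"
  proof (rule integral_cong_AE)
    have p: "(phi m :: real^'n \<Rightarrow> real) = (\<lambda>x. ?c * ln (5 / norm x))" by (auto simp: phi_def n fun_eq_iff)
    have [measurable]: "polylap m h \<in> borel_measurable borel" using cp by (rule borel_measurable_continuous_onI)
    show "(\<lambda>y. phi m y * polylap m h y) \<in> borel_measurable lborel" unfolding p by simp
    show "(\<lambda>y. ?c * ln 5 * polylap m h y - ?c * (ln (norm y) * polylap m h y)) \<in> borel_measurable lborel" by simp
    show "AE y in lborel. phi m y * polylap m h y = ?c * ln 5 * polylap m h y - ?c * (ln (norm y) * polylap m h y)"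
      using AE by eventually_elim (simp add: phi_def n ln_div algebra_simps)
  qed
  also have "\<dots> = - ?c * (\<integral>y. ln (norm y) * polylap m h y \<partial>lborel)"
    using i0 i1 const by simp
  also have "\<dots> = h 0"
  proof -
    \<comment> \<open>\<open>j\<close> Laplacians remain after the one applied to the logarithm, and
      2j - n = -2 is the exponent it leaves.\<close>
    obtain j where j: "m = Suc j" using m by (cases m) auto
    have hj: "Ck (2 * j + 2) UNIV h" "Ck (2 * j) UNIV h" using h Ck_le[of "2 * m" UNIV h "2 * j"] by (auto simp: j)
    have pj: "Ck 2 UNIV (polylap j h)" "csupp (polylap j h)"
      by (intro Ck_polylap hj open_UNIV csupp_polylap h)+
    show ?thesis
    proof (cases "j = 0")
      case True
      then have "(\<integral>y. ln (norm y) * lap (polylap j h) y \<partial>lborel) = 2 * pi * h 0"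
        using integral_ln_norm_lap(2)[OF pj] n j by simp
      then show ?thesis using True by (simp add: j polylap_Suc fs_const_def)
    next
      case False
      have l: "(\<integral>y. ln (norm y) * lap (polylap j h) y \<partial>lborel) = (real CARD('n) - 2) * (\<integral>y. norm y powr (- 2) * polylap j h y \<partial>lborel)"
        using integral_ln_norm_lap(1)[OF pj] n j False by simp
      have f: "fs_const j CARD('n) * (\<integral>y. norm y powr (real (2 * j) - real CARD('n)) * polylap j h y \<partial>lborel) = h 0"
        using False n j by (intro integral_norm_powr_polylap hj h) auto
      have e: "real (2 * j) - real CARD('n) = - 2" using n j by simp
      have c: "?c * (real CARD('n) - 2) = fs_const j CARD('n)"
      proof -
        have half: "real CARD('n) / 2 - real j = 1" "real CARD('n) / 2 = real m" and n2: "real CARD('n) - 2 = 2 * real j"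
          using n j by (auto simp: field_simps)
        have pw: "pi powr (real CARD('n) / 2) = pi ^ m" unfolding half by (simp add: powr_realpow)
        have fj: "fact j = real j * Gamma (real j)"
          using False Gamma_fact[of "j - 1", where 'a=real] fact_reduce[of j, where 'a=real] by (cases j) (auto simp: add.commute)
        have p2: "(2::real) ^ (2 * m - 1) = 2 * 4 ^ j" by (simp add: j power_mult)
        have c1: "?c = 1 / (2 * 4 ^ j * pi ^ m * (real j * Gamma (real j)))"
        proof -
          have "?c = 1 / (2 ^ (2 * m - 1) * pi ^ m * fact (m - 1))" by (simp add: fs_const_def)
          also have "m - 1 = j" by (simp add: j)
          finally show ?thesis unfolding p2 fj .
        qed
        have c2: "fs_const j CARD('n) = 1 / (4 ^ j * pi ^ m * Gamma (real j))"
        proof -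
          have "CARD('n) \<noteq> 2 * j" using n j by simp
          then show ?thesis unfolding fs_const_def half(1) pw by simp
        qed
        have gen: "1 / (2 * q * P * (r * G)) * (2 * r) = 1 / (q * P * G)"
          if "r \<noteq> 0" for q P r G :: real
          using that by simp
        show ?thesis unfolding c1 c2 n2 by (rule gen) (use False in simp)
      qed
      have "- ?c * (\<integral>y. ln (norm y) * polylap m h y \<partial>lborel) = ?c * (\<integral>y. ln (norm y) * lap (polylap j h) y \<partial>lborel)"
        unfolding j polylap_Suc by simp
      also have "\<dots> = fs_const j CARD('n) * (\<integral>y. norm y powr (- 2) * polylap j h y \<partial>lborel)"
        unfolding l c[symmetric] by (simp only: mult.assoc)
      also have "\<dots> = h 0" using f unfolding e .
      finally show ?thesis .
    qed
  qed
  finally show ?thesis .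
qed

lemma borel_measurable_phi [measurable]: "(phi m :: real^'n::finite \<Rightarrow> real) \<in> borel_measurable borel"
  unfolding phi_def[abs_def] by measurable

lemma integral_reflect:
  fixes f :: "real^'n::finite \<Rightarrow> real"
  assumes "f \<in> borel_measurable borel"
  shows "(\<integral>y. f y \<partial>lborel) = (\<integral>z. f (x - z) \<partial>lborel)"
  using lborel_integral_affine[of "-1" f x] assms by simp

lemma integrable_reflect:
  fixes f :: "real^'n::finite \<Rightarrow> real"
  shows "integrable lborel f \<Longrightarrow> integrable lborel (\<lambda>z. f (x - z))"
  using lborel_integrable_affine[of "-1" f x] by simp

text \<open>The point \<open>x\<close> is moved to 0 by the reflection z to x - z, under which an
  operator of even order keeps its sign.\<close>

theorem fundamental_solution:
  fixes h :: "real^'n::finite \<Rightarrow> real"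
  assumes m: "m \<ge> 1" "CARD('n) \<ge> 2 * m" and h: "Ck (2 * m) UNIV h" "csupp h"
  shows "(\<integral>y. phi m (x - y) * polylap m h y \<partial>lborel) = h x"
proof -
  let ?h = "\<lambda>z. h (x + (- 1) *\<^sub>R z)"
  have C: "Ck (2 * m) UNIV ?h" using Ck_affine[OF open_UNIV h(1), of x "-1"] by simp
  obtain R where R: "R > 0" "\<And>y. R \<le> norm y \<Longrightarrow> h y = 0" using h(2) by (auto simp: csupp_def)
  have "?h y = 0" if "R + norm x \<le> norm y" for y
    using that norm_triangle_ineq4[of x "x - y"] by (intro R(2)) (simp add: algebra_simps, linarith?)
  then have cs: "csupp ?h" unfolding csupp_def using R(1) by (intro exI[of _ "R + norm x"]) (auto intro: add_pos_nonneg)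
  have [measurable]: "polylap m h \<in> borel_measurable borel"
    using Ck_polylap[of UNIV m 0 h] h by (auto intro: borel_measurable_continuous_onI)
  have "h x = (\<integral>y. phi m y * polylap m ?h y \<partial>lborel)"
    using integral_phi_polylap_at_0[OF m C cs] by simp
  also have "\<dots> = (\<integral>y. phi m y * polylap m h (x - y) \<partial>lborel)"
    using polylap_affine[OF open_UNIV h(1), of x "-1"] by simp
  also have "\<dots> = (\<integral>y. phi m (x - y) * polylap m h y \<partial>lborel)"
    using integral_reflect[of "\<lambda>y. phi m y * polylap m h (x - y)" x] by simp
  finally show ?thesis by simp
qed

lemma integrable_phi_times:
  fixes g :: "real^'n::finite \<Rightarrow> real"
  assumes m: "m \<ge> 1" "CARD('n) \<ge> 2 * m" and g: "g \<in> borel_measurable borel"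
    and B: "\<And>y. \<bar>g y\<bar> \<le> B" and R: "\<And>y. R \<le> norm y \<Longrightarrow> g y = 0"
  shows "integrable lborel (\<lambda>y. phi m (x - y) * g y)"
proof -
  note [measurable] = g
  \<comment> \<open>Radius of a ball that contains x - y for every y in the support of
    \<open>g\<close>.\<close>
  define S where "S = \<bar>R\<bar> + norm x"
  have loc: "integrable lborel (\<lambda>z :: real^'n. phi m z * (B * indicator (cball 0 S) z))"
  proof (cases "CARD('n) > 2 * m")
    case True
    have "integrable lborel (\<lambda>z::real^'n. fs_const m CARD('n) * B * (norm z powr (real (2 * m) - real CARD('n)) * indicator (cball 0 S) z))"
      by (intro integrable_mult_right integrable_norm_powr) (use m in simp)
    then show ?thesis using True by (simp add: phi_def mult_ac)
  next
    case False
    let ?c = "\<bar>fs_const m CARD('n)\<bar> * \<bar>B\<bar>"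
    have int: "integrable lborel (\<lambda>z::real^'n. ?c * (norm z powr (- 1) * indicator (cball 0 S) z + (ln 5 + S) * indicator (cball 0 S) z))"
      by (intro integrable_mult_right Bochner_Integration.integrable_add integrable_norm_powr integrable_indicator_cball) (use m in simp)
    show ?thesis
    proof (rule Bochner_Integration.integrable_bound[OF int])
      show "(\<lambda>z::real^'n. phi m z * (B * indicator (cball 0 S) z)) \<in> borel_measurable lborel"
        by (intro borel_measurable_times borel_measurable_indicator) (auto simp: borel_measurable_phi)
      have AE: "AE z :: real^'n in lborel. z \<noteq> 0" by (rule AE_lborel_singleton)
      show "AE z in lborel. norm (phi m z * (B * indicator (cball 0 S) (z::real^'n)))
        \<le> norm (?c * (norm z powr (- 1) * indicator (cball 0 S) z + (ln 5 + S) * indicator (cball 0 S) z))"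
        using AE
      proof eventually_elim
        case (elim z)
        show ?case
        proof (cases "norm z \<le> S")
          case True
          have "\<bar>ln (5 / norm z)\<bar> \<le> ln 5 + (1 / norm z + norm z)"
            using elim abs_ln_le[of "norm z"] abs_triangle_ineq4[of "ln 5" "ln (norm z)"] by (simp add: ln_div)
          also have "\<dots> \<le> norm z powr (- 1) + (ln 5 + S)"
            using True elim by (simp add: powr_minus inverse_eq_divide)
          finally have l: "\<bar>ln (5 / norm z)\<bar> \<le> norm z powr (- 1) + (ln 5 + S)" .
          have "norm (phi m z * (B * indicator (cball 0 S) z)) = ?c * \<bar>ln (5 / norm z)\<bar>"
            using False True by (simp add: phi_def abs_mult)
          also have "\<dots> \<le> ?c * (norm z powr (- 1) + (ln 5 + S))"
            using l by (intro mult_left_mono) auto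
          also have "?c * (norm z powr (- 1) + (ln 5 + S)) = ?c * (norm z powr (- 1) * indicator (cball 0 S) z + (ln 5 + S) * indicator (cball 0 S) z)"
            using True by simp
          also have "\<dots> \<le> norm \<dots>" unfolding real_norm_def by (rule abs_ge_self)
          finally show ?thesis .
        qed simp
      qed
    qed
  qed
  have B0: "B \<ge> 0" using B[of 0] by linarith
  show ?thesis
  proof (rule Bochner_Integration.integrable_bound[OF integrable_reflect[OF loc, of x]])
    show "(\<lambda>y. phi m (x - y) * g y) \<in> borel_measurable lborel" by simp
    show "AE y in lborel. norm (phi m (x - y) * g y) \<le> norm (phi m (x - y) * (B * indicator (cball 0 S) (x - y)))"
    proof (rule AE_I2)
      fix y
      show "norm (phi m (x - y) * g y) \<le> norm (phi m (x - y) * (B * indicator (cball 0 S) (x - y)))"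
      proof (cases "R \<le> norm y")
        case False
        then have "norm (x - y) \<le> S" unfolding S_def using norm_triangle_ineq4[of x y] by linarith
        then show ?thesis using B[of y] B0 by (simp add: abs_mult mult_left_mono)
      qed (use R in simp)
    qed
  qed
qed

section \<open>Smoothness and polyharmonicity of \<open>phi\<close> off the origin\<close>

lemma phi_as_radial:
  assumes "x \<noteq> 0"
  shows "phi m (x :: real^'n::finite) = (if CARD('n) > 2*m
              then fs_const m CARD('n) * ((norm x)\<^sup>2 + 0) powr (real m - real CARD('n) / 2)
              else fs_const m CARD('n) * ln 5 - fs_const m CARD('n) * (ln ((norm x)\<^sup>2 + 0) / 2))"
proof -
  have "norm x powr (real (2 * m) - real CARD('n)) = (norm x)\<^sup>2 powr (real m - real CARD('n) / 2)"
    using norm_powr_double[of x "real m - real CARD('n) / 2"] by (simp add: algebra_simps)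
  then show ?thesis using assms by (simp add: phi_def ln_div ln_realpow algebra_simps)
qed

lemma open_Compl_0 [simp]: "open (- {0 :: real^'n::finite})"
  by (simp add: open_Compl)

text \<open>The summand 0 is kept so that the Laplacian formulas for the shifted norm apply
  literally with d = 0.\<close>

lemma Ck_norm_powr: "Ck k (- {0}) (\<lambda>y :: real^'n::finite. ((norm y)\<^sup>2 + 0) powr a)"
  by (intro Ck_powr Ck_add Ck_norm2 Ck_const) auto

lemma Ck_norm_ln: "Ck k (- {0}) (\<lambda>y :: real^'n::finite. ln ((norm y)\<^sup>2 + 0) / 2)"
proof -
  have "Ck k (- {0}) (\<lambda>y :: real^'n. 1 / 2 * ln ((norm y)\<^sup>2 + 0))"
    by (intro Ck_cmult Ck_ln Ck_add Ck_norm2 Ck_const) auto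
  then show ?thesis by simp
qed

lemma Cinf_phi: "Cinf (- {0}) (phi m :: real^'n::finite \<Rightarrow> real)"
  unfolding Cinf_def
proof
  fix k
  have "Ck k (- {0}) (\<lambda>x :: real^'n. if CARD('n) > 2*m
              then fs_const m CARD('n) * ((norm x)\<^sup>2 + 0) powr (real m - real CARD('n) / 2)
              else fs_const m CARD('n) * ln 5 - fs_const m CARD('n) * (ln ((norm x)\<^sup>2 + 0) / 2))"
    using Ck_cmult[OF open_Compl_0 Ck_norm_powr] Ck_diff[OF open_Compl_0 Ck_const Ck_cmult[OF open_Compl_0 Ck_norm_ln]]
    by (cases "CARD('n) > 2*m") (simp_all only: if_True if_False)
  then show "Ck k (- {0}) (phi m :: real^'n \<Rightarrow> real)"
    by (rule Ck_cong[rotated 2]) (auto simp: phi_as_radial)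
qed

text \<open>Each Laplacian lowers the exponent by one, until the last acts on the harmonic exponent
  1 - n/2 and gives 0.\<close>

lemma polylap_norm_powr:
  fixes y :: "real^'n::finite"
  assumes "k \<ge> 1" "y \<noteq> 0"
  shows "polylap k (\<lambda>y. ((norm y)\<^sup>2 + 0) powr (real k - real CARD('n) / 2)) y = 0"
  using assms
proof (induction k arbitrary: y rule: nat_induct_at_least)
  case base
  then show ?case by (simp only: One_nat_def polylap_Suc polylap_0) (subst lap_shifted_norm_powr; simp)
next
  case (Suc k)
  have op: "open (- {0 :: real^'n})" by simp
  let ?a = "real (Suc k) - real CARD('n) / 2"
  let ?c = "- (2 * ?a * (2 * ?a - 2 + real CARD('n)))"
  have "polylap (Suc k) (\<lambda>y. ((norm y)\<^sup>2 + 0) powr ?a) y = polylap k (\<lambda>y. ?c * ((norm y)\<^sup>2 + 0) powr (?a - 1)) y"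
    unfolding polylap_Suc_right
  proof (rule polylap_cong[OF op])
    fix z :: "real^'n" assume "z \<in> - {0}"
    then have "(0::real) > 0 \<or> (0::real) = 0 \<and> z \<noteq> 0" by simp
    from lap_shifted_norm_powr[OF this, of ?a]
    show "- lap (\<lambda>y. ((norm y)\<^sup>2 + 0) powr ?a) z = ?c * ((norm z)\<^sup>2 + 0) powr (?a - 1)"
      by (simp only: mult_zero_left mult_zero_right diff_zero mult_minus_left)
  qed (use Suc.prems in simp)
  also have "\<dots> = ?c * polylap k (\<lambda>y. ((norm y)\<^sup>2 + 0) powr (?a - 1)) y"
    using Suc.prems by (intro polylap_cmult[OF op Ck_norm_powr]) auto
  also have "?a - 1 = real k - real CARD('n) / 2" by simp
  finally show ?case using Suc by simp
qed

text \<open>In the logarithmic case one Laplacian leaves (n - 2)|y|^(-2), which is 0 for m = 1 and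
  otherwise the power treated before with m - 1 Laplacians to go.\<close>

lemma polylap_phi:
  fixes y :: "real^'n::finite"
  assumes m: "m \<ge> 1" "CARD('n) \<ge> 2 * m" and y: "y \<noteq> 0"
  shows "polylap m (phi m) y = 0"
proof -
  have op: "open (- {0 :: real^'n})" by simp
  have "polylap m (phi m) y = polylap m (\<lambda>x. if CARD('n) > 2*m
              then fs_const m CARD('n) * ((norm x)\<^sup>2 + 0) powr (real m - real CARD('n) / 2)
              else fs_const m CARD('n) * ln 5 - fs_const m CARD('n) * (ln ((norm x)\<^sup>2 + 0) / 2)) y"
    using y by (intro polylap_cong[OF op] phi_as_radial) auto
  also have "\<dots> = 0"
  proof (cases "CARD('n) > 2*m")
    case True
    then show ?thesis
      using polylap_cmult[OF op Ck_norm_powr, of y m "fs_const m CARD('n)"] polylap_norm_powr[OF m(1) y] y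
      by simp
  next
    case False
    then have n: "CARD('n) = 2 * m" using m by simp
    have "polylap m (\<lambda>x::real^'n. ln ((norm x)\<^sup>2 + 0) / 2) y = 0"
    proof (cases "m = 1")
      case True
      then show ?thesis using n y
        by (simp only: True One_nat_def polylap_Suc polylap_0) (subst lap_shifted_norm_ln; simp)
    next
      case False
      then obtain j where j: "m = Suc j" "j \<ge> 1" using m by (cases m) auto
      let ?c = "- (real CARD('n) - 2)"
      have "polylap m (\<lambda>x::real^'n. ln ((norm x)\<^sup>2 + 0) / 2) y = polylap j (\<lambda>y. ?c * ((norm y)\<^sup>2 + 0) powr (- 1)) y"
        unfolding j polylap_Suc_right
      proof (rule polylap_cong[OF op])
        fix z :: "real^'n" assume "z \<in> - {0}"
        then have "(0::real) > 0 \<or> (0::real) = 0 \<and> z \<noteq> 0" by simp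
        from lap_shifted_norm_ln[OF this]
        show "- lap (\<lambda>y. ln ((norm y)\<^sup>2 + 0) / 2) z = ?c * ((norm z)\<^sup>2 + 0) powr (- 1)"
          by (simp only: mult_zero_left mult_zero_right add_0_right mult_minus_left)
      qed (use y in simp)
      also have "\<dots> = ?c * polylap j (\<lambda>y. ((norm y)\<^sup>2 + 0) powr (- 1)) y"
        using y by (intro polylap_cmult[OF op Ck_norm_powr]) auto
      also have "- 1 = real j - real CARD('n) / 2" using n j by (simp add: field_simps)
      finally show ?thesis using polylap_norm_powr[OF j(2) y] by simp
    qed
    moreover have "polylap m (\<lambda>x::real^'n. fs_const m CARD('n) * ln 5 - fs_const m CARD('n) * (ln ((norm x)\<^sup>2 + 0) / 2)) y
      = polylap m (\<lambda>x. fs_const m CARD('n) * ln 5) y - polylap m (\<lambda>x. fs_const m CARD('n) * (ln ((norm x)\<^sup>2 + 0) / 2)) y"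
      using y by (intro polylap_diff[OF op] Ck_const Ck_cmult[OF op] Ck_norm_ln) auto
    moreover have "polylap m (\<lambda>x::real^'n. fs_const m CARD('n) * (ln ((norm x)\<^sup>2 + 0) / 2)) y
      = fs_const m CARD('n) * polylap m (\<lambda>x. ln ((norm x)\<^sup>2 + 0) / 2) y"
      using y by (intro polylap_cmult[OF op] Ck_norm_ln) auto
    ultimately show ?thesis using n m by (simp add: polylap_const del: add_0_right)
  qed
  finally show ?thesis .
qed

section \<open>Cutoff functions and homogeneous derivative bounds at the origin\<close>

text \<open>Positive parts raised to the power \<open>k + 1\<close> are only \<open>C\<^sup>k\<close>, which suffices because the order of
  differentiation is fixed throughout.\<close>

definition cutoff :: "nat \<Rightarrow> real \<Rightarrow> real \<Rightarrow> real^'n::finite \<Rightarrow> real" where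
  "cutoff k r R y = (max 0 (1 - (max 0 (((norm y)\<^sup>2 - r\<^sup>2) / (R\<^sup>2 - r\<^sup>2))) ^ Suc k)) ^ Suc k"

lemma Ck_cutoff: "Ck k UNIV (cutoff k r R :: real^'n::finite \<Rightarrow> real)"
proof -
  have "Ck k UNIV (\<lambda>y::real^'n. 1 / (R\<^sup>2 - r\<^sup>2) * ((norm y)\<^sup>2 - r\<^sup>2))"
    by (intro Ck_cmult Ck_diff Ck_norm2 Ck_const open_UNIV)
  then have "Ck k UNIV (\<lambda>y::real^'n. ((norm y)\<^sup>2 - r\<^sup>2) / (R\<^sup>2 - r\<^sup>2))" by simp
  then show ?thesis unfolding cutoff_def[abs_def]
    by (intro Ck_pos_power Ck_diff Ck_const open_UNIV) auto
qed

lemma cutoff_eq_1: "0 \<le> r \<Longrightarrow> r < R \<Longrightarrow> norm y \<le> r \<Longrightarrow> cutoff k r R y = 1"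
proof -
  assume a: "0 \<le> r" "r < R" "norm y \<le> r"
  have "(norm y)\<^sup>2 \<le> r\<^sup>2" "r\<^sup>2 < R\<^sup>2" using a by (simp_all add: power_mono power_strict_mono)
  then have "max 0 (((norm y)\<^sup>2 - r\<^sup>2) / (R\<^sup>2 - r\<^sup>2)) = 0"
    by (intro max_absorb1 divide_nonpos_pos) auto
  then show ?thesis unfolding cutoff_def by simp
qed

lemma cutoff_eq_0: "0 \<le> r \<Longrightarrow> r < R \<Longrightarrow> R \<le> norm y \<Longrightarrow> cutoff k r R y = 0"
proof -
  assume a: "0 \<le> r" "r < R" "R \<le> norm y"
  have "R\<^sup>2 \<le> (norm y)\<^sup>2" "r\<^sup>2 < R\<^sup>2" using a by (simp_all add: power_mono power_strict_mono)
  then have "1 \<le> ((norm y)\<^sup>2 - r\<^sup>2) / (R\<^sup>2 - r\<^sup>2)" by simp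
  then have "1 \<le> (max 0 (((norm y)\<^sup>2 - r\<^sup>2) / (R\<^sup>2 - r\<^sup>2))) ^ Suc k" by (intro one_le_power) simp
  then have "max 0 (1 - (max 0 (((norm y)\<^sup>2 - r\<^sup>2) / (R\<^sup>2 - r\<^sup>2))) ^ Suc k) = 0"
    by (intro max_absorb1) (simp only: diff_le_0_iff_le)
  then show ?thesis unfolding cutoff_def by (simp only: power_Suc mult_zero_left)
qed

lemma cutoff_nonneg: "0 \<le> cutoff k r R y"
  unfolding cutoff_def by (intro zero_le_power) simp

lemma cutoff_le_1: "cutoff k r R y \<le> 1"
  unfolding cutoff_def by (intro power_le_one) auto

text \<open>All scales are dilates of one profile, so a single estimate at scale 1 serves them
  all.\<close>

lemma cutoff_scale: "e > 0 \<Longrightarrow> cutoff k (e * r) (e * R) y = cutoff k r R ((1 / e) *\<^sub>R y)"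
  unfolding cutoff_def
  by (auto simp: power_mult_distrib power_divide field_simps right_diff_distrib[symmetric] intro!: arg_cong[where f="\<lambda>t. max 0 (1 - t ^ Suc k) ^ Suc k"] arg_cong[where f="max 0"])

lemma csupp_cutoff: "0 \<le> r \<Longrightarrow> r < R \<Longrightarrow> csupp (cutoff k r R)"
  unfolding csupp_def using cutoff_eq_0 by (intro exI[of _ R]) auto

text \<open>Symbol estimates of order \<open>a\<close>: derivatives of order j up to
  \<open>k\<close> are at most K |y|^(a - j) off the origin. One constant for all orders makes
  uniformity in a parameter easy to state.\<close>

fun symb :: "nat \<Rightarrow> real \<Rightarrow> real \<Rightarrow> (real^'n::finite \<Rightarrow> real) \<Rightarrow> bool" where
  "symb 0 K a g = (\<forall>y. y \<noteq> 0 \<longrightarrow> \<bar>g y\<bar> \<le> K * norm y powr a)"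
| "symb (Suc k) K a g = ((\<forall>y. y \<noteq> 0 \<longrightarrow> \<bar>g y\<bar> \<le> K * norm y powr a) \<and> (\<forall>i. symb k K (a - 1) (pd i g)))"

lemma symbD: "symb k K a g \<Longrightarrow> y \<noteq> 0 \<Longrightarrow> \<bar>g y\<bar> \<le> K * norm y powr a"
  by (cases k) auto

lemma symb_SucD: "symb (Suc k) K a g \<Longrightarrow> symb k K a g"
  by (induction k arbitrary: a g) auto

lemma symb_mono: "symb k K a g \<Longrightarrow> K \<le> L \<Longrightarrow> symb k L a g"
proof (induction k arbitrary: a g)
  case 0
  have "K * norm y powr a \<le> L * norm y powr a" for y :: "real^'a" using 0 by (intro mult_right_mono) auto
  then show ?case using 0 by (force intro: order_trans)
next
  case (Suc k)
  have "K * norm y powr a \<le> L * norm y powr a" for y :: "real^'a" using Suc by (intro mult_right_mono) auto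
  then show ?case using Suc by (force intro: order_trans)
qed

lemma symb_cong:
  assumes "\<And>y. y \<noteq> 0 \<Longrightarrow> g y = h y" "symb k K a g"
  shows "symb k K a h"
  using assms
proof (induction k arbitrary: a g h)
  case (Suc k)
  have "symb k K (a - 1) (pd i h)" for i
  proof (rule Suc.IH)
    show "pd i g y = pd i h y" if "y \<noteq> 0" for y
      by (rule pd_cong[where S="- {0}"]) (use that Suc.prems(1) in auto)
    show "symb k K (a - 1) (pd i g)" using Suc.prems(2) by simp
  qed
  then show ?case using Suc.prems by simp
qed simp

lemma symb_const_0: "0 \<le> K \<Longrightarrow> symb k K a (\<lambda>_. 0)"
  by (induction k arbitrary: a) auto

lemma symb_add:
  assumes "Ck k (- {0}) g" "Ck k (- {0}) h" "symb k K a g" "symb k L a h"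
  shows "symb k (K + L) a (\<lambda>y. g y + h y)"
  using assms
proof (induction k arbitrary: a g h)
  case 0
  show ?case using symbD[OF 0(3)] symbD[OF 0(4)] by (fastforce simp: distrib_right)
next
  case (Suc k)
  have "\<bar>g y + h y\<bar> \<le> (K + L) * norm y powr a" if "y \<noteq> 0" for y
    using symbD[OF Suc.prems(3) that] symbD[OF Suc.prems(4) that] by (simp add: distrib_right)
  moreover have "symb k (K + L) (a - 1) (pd i (\<lambda>y. g y + h y))" for i
  proof (rule symb_cong)
    show "symb k (K + L) (a - 1) (\<lambda>y. pd i g y + pd i h y)"
      by (rule Suc.IH) (use Suc.prems in \<open>auto intro: Ck_pd\<close>)
    show "pd i g y + pd i h y = pd i (\<lambda>y. g y + h y) y" if "y \<noteq> 0" for y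
      using pd_add[OF Suc.prems(1,2)] that by simp
  qed
  ultimately show ?case by simp
qed

lemma symb_cmult:
  assumes "Ck k (- {0}) g" "symb k K a g"
  shows "symb k (\<bar>c\<bar> * K) a (\<lambda>y. c * g y)"
  using assms
proof (induction k arbitrary: a g)
  case 0
  show ?case using symbD[OF 0(2)] by (auto simp: abs_mult mult.assoc intro!: mult_left_mono)
next
  case (Suc k)
  have "\<bar>c * g y\<bar> \<le> \<bar>c\<bar> * K * norm y powr a" if "y \<noteq> 0" for y
    using symbD[OF Suc.prems(2) that] by (auto simp: abs_mult mult.assoc intro!: mult_left_mono)
  moreover have "symb k (\<bar>c\<bar> * K) (a - 1) (pd i (\<lambda>y. c * g y))" for i
  proof (rule symb_cong)
    show "symb k (\<bar>c\<bar> * K) (a - 1) (\<lambda>y. c * pd i g y)"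
      by (rule Suc.IH) (use Suc.prems in \<open>auto intro: Ck_pd\<close>)
    show "c * pd i g y = pd i (\<lambda>y. c * g y) y" if "y \<noteq> 0" for y
      using pd_cmult[OF Suc.prems(1)] that by simp
  qed
  ultimately show ?case by simp
qed

lemma symb_sum:
  assumes "finite A" "\<And>i. i \<in> A \<Longrightarrow> Ck k (- {0}) (g i)" "\<And>i. i \<in> A \<Longrightarrow> symb k K a (g i)"
  shows "symb k (real (card A) * K) a (\<lambda>y. \<Sum>i\<in>A. g i y)"
  using assms
proof (induction A)
  case empty
  show ?case by (simp add: symb_const_0)
next
  case (insert i A)
  have "symb k (K + real (card A) * K) a (\<lambda>y. g i y + (\<Sum>i\<in>A. g i y))"
    by (intro symb_add Ck_sum insert open_Compl_0) (use insert in auto)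
  then show ?case using insert.hyps by (simp add: distrib_right)
qed

text \<open>Every use of the product rule doubles the number of terms, whence the factor
  2^k.\<close>

lemma symb_mult:
  assumes "Ck k (- {0}) g" "Ck k (- {0}) h" "symb k K a g" "symb k L b h" "0 \<le> K" "0 \<le> L"
  shows "symb k (2 ^ k * (K * L)) (a + b) (\<lambda>y. g y * h y)"
  using assms(1-4)
proof (induction k arbitrary: a b g h)
  case 0
  show ?case
  proof (simp, intro allI impI)
    fix y :: "real^'a" assume "y \<noteq> 0"
    then have "\<bar>g y * h y\<bar> \<le> (K * norm y powr a) * (L * norm y powr b)"
      unfolding abs_mult using symbD[OF 0(3)] symbD[OF 0(4)] assms(5,6) by (intro mult_mono) auto
    then show "\<bar>g y * h y\<bar> \<le> K * L * norm y powr (a + b)" by (simp add: powr_add mult_ac)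
  qed
next
  case (Suc k)
  have "\<bar>g y * h y\<bar> \<le> 2 ^ Suc k * (K * L) * norm y powr (a + b)" if "y \<noteq> 0" for y
  proof -
    have "\<bar>g y * h y\<bar> \<le> (K * norm y powr a) * (L * norm y powr b)"
      unfolding abs_mult using symbD[OF Suc.prems(3) that] symbD[OF Suc.prems(4) that] assms(5,6) by (intro mult_mono) auto
    also have "\<dots> = 1 * (K * L * norm y powr (a + b))" by (simp add: powr_add mult_ac)
    also have "\<dots> \<le> 2 ^ Suc k * (K * L * norm y powr (a + b))"
      using assms(5,6) by (intro mult_right_mono one_le_power mult_nonneg_nonneg) auto
    finally show ?thesis by (simp add: mult_ac)
  qed
  moreover have "symb k (2 ^ Suc k * (K * L)) (a + b - 1) (pd i (\<lambda>y. g y * h y))" for i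
  proof (rule symb_cong)
    have 1: "symb k (2 ^ k * (K * L)) (a - 1 + b) (\<lambda>y. pd i g y * h y)"
      by (rule Suc.IH) (use Suc.prems in \<open>auto intro: Ck_pd Ck_SucD symb_SucD\<close>)
    have 2: "symb k (2 ^ k * (K * L)) (a + (b - 1)) (\<lambda>y. g y * pd i h y)"
      by (rule Suc.IH) (use Suc.prems in \<open>auto intro: Ck_pd Ck_SucD symb_SucD\<close>)
    have "symb k (2 ^ k * (K * L) + 2 ^ k * (K * L)) (a + b - 1) (\<lambda>y. pd i g y * h y + g y * pd i h y)"
      by (rule symb_add) (use 1 2 Suc.prems in \<open>auto intro!: Ck_mult intro: Ck_pd Ck_SucD simp: algebra_simps\<close>)
    moreover have "2 ^ Suc k * (K * L) = 2 ^ k * (K * L) + 2 ^ k * (K * L)" by simp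
    ultimately show "symb k (2 ^ Suc k * (K * L)) (a + b - 1) (\<lambda>y. pd i g y * h y + g y * pd i h y)" by (simp only:)
    show "pd i g y * h y + g y * pd i h y = pd i (\<lambda>y. g y * h y) y" if "y \<noteq> 0" for y
      using pd_mult[OF Suc.prems(1,2)] that by simp
  qed
  ultimately show ?case by simp
qed

lemma symb_lap:
  fixes g :: "real^'n::finite \<Rightarrow> real"
  assumes "Ck (Suc (Suc k)) (- {0}) g" "symb (Suc (Suc k)) K a g"
  shows "symb k (real CARD('n) * K) (a - 2) (lap g)"
  unfolding lap_def[abs_def]
proof (rule symb_sum)
  show "Ck k (- {0}) (pd i (pd i g))" for i using assms(1) by (intro Ck_pd)
  have "symb k K (a - 1 - 1) (pd i (pd i g))" for i using assms(2) by simp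
  then show "symb k K (a - 2) (pd i (pd i g))" for i by simp
qed auto

text \<open>Each Laplacian costs two orders and a factor n. For \<open>a = 2 * real m\<close> and
  \<open>k = 0\<close> a plain uniform bound remains.\<close>

lemma symb_polylap:
  fixes g :: "real^'n::finite \<Rightarrow> real"
  assumes "Ck (2 * m + k) (- {0}) g" "symb (2 * m + k) K a g"
  shows "symb k (real CARD('n) ^ m * K) (a - 2 * real m) (polylap m g)"
  using assms
proof (induction m arbitrary: k)
  case (Suc m)
  have 1: "symb (Suc (Suc k)) (real CARD('n) ^ m * K) (a - 2 * real m) (polylap m g)"
    using Suc.IH[of "Suc (Suc k)"] Suc.prems by simp
  have c: "Ck (Suc (Suc k)) (- {0}) (polylap m g)"
    using Ck_polylap[OF open_Compl_0, of m "Suc (Suc k)"] Suc.prems(1) by simp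
  have "symb k (\<bar>- 1\<bar> * (real CARD('n) * (real CARD('n) ^ m * K))) (a - 2 * real m - 2) (\<lambda>y. - 1 * lap (polylap m g) y)"
    by (intro symb_cmult symb_lap[OF c 1] Ck_lap c open_Compl_0)
  then show ?case by (simp add: polylap_Suc algebra_simps)
qed simp

text \<open>For \<open>a = 0\<close> the constant does not change with \<open>e\<close>: estimates
  of order 0 are invariant under dilation.\<close>

lemma symb_scale:
  assumes "Ck k (- {0}) g" "symb k K a g" "e > 0"
  shows "symb k (K * e powr (- a)) a (\<lambda>y. g ((1 / e) *\<^sub>R y))"
  using assms(1,2)
proof (induction k arbitrary: a g)
  case 0
  have "\<bar>g ((1 / e) *\<^sub>R y)\<bar> \<le> K * e powr (- a) * norm y powr a" if "y \<noteq> 0" for y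
    using symbD[OF 0(2), of "(1 / e) *\<^sub>R y"] that assms(3) by (simp add: powr_mult powr_divide powr_minus_divide mult.assoc)
  then show ?case by simp
next
  case (Suc k)
  have "\<bar>g ((1 / e) *\<^sub>R y)\<bar> \<le> K * e powr (- a) * norm y powr a" if "y \<noteq> 0" for y
    using symbD[OF Suc.prems(2), of "(1 / e) *\<^sub>R y"] that assms(3) by (simp add: powr_mult powr_divide powr_minus_divide mult.assoc)
  moreover have "symb k (K * e powr (- a)) (a - 1) (pd i (\<lambda>y. g ((1 / e) *\<^sub>R y)))" for i
  proof (rule symb_cong)
    have "{y. 0 + (1 / e) *\<^sub>R y \<in> - {0 :: real^'a}} = - {0}" using assms(3) by auto
    then have c: "Ck k (- {0}) (\<lambda>y. pd i g ((1 / e) *\<^sub>R y))"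
      using Ck_affine[OF open_Compl_0 Ck_pd[OF Suc.prems(1)], of 0 "1 / e" i] by simp
    have "symb k (K * e powr (- (a - 1))) (a - 1) (\<lambda>y. pd i g ((1 / e) *\<^sub>R y))"
      by (rule Suc.IH) (use Suc.prems in \<open>auto intro: Ck_pd\<close>)
    from symb_cmult[OF c this, of "1 / e"]
    have "symb k (1 / e * (K * e powr (- (a - 1)))) (a - 1) (\<lambda>y. 1 / e * pd i g ((1 / e) *\<^sub>R y))"
      using assms(3) by simp
    moreover have "1 / e * e powr (- (a - 1)) = e powr (- a)"
      using assms(3) powr_add[of e 1 "- a"] by simp
    ultimately show "symb k (K * e powr (- a)) (a - 1) (\<lambda>y. 1 / e * pd i g ((1 / e) *\<^sub>R y))"
      by (metis mult.left_commute)
    show "1 / e * pd i g ((1 / e) *\<^sub>R y) = pd i (\<lambda>y. g ((1 / e) *\<^sub>R y)) y" if "y \<noteq> 0" for y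
      using pd_affine[OF Suc.prems(1), of 0 "1 / e" y i] that assms(3) by simp
  qed
  ultimately show ?case by simp
qed

lemma ex_symb_uniform:
  fixes P :: "'n::finite \<Rightarrow> real^'n \<Rightarrow> real"
  assumes "\<And>i. \<exists>K\<ge>0. symb k K a (P i)"
  obtains K where "K \<ge> 0" "\<And>i. symb k K a (P i)"
proof -
  obtain K where K: "\<And>i. K i \<ge> 0" "\<And>i. symb k (K i) a (P i)" using assms by metis
  have "K i \<le> (\<Sum>i\<in>UNIV. K i)" for i by (rule member_le_sum) (use K in auto)
  then have "\<And>i. symb k (\<Sum>i\<in>UNIV. K i) a (P i)" using K symb_mono by blast
  moreover have "(\<Sum>i\<in>UNIV. K i) \<ge> 0" using K by (intro sum_nonneg) auto
  ultimately show ?thesis using that by blast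
qed

text \<open>Where \<open>g\<close> is nonzero |y| lies between two positive radii, so every power of
  |y| is bounded below there and the order \<open>a\<close> is arbitrary.\<close>

lemma ex_symb_annulus:
  fixes g :: "real^'n::finite \<Rightarrow> real"
  assumes "Ck k UNIV g" "csupp g" "\<And>y. norm y < 1 \<Longrightarrow> g y = 0"
  shows "\<exists>K\<ge>0. symb k K a g"
proof -
  have base: "\<exists>K\<ge>0. \<forall>y. y \<noteq> 0 \<longrightarrow> \<bar>g y\<bar> \<le> K * norm y powr a"
    if c: "continuous_on UNIV g" and s: "csupp g" and z: "\<And>y. norm y < 1 \<Longrightarrow> g y = 0"
    for g :: "real^'n \<Rightarrow> real" and a
  proof -
    obtain B where B: "B > 0" "\<And>y. \<bar>g y\<bar> \<le> B" using bounded_continuous_csupp[OF c s] by blast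
    obtain R where R: "R > 0" "\<And>y. R \<le> norm y \<Longrightarrow> g y = 0" using s by (auto simp: csupp_def)
    \<comment> \<open>A lower bound of |y|^a for 1 <= |y| < R, whatever the sign of
      \<open>a\<close>.\<close>
    let ?q = "min 1 (R powr a)"
    have q: "?q > 0" using R by simp
    have "\<bar>g y\<bar> \<le> B / ?q * norm y powr a" if "y \<noteq> 0" for y
    proof (cases "1 \<le> norm y \<and> norm y < R")
      case True
      have "?q \<le> norm y powr a"
      proof (cases "a \<ge> 0")
        case True
        then show ?thesis using ge_one_powr_ge_zero[of "norm y" a] \<open>1 \<le> norm y \<and> norm y < R\<close> by simp
      next
        case False
        then have "R powr a \<le> norm y powr a" using True that by (intro powr_mono2') auto
        then show ?thesis by simp
      qed
      then have "B / ?q * ?q \<le> B / ?q * norm y powr a" using B q by (intro mult_left_mono) auto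
      then show ?thesis using B(2)[of y] q by simp
    next
      case False
      then have "g y = 0" using z R(2) by (meson not_le)
      then show ?thesis using B q by simp
    qed
    then show ?thesis using B q by (intro exI[of _ "B / ?q"]) auto
  qed
  show ?thesis using assms
  proof (induction k arbitrary: a g)
    case 0
    then show ?case using base[of g a] by (auto simp: Ck_continuous_on)
  next
    case (Suc k)
    have "\<exists>K\<ge>0. symb k K (a - 1) (pd i g)" for i
    proof (rule Suc.IH)
      show "pd i g y = 0" if "norm y < 1" for y
        using pd_cong[of "ball 0 1" y g "\<lambda>_. 0" i] that Suc.prems(3) by simp
    qed (use Suc.prems in \<open>auto intro: Ck_pd csupp_pd\<close>)
    then obtain K where K: "K \<ge> 0" "\<And>i. symb k K (a - 1) (pd i g)"
      using ex_symb_uniform[of k "a - 1" "\<lambda>i. pd i g"] by blast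
    obtain L where L: "L \<ge> 0" "\<forall>y. y \<noteq> 0 \<longrightarrow> \<bar>g y\<bar> \<le> L * norm y powr a"
      using base[of g a] Suc.prems Ck_continuous_on by blast
    have "\<bar>g y\<bar> \<le> (K + L) * norm y powr a" if "y \<noteq> 0" for y
      using L(2) that K(1) by (force simp: distrib_right intro: add_increasing)
    moreover have "symb k (K + L) (a - 1) (pd i g)" for i using symb_mono[OF K(2)] L by simp
    ultimately show ?case using K(1) L(1) by (intro exI[of _ "K + L"]) auto
  qed
qed

text \<open>The function equals 1 far out, but its derivatives live on the annulus between radii 1
  and 2. The function itself is bounded by 1, its derivatives by the annulus estimate.\<close>

lemma ex_symb_inner_cutoff:
  shows "\<exists>K\<ge>0. symb k K 0 (\<lambda>y :: real^'n::finite. 1 - cutoff k 1 2 y)"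
proof -
  have b: "\<bar>1 - cutoff k 1 2 y\<bar> \<le> 1" for y :: "real^'n"
    using cutoff_nonneg[of k 1 2 y] cutoff_le_1[of k 1 2 y] by simp
  show ?thesis
  proof (cases k)
    case 0
    then show ?thesis using b by (intro exI[of _ 1]) auto
  next
    case (Suc j)
    have C: "Ck (Suc j) UNIV (\<lambda>y :: real^'n. 1 - cutoff k 1 2 y)"
      using Ck_diff[OF open_UNIV Ck_const Ck_cutoff] Suc by simp
    have eq: "pd i (\<lambda>y. 1 - cutoff k 1 2 y) y = - pd i (cutoff k 1 2) y" for i and y :: "real^'n"
    proof -
      have "has_pd (\<lambda>y. 1 + - 1 * cutoff k 1 2 y) i (0 + (0 * cutoff k 1 2 y + - 1 * pd i (cutoff k 1 2) y)) y"
        using Ck_Suc_has_pd[of j UNIV "cutoff k 1 2"] Ck_cutoff[of k 1 2] Suc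
        by (intro has_pd_add has_pd_mult has_pd_const) auto
      from has_pd_imp_pd[OF this] show ?thesis by simp
    qed
    have "\<exists>K\<ge>0. symb j K (0 - 1) (pd i (\<lambda>y :: real^'n. 1 - cutoff k 1 2 y))" for i
    proof (rule ex_symb_annulus)
      show "Ck j UNIV (pd i (\<lambda>y :: real^'n. 1 - cutoff k 1 2 y))" using C by (rule Ck_pd)
      show "csupp (pd i (\<lambda>y :: real^'n. 1 - cutoff k 1 2 y))"
        unfolding eq[abs_def] by (intro csupp_uminus csupp_pd csupp_cutoff) auto
      show "pd i (\<lambda>y :: real^'n. 1 - cutoff k 1 2 y) y = 0" if "norm y < 1" for y
        by (rule trans[OF pd_cong[where S="ball 0 1" and h="\<lambda>_. 0"]])
           (use that in \<open>simp_all add: cutoff_eq_1\<close>)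
    qed
    then obtain K where K: "K \<ge> 0" "\<And>i. symb j K (0 - 1) (pd i (\<lambda>y :: real^'n. 1 - cutoff k 1 2 y))"
      using ex_symb_uniform[of j "0 - 1" "\<lambda>i. pd i (\<lambda>y :: real^'n. 1 - cutoff k 1 2 y)"] by blast
    have "\<bar>1 - cutoff k 1 2 y\<bar> \<le> (1 + K) * norm y powr 0" if "y \<noteq> 0" for y :: "real^'n" using b[of y] K that by simp
    moreover have "symb j (1 + K) (0 - 1) (pd i (\<lambda>y :: real^'n. 1 - cutoff k 1 2 y))" for i
      using symb_mono[OF K(2)] by simp
    ultimately show ?thesis unfolding Suc using K(1) Suc by (intro exI[of _ "1 + K"]) simp
  qed
qed

text \<open>Taylor's theorem at a flat point, by induction: the partial derivatives are flat to one
  order less, and the mean value theorem on the segment from 0 recovers the lost order. The sum over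
  coordinates gives the factor n.\<close>

lemma ex_symb_flat:
  fixes g :: "real^'n::finite \<Rightarrow> real"
  assumes "Ck k UNIV g" "csupp g" "\<And>w. length w < k \<Longrightarrow> foldr pd w g 0 = 0"
  shows "\<exists>K\<ge>0. symb k K (real k) g"
  using assms
proof (induction k arbitrary: g)
  case 0
  obtain B where "B > 0" "\<And>y. \<bar>g y\<bar> \<le> B"
    using bounded_continuous_csupp[OF Ck_continuous_on[OF 0(1)] 0(2)] by blast
  then show ?case by (intro exI[of _ B]) auto
next
  case (Suc k)
  have "\<exists>K\<ge>0. symb k K (real k) (pd i g)" for i
  proof (rule Suc.IH)
    show "foldr pd w (pd i g) 0 = 0" if "length w < k" for w
      using Suc.prems(3)[of "w @ [i]"] that by simp
  qed (use Suc.prems in \<open>auto intro: Ck_pd csupp_pd\<close>)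
  then obtain K where K: "K \<ge> 0" "\<And>i. symb k K (real k) (pd i g)"
    using ex_symb_uniform[of k "real k" "\<lambda>i. pd i g"] by blast
  let ?n = "real CARD('n)"
  have C1: "Ck (Suc 0) UNIV g" using Ck_le[OF Suc.prems(1)] by simp
  have "\<bar>g y\<bar> \<le> ?n * K * norm y powr real (Suc k)" if y: "y \<noteq> 0" for y
  proof -
    have "\<exists>t>0. t < 1 \<and> g (1 *\<^sub>R y) - g (0 *\<^sub>R y) = (1 - 0) * (\<Sum>i\<in>UNIV. pd i g (t *\<^sub>R y) * y $ i)"
    proof (rule MVT2)
      fix t :: real
      have "((\<lambda>t. g (t *\<^sub>R y)) has_derivative (\<lambda>s. \<Sum>i\<in>UNIV. pd i g (t *\<^sub>R y) * (s *\<^sub>R y) $ i)) (at t)"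
        by (rule has_derivative_compose[OF _ Ck_1_has_derivative[OF open_UNIV C1 UNIV_I]])
           (auto intro!: derivative_eq_intros)
      then show "((\<lambda>t. g (t *\<^sub>R y)) has_real_derivative (\<Sum>i\<in>UNIV. pd i g (t *\<^sub>R y) * y $ i)) (at t)"
        by (rule has_derivative_imp_has_field_derivative) (simp add: sum_distrib_left mult_ac)
    qed simp
    then obtain t where t: "0 < t" "t < 1" "g y - g 0 = (\<Sum>i\<in>UNIV. pd i g (t *\<^sub>R y) * y $ i)" by auto
    have "g 0 = 0" using Suc.prems(3)[of "[]"] by simp
    then have "\<bar>g y\<bar> \<le> (\<Sum>i\<in>UNIV. \<bar>pd i g (t *\<^sub>R y) * y $ i\<bar>)" using t(3) by simp
    also have "\<dots> \<le> (\<Sum>i\<in>(UNIV :: 'n set). K * norm y powr real k * norm y)"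
    proof (rule sum_mono)
      fix i
      have "\<bar>pd i g (t *\<^sub>R y)\<bar> \<le> K * norm (t *\<^sub>R y) powr real k" using t y by (intro symbD[OF K(2)]) simp
      also have "\<dots> \<le> K * norm y powr real k"
        using t K(1) by (intro mult_left_mono powr_mono2) (auto simp: mult_left_le_one_le)
      finally show "\<bar>pd i g (t *\<^sub>R y) * y $ i\<bar> \<le> K * norm y powr real k * norm y"
        unfolding abs_mult using K(1) component_le_norm_cart[of y i] by (intro mult_mono) auto
    qed
    also have "\<dots> = ?n * K * (norm y powr real k * norm y)" by simp
    also have "norm y powr real k * norm y = norm y powr real (Suc k)"
      using y powr_add[of "norm y" "real k" 1] by (simp add: add.commute)
    finally show ?thesis .
  qed
  moreover have n: "?n * K \<ge> K" using K(1) by (simp add: mult_le_cancel_right1 Suc_le_eq)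
  moreover have "symb k (?n * K) (real (Suc k) - 1) (pd i g)" for i using symb_mono[OF K(2) n] by simp
  ultimately show ?case using K(1) by (intro exI[of _ "?n * K"]) auto
qed

lemma Ck_inner_cutoff:
  fixes U :: "real^'n::finite \<Rightarrow> real"
  assumes "Ck k (- {0}) U" "0 < r" "r < R"
  shows "Ck k UNIV (\<lambda>y. (1 - cutoff k r R y) * U y)"
proof (rule Ck_local)
  fix x :: "real^'n"
  show "\<exists>T. open T \<and> x \<in> T \<and> Ck k T (\<lambda>y. (1 - cutoff k r R y) * U y)"
  proof (cases "x = 0")
    case True
    have "Ck k (ball 0 r) (\<lambda>y. (1 - cutoff k r R y) * U y)"
      by (rule Ck_cong[OF _ _ Ck_const[of k _ 0]]) (use assms in \<open>simp_all add: cutoff_eq_1\<close>)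
    then show ?thesis using True assms(2) by (intro exI[of _ "ball 0 r"]) auto
  next
    case False
    have "Ck k (- {0}) (\<lambda>y. (1 - cutoff k r R y) * U y)"
      by (intro Ck_mult Ck_diff Ck_const open_Compl_0 assms Ck_subset[OF Ck_cutoff]) auto
    then show ?thesis using False by (intro exI[of _ "- {0}"]) auto
  qed
qed

lemma polylap_inner_cutoff:
  assumes "0 < r" "r < R" "R < norm y"
  shows "polylap m (\<lambda>y. (1 - cutoff k r R y) * U y) y = polylap m U y"
  by (rule polylap_cong[OF open_norm_gt[of R]]) (use assms in \<open>simp_all add: cutoff_eq_0\<close>)

section \<open>Representation of a compactly supported function\<close>

lemma borel_measurable_continuous_off_0:
  fixes U :: "real^'n::finite \<Rightarrow> real"
  assumes "continuous_on (- {0}) U"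
  shows "U \<in> borel_measurable borel"
proof -
  have "(\<lambda>y. indicator (- {0}) y *\<^sub>R U y) \<in> borel_measurable borel"
    by (rule borel_measurable_continuous_on_indicator) (use assms in auto)
  moreover have "(\<lambda>y. indicator {0 :: real^'n} y *\<^sub>R U 0) \<in> borel_measurable borel"
    by (intro borel_measurable_scaleR borel_measurable_indicator borel_closed) auto
  ultimately have "(\<lambda>y. indicator (- {0}) y *\<^sub>R U y + indicator {0} y *\<^sub>R U 0) \<in> borel_measurable borel"
    by (rule borel_measurable_add)
  moreover have "(\<lambda>y. indicator (- {0}) y *\<^sub>R U y + indicator {0} y *\<^sub>R U 0) = U"
    by (auto simp: fun_eq_iff indicator_def)
  ultimately show ?thesis by simp
qed

lemma continuous_on_polylap:
  "open S \<Longrightarrow> Ck (2 * m) S U \<Longrightarrow> continuous_on S (polylap m U)"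
  using Ck_polylap[of S m 0 U] by simp

text \<open>\<open>G\<close> vanishes near 0, so \<open>U\<close> may be replaced by an inner
  truncation that is regular everywhere and differs from \<open>U\<close> only where
  \<open>G\<close> is 0.\<close>

lemma integral_polylap_away_from_0:
  fixes U :: "real^'n::finite \<Rightarrow> real"
  assumes U: "Ck (2 * m) (- {0}) U" "csupp U"
    and G: "Ck (2 * m) UNIV G" and r: "r > 0" "\<And>y. norm y < r \<Longrightarrow> G y = 0"
  shows "(\<integral>y. G y * polylap m U y \<partial>lborel) = (\<integral>y. polylap m G y * U y \<partial>lborel)"
proof -
  define V where "V y = (1 - cutoff (2 * m) (r / 4) (r / 2) y) * U y" for y
  have V: "Ck (2 * m) UNIV V" "csupp V"
    unfolding V_def[abs_def] using Ck_inner_cutoff[OF U(1), of "r/4" "r/2"] r(1) by (auto intro: csupp_mult_left U(2))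
  have 1: "G y * polylap m U y = G y * polylap m V y" for y
    using r polylap_inner_cutoff[of "r/4" "r/2" y m "2 * m" U] unfolding V_def[abs_def] by (cases "norm y < r") auto
  have 2: "polylap m G y * V y = polylap m G y * U y" for y
  proof (cases "norm y < r")
    case True
    have "polylap m G y = polylap m (\<lambda>_. 0) y"
      by (rule polylap_cong[of "ball 0 r"]) (use True r in auto)
    also have "\<dots> = 0" by (cases m) (auto simp: polylap_const)
    finally show ?thesis by simp
  next
    case False
    then show ?thesis using r(1) by (simp add: V_def cutoff_eq_0)
  qed
  show ?thesis unfolding 1 2[symmetric] by (rule integral_by_parts_polylap[OF G V])
qed

text \<open>The crossing of the singularity. Insert an inner cutoff at scale e next to
  \<open>\<Theta>\<close>; its derivatives blow up like |y|^(-j), but with a constant independent of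
  e, and the flatness of \<open>\<Theta>\<close> compensates for all 2m of them. The m-fold
  Laplacian of the product is then bounded uniformly in e, and the integrable \<open>U\<close>
  supplies the dominating function. The second claim puts the cutoff on \<open>U\<close>
  instead.\<close>

lemma weak_identity_across_0:
  fixes U \<Theta> :: "real^'n::finite \<Rightarrow> real"
  assumes U: "Ck (2 * m) (- {0}) U" "csupp U" "integrable lborel U"
    and T: "Ck (2 * m) UNIV \<Theta>" "csupp \<Theta>" "symb (2 * m) K (real (2 * m)) \<Theta>" "0 \<le> K"
    and F: "integrable lborel (\<lambda>y. \<Theta> y * polylap m U y)"
  shows "(\<integral>y. \<Theta> y * polylap m U y \<partial>lborel) = (\<integral>y. polylap m \<Theta> y * U y \<partial>lborel)"
    and "\<And>e. (\<And>k. 0 < e k) \<Longrightarrow> e \<longlonglongrightarrow> 0 \<Longrightarrow>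
      (\<lambda>k. \<integral>y. polylap m \<Theta> y * ((1 - cutoff (2 * m) (e k) (2 * e k) y) * U y) \<partial>lborel) \<longlonglongrightarrow> (\<integral>y. polylap m \<Theta> y * U y \<partial>lborel)"
proof -
  have AE: "AE y :: real^'n in lborel. y \<noteq> 0" by (rule AE_lborel_singleton)
  have Um [measurable]: "U \<in> borel_measurable borel"
    using U(1) by (intro borel_measurable_continuous_off_0 Ck_continuous_on)
  have Fm [measurable]: "polylap m U \<in> borel_measurable borel"
    using U(1) by (intro borel_measurable_continuous_off_0 continuous_on_polylap) auto
  have Tm [measurable]: "\<Theta> \<in> borel_measurable borel"
    using T(1) by (intro borel_measurable_continuous_onI Ck_continuous_on)
  have LTm [measurable]: "polylap m \<Theta> \<in> borel_measurable borel"
    using T(1) by (intro borel_measurable_continuous_onI continuous_on_polylap) auto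
  have T0: "Ck (2 * m) (- {0}) \<Theta>" by (rule Ck_subset[OF T(1)]) simp
  define n where "n = real CARD('n)"
  define W where "W e y = 1 - cutoff (2 * m) (e * 1) (e * 2) y" for e and y :: "real^'n"
  have CW: "Ck (2 * m) UNIV (W e)" for e unfolding W_def[abs_def] by (intro Ck_diff Ck_const Ck_cutoff open_UNIV)
  have CW0: "Ck (2 * m) (- {0}) (W e)" for e by (rule Ck_subset[OF CW]) simp
  have Wm [measurable]: "W e \<in> borel_measurable borel" for e
    by (intro borel_measurable_continuous_onI Ck_continuous_on[OF CW])
  have Wb: "\<bar>W e y\<bar> \<le> 1" for e y
    unfolding W_def using cutoff_nonneg[of "2*m" "e*1" "e*2" y] cutoff_le_1[of "2*m" "e*1" "e*2" y] by simp
  obtain L where L: "L \<ge> 0" "symb (2 * m) L 0 (\<lambda>y :: real^'n. 1 - cutoff (2 * m) 1 2 y)"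
    using ex_symb_inner_cutoff by blast
  have SW: "symb (2 * m) L 0 (W e)" if "e > 0" for e
  proof -
    have "symb (2 * m) (L * e powr (- 0)) 0 (\<lambda>y :: real^'n. 1 - cutoff (2 * m) 1 2 ((1 / e) *\<^sub>R y))"
      by (rule symb_scale[OF _ L(2) that]) (rule Ck_subset[OF _ subset_UNIV], intro Ck_diff Ck_const Ck_cutoff open_UNIV)
    then show ?thesis unfolding W_def[abs_def] cutoff_scale[OF that] using that by simp
  qed
  \<comment> \<open>Product rule and m Laplacians; that \<open>e\<close> does not occur here is the
    point.\<close>
  define C where "C = n ^ m * (2 ^ (2 * m) * (K * L))"
  have bnd: "\<bar>polylap m (\<lambda>y. \<Theta> y * W e y) y\<bar> \<le> C" if "e > 0" "y \<noteq> 0" for e y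
  proof -
    have "symb (2 * m + 0) (2 ^ (2 * m) * (K * L)) (real (2 * m) + 0) (\<lambda>y. \<Theta> y * W e y)"
      using symb_mult[OF T0 CW0 T(3) SW[OF that(1)] T(4) L(1)] by simp
    from symbD[OF symb_polylap[OF _ this] that(2)]
    show ?thesis using that(2) Ck_mult[OF open_Compl_0 T0 CW0] by (simp add: C_def n_def)
  qed
  have ev: "\<forall>\<^sub>F k in sequentially. 2 * e k < norm y" if "e \<longlonglongrightarrow> 0" "y \<noteq> 0" for e :: "nat \<Rightarrow> real" and y :: "real^'n"
    using order_tendstoD(2)[OF that(1), of "norm y / 2"] that(2) by (auto elim: eventually_mono)
  have W1: "W e y = 1" if "0 < e" "2 * e < norm y" for e y
    using that unfolding W_def by (simp add: cutoff_eq_0)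
  show lim: "(\<lambda>k. \<integral>y. polylap m \<Theta> y * ((1 - cutoff (2 * m) (e k) (2 * e k) y) * U y) \<partial>lborel) \<longlonglongrightarrow> (\<integral>y. polylap m \<Theta> y * U y \<partial>lborel)"
    if e: "\<And>k. 0 < e k" "e \<longlonglongrightarrow> 0" for e
  proof -
    obtain B where B: "B > 0" "\<And>y. \<bar>polylap m \<Theta> y\<bar> \<le> B"
      using bounded_continuous_csupp[OF continuous_on_polylap[OF open_UNIV T(1)] csupp_polylap[OF T(2)]] by blast
    have "(\<lambda>k. \<integral>y. polylap m \<Theta> y * (W (e k) y * U y) \<partial>lborel) \<longlonglongrightarrow> (\<integral>y. polylap m \<Theta> y * U y \<partial>lborel)"
    proof (rule integral_dominated_convergence[where w="\<lambda>y. B * \<bar>U y\<bar>"])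
      show "AE y in lborel. (\<lambda>k. polylap m \<Theta> y * (W (e k) y * U y)) \<longlonglongrightarrow> polylap m \<Theta> y * U y"
        using AE
      proof eventually_elim
        case (elim y)
        have "\<forall>\<^sub>F k in sequentially. polylap m \<Theta> y * (W (e k) y * U y) = polylap m \<Theta> y * U y"
          using ev[OF e(2) elim] by eventually_elim (simp add: W1 e(1))
        then show ?case by (rule tendsto_eventually)
      qed
      show "AE y in lborel. norm (polylap m \<Theta> y * (W (e k) y * U y)) \<le> B * \<bar>U y\<bar>" for k
      proof (rule AE_I2)
        fix y
        have "\<bar>W (e k) y\<bar> * \<bar>U y\<bar> \<le> \<bar>U y\<bar>" using Wb by (simp add: mult_left_le_one_le)
        then have "\<bar>polylap m \<Theta> y\<bar> * (\<bar>W (e k) y\<bar> * \<bar>U y\<bar>) \<le> B * \<bar>U y\<bar>" using B by (intro mult_mono) auto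
        then show "norm (polylap m \<Theta> y * (W (e k) y * U y)) \<le> B * \<bar>U y\<bar>" by (simp add: abs_mult)
      qed
    qed (use U(3) in auto)
    then show ?thesis unfolding W_def by (simp add: mult.commute)
  qed
  let ?e = "\<lambda>k::nat. 1 / real (Suc k)"
  have e: "\<And>k. 0 < ?e k" "?e \<longlonglongrightarrow> 0" using harmonic_seq by auto
  have eq: "(\<integral>y. \<Theta> y * W (?e k) y * polylap m U y \<partial>lborel) = (\<integral>y. polylap m (\<lambda>y. \<Theta> y * W (?e k) y) y * U y \<partial>lborel)" for k
  proof (rule integral_polylap_away_from_0[OF U(1,2)])
    show "Ck (2 * m) UNIV (\<lambda>y. \<Theta> y * W (?e k) y)" by (intro Ck_mult T CW open_UNIV)
    show "?e k > 0" by simp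
    show "\<Theta> y * W (?e k) y = 0" if "norm y < ?e k" for y
    proof -
      have "?e k * 1 < ?e k * 2" by (simp add: divide_strict_right_mono)
      then have "cutoff (2 * m) (?e k * 1) (?e k * 2) y = 1"
        using that by (intro cutoff_eq_1) auto
      then show ?thesis unfolding W_def by simp
    qed
  qed
  have "(\<lambda>k. \<integral>y. \<Theta> y * W (?e k) y * polylap m U y \<partial>lborel) \<longlonglongrightarrow> (\<integral>y. \<Theta> y * polylap m U y \<partial>lborel)"
  proof (rule integral_dominated_convergence[where w="\<lambda>y. \<bar>\<Theta> y * polylap m U y\<bar>"])
    show "AE y in lborel. (\<lambda>k. \<Theta> y * W (?e k) y * polylap m U y) \<longlonglongrightarrow> \<Theta> y * polylap m U y"
      using AE
    proof eventually_elim
      case (elim y)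
      have "\<forall>\<^sub>F k in sequentially. \<Theta> y * W (?e k) y * polylap m U y = \<Theta> y * polylap m U y"
        using ev[OF e(2) elim] by eventually_elim (simp add: W1 e(1))
      then show ?case by (rule tendsto_eventually)
    qed
    show "AE y in lborel. norm (\<Theta> y * W (?e k) y * polylap m U y) \<le> \<bar>\<Theta> y * polylap m U y\<bar>" for k
    proof (rule AE_I2)
      fix y
      have "\<bar>W (?e k) y\<bar> * (\<bar>\<Theta> y\<bar> * \<bar>polylap m U y\<bar>) \<le> \<bar>\<Theta> y\<bar> * \<bar>polylap m U y\<bar>"
        using Wb by (intro mult_left_le_one_le) auto
      then show "norm (\<Theta> y * W (?e k) y * polylap m U y) \<le> \<bar>\<Theta> y * polylap m U y\<bar>" by (simp add: abs_mult mult_ac)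
    qed
  qed (use F in auto)
  moreover have "(\<lambda>k. \<integral>y. polylap m (\<lambda>y. \<Theta> y * W (?e k) y) y * U y \<partial>lborel) \<longlonglongrightarrow> (\<integral>y. polylap m \<Theta> y * U y \<partial>lborel)"
  proof (rule integral_dominated_convergence[where w="\<lambda>y. C * \<bar>U y\<bar>"])
    show "AE y in lborel. (\<lambda>k. polylap m (\<lambda>y. \<Theta> y * W (?e k) y) y * U y) \<longlonglongrightarrow> polylap m \<Theta> y * U y"
      using AE
    proof eventually_elim
      case (elim y)
      have "\<forall>\<^sub>F k in sequentially. polylap m (\<lambda>y. \<Theta> y * W (?e k) y) y * U y = polylap m \<Theta> y * U y"
        using ev[OF e(2) elim]
      proof eventually_elim
        case (elim k)
        have "polylap m (\<lambda>y. \<Theta> y * W (?e k) y) y = polylap m \<Theta> y"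
          by (rule polylap_cong[OF open_norm_gt[of "2 * ?e k"]]) (use elim W1[of "?e k"] in auto)
        then show ?case by simp
      qed
      then show ?case by (rule tendsto_eventually)
    qed
    show "AE y in lborel. norm (polylap m (\<lambda>y. \<Theta> y * W (?e k) y) y * U y) \<le> C * \<bar>U y\<bar>" for k
      using AE
    proof eventually_elim
      case (elim y)
      then show ?case using bnd[of "?e k" y] by (simp add: abs_mult mult_right_mono)
    qed
    show "(\<lambda>y. polylap m (\<lambda>y. \<Theta> y * W (?e k) y) y * U y) \<in> borel_measurable lborel" for k
    proof -
      have "polylap m (\<lambda>y. \<Theta> y * W (?e k) y) \<in> borel_measurable borel"
        by (intro borel_measurable_continuous_onI continuous_on_polylap Ck_mult T CW open_UNIV)
      then show ?thesis by simp
    qed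
  qed (use U(3) in auto)
  ultimately show "(\<integral>y. \<Theta> y * polylap m U y \<partial>lborel) = (\<integral>y. polylap m \<Theta> y * U y \<partial>lborel)"
    unfolding eq by (rule LIMSEQ_unique)
qed

section \<open>The Taylor polynomial of the kernel and the representation formula\<close>

definition taylor_phi :: "nat \<Rightarrow> real^'n::finite \<Rightarrow> real^'n \<Rightarrow> real" where
  "taylor_phi m x y = (\<Sum>\<beta>\<in>{\<beta>::'n\<Rightarrow>nat. mabs \<beta> < 2 * m}. mpow (- y) \<beta> / mfact \<beta> * Dm \<beta> (phi m) x)"

lemma mfact_nz: "mfact \<beta> \<noteq> 0"
  unfolding mfact_def by simp

lemma Ck_mpow_uminus: "Ck k UNIV (\<lambda>y. mpow (- y) \<beta>)"
  using Ck_affine[where a=0 and c="-1", OF open_UNIV Ck_mpow[OF open_UNIV, of k \<beta>]] by simp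

lemma polylap_mpow_uminus:
  assumes "mabs \<beta> < 2 * m"
  shows "polylap m (\<lambda>y. mpow (- y) \<beta>) y = 0"
  using polylap_affine[OF open_UNIV Ck_mpow[OF open_UNIV], of 0 "-1" y m \<beta>] polylap_mpow[OF assms] by simp

lemma taylor_phi_alt: "taylor_phi m x y = (\<Sum>\<beta>\<in>{\<beta>. mabs \<beta> < 2 * m}. (Dm \<beta> (phi m) x / mfact \<beta>) * mpow (- y) \<beta>)"
  unfolding taylor_phi_def by (intro sum.cong refl) simp

lemma Ck_taylor_phi: "Ck k UNIV (taylor_phi m x)"
  unfolding taylor_phi_alt[abs_def] by (intro Ck_sum Ck_cmult Ck_mpow_uminus open_UNIV)

lemma polylap_taylor_phi: "polylap m (taylor_phi m x) y = 0"
proof -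
  have "polylap m (taylor_phi m x) y = (\<Sum>\<beta>\<in>{\<beta>. mabs \<beta> < 2 * m}. polylap m (\<lambda>y. (Dm \<beta> (phi m) x / mfact \<beta>) * mpow (- y) \<beta>) y)"
    unfolding taylor_phi_alt[abs_def]
    by (rule polylap_sum[OF open_UNIV Ck_cmult[OF open_UNIV Ck_mpow_uminus] UNIV_I])
  also have "\<dots> = (\<Sum>\<beta>\<in>{\<beta>. mabs \<beta> < 2 * m}. (Dm \<beta> (phi m) x / mfact \<beta>) * polylap m (\<lambda>y. mpow (- y) \<beta>) y)"
    by (intro sum.cong refl polylap_cmult[OF open_UNIV] Ck_mpow_uminus UNIV_I)
  also have "\<dots> = 0" by (intro sum.neutral) (simp add: polylap_mpow_uminus)
  finally show ?thesis .
qed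

lemma foldr_pd_affine:
  assumes "open S" "\<And>k. Ck k S g" "x + c *\<^sub>R y \<in> S"
  shows "foldr pd w (\<lambda>y. g (x + c *\<^sub>R y)) y = c ^ length w * foldr pd w g (x + c *\<^sub>R y)"
  using assms(3)
proof (induction w arbitrary: y)
  case (Cons i w)
  let ?T = "{y. x + c *\<^sub>R y \<in> S}"
  have op: "open ?T"
    using open_vimage[OF assms(1), of "\<lambda>y. x + c *\<^sub>R y"] by (simp add: vimage_def continuous_intros)
  have C: "Ck (Suc 0) S (foldr pd w g)" by (intro Ck_foldr_pd assms)
  have "pd i (foldr pd w (\<lambda>y. g (x + c *\<^sub>R y))) y = pd i (\<lambda>y. c ^ length w * foldr pd w g (x + c *\<^sub>R y)) y"
    by (rule pd_cong[OF op]) (use Cons in auto)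
  also have "\<dots> = c ^ length w * pd i (\<lambda>y. foldr pd w g (x + c *\<^sub>R y)) y"
    by (rule pd_cmult[OF Ck_affine[OF assms(1) C]]) (use Cons in auto)
  also have "pd i (\<lambda>y. foldr pd w g (x + c *\<^sub>R y)) y = c * pd i (foldr pd w g) (x + c *\<^sub>R y)"
    by (rule pd_affine[OF C Cons.prems])
  finally show ?case by simp
qed simp

lemma foldr_pd_add:
  assumes "open S" "\<And>k. Ck k S g" "\<And>k. Ck k S h" "y \<in> S"
  shows "foldr pd w (\<lambda>y. g y + h y) y = foldr pd w g y + foldr pd w h y"
  using assms(4)
proof (induction w arbitrary: y)
  case (Cons i w)
  have "pd i (foldr pd w (\<lambda>y. g y + h y)) y = pd i (\<lambda>y. foldr pd w g y + foldr pd w h y) y"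
    by (rule pd_cong[OF assms(1)]) (use Cons in auto)
  also have "\<dots> = pd i (foldr pd w g) y + pd i (foldr pd w h) y"
    by (rule pd_add[of 0 S]) (use Cons assms in \<open>auto intro!: Ck_foldr_pd\<close>)
  finally show ?case by simp
qed simp

lemma foldr_pd_0: "foldr pd w (\<lambda>_. 0) = (\<lambda>_ :: real^'n::finite. 0)"
  by (induction w) auto

lemma foldr_pd_sum:
  assumes "finite A" "\<And>a k. a \<in> A \<Longrightarrow> Ck k UNIV (g a)"
  shows "foldr pd w (\<lambda>y. \<Sum>a\<in>A. g a y) y = (\<Sum>a\<in>A. foldr pd w (g a) y)"
  using assms
  by (induction A) (auto simp: foldr_pd_0 foldr_pd_add[OF open_UNIV] Ck_sum)

text \<open>Both parts produce the sign (-1)^|w|: one from the reflection y to x - y, the other from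
  the monomials in -y.\<close>

lemma foldr_pd_taylor_phi_at_0:
  fixes x :: "real^'n::finite"
  assumes x: "x \<noteq> 0" and w: "length w < 2 * m"
  shows "foldr pd w (\<lambda>y. phi m (x - y) - taylor_phi m x y) 0 = 0"
proof -
  let ?S = "{y. x + (- 1) *\<^sub>R y \<in> - {0}}"
  have eqS: "?S = - {x}" by (auto simp: algebra_simps)
  have CS: "Ck k ?S (\<lambda>y. phi m (x + (- 1) *\<^sub>R y))" for k
    by (rule Ck_affine[OF open_Compl_0]) (rule Cinf_Ck[OF Cinf_phi])
  have opS: "open ?S" unfolding eqS by (simp add: open_Compl)
  have CT: "Ck k ?S (\<lambda>y. - 1 * taylor_phi m x y)" for k
    by (intro Ck_cmult opS Ck_subset[OF Ck_taylor_phi]) simp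
  have xS: "0 \<in> ?S" using x by simp
  have "foldr pd w (\<lambda>y. phi m (x + (- 1) *\<^sub>R y) + - 1 * taylor_phi m x y) 0
     = foldr pd w (\<lambda>y. phi m (x + (- 1) *\<^sub>R y)) 0 + foldr pd w (\<lambda>y. - 1 * taylor_phi m x y) 0"
    by (rule foldr_pd_add[OF opS CS CT xS])
  moreover have "foldr pd w (\<lambda>y. phi m (x + (- 1) *\<^sub>R y)) 0 = (- 1) ^ length w * foldr pd w (phi m) (x + (- 1) *\<^sub>R 0)"
    by (rule foldr_pd_affine[OF open_Compl_0 Cinf_Ck[OF Cinf_phi]]) (use x in simp)
  moreover have "foldr pd w (phi m) x = Dm (count (mset w)) (phi m) x"
    by (rule foldr_pd_eq_Dm[OF open_Compl_0 Cinf_phi]) (use x in simp)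
  moreover have "foldr pd w (\<lambda>y. - 1 * taylor_phi m x y) 0 = - 1 * foldr pd w (taylor_phi m x) 0"
    by (subst foldr_pd_cmult) (auto simp: Ck_taylor_phi)
  moreover have "foldr pd w (taylor_phi m x) 0 = (- 1) ^ length w * Dm (count (mset w)) (phi m) x"
  proof -
    have mon: "foldr pd w (\<lambda>y. mpow (- y) \<beta>) 0 = (- 1) ^ length w * (if count (mset w) = \<beta> then mfact \<beta> else 0)" for \<beta> :: "'n \<Rightarrow> nat"
      using foldr_pd_affine[OF open_UNIV Ck_mpow[OF open_UNIV], of 0 "-1" 0 w \<beta>] foldr_pd_mpow_at_0[of w \<beta>] by simp
    have "foldr pd w (taylor_phi m x) 0 = (\<Sum>\<beta>\<in>{\<beta>. mabs \<beta> < 2 * m}. foldr pd w (\<lambda>y. (Dm \<beta> (phi m) x / mfact \<beta>) * mpow (- y) \<beta>) 0)"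
      unfolding taylor_phi_alt[abs_def] by (intro foldr_pd_sum finite_mabs_less Ck_cmult Ck_mpow_uminus open_UNIV)
    also have "\<dots> = (\<Sum>\<beta>\<in>{\<beta>. mabs \<beta> < 2 * m}. (Dm \<beta> (phi m) x / mfact \<beta>) * foldr pd w (\<lambda>y. mpow (- y) \<beta>) 0)"
      by (intro sum.cong refl) (subst foldr_pd_cmult, auto intro: Ck_mpow_uminus)
    also have "\<dots> = (\<Sum>\<beta>\<in>{\<beta>. mabs \<beta> < 2 * m}. if count (mset w) = \<beta> then (- 1) ^ length w * Dm \<beta> (phi m) x else 0)"
      by (intro sum.cong refl) (simp add: mon mfact_nz)
    also have "\<dots> = (- 1) ^ length w * Dm (count (mset w)) (phi m) x"
      using w by (subst sum.delta') (auto simp: finite_mabs_less mabs_count)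
    finally show ?thesis .
  qed
  ultimately show ?thesis by simp
qed

text \<open>A cutoff \<open>\<eta>\<close> splits the kernel. The part \<open>\<Theta>\<close> near
  0 is flat to order 2m and regular, since \<open>\<eta>\<close> vanishes near \<open>x\<close>. The
  other part contains the pole at \<open>x\<close> but lives off the origin, where the inner
  truncation of \<open>U\<close> is not felt. Only the first part needs a limit.\<close>

theorem representation_formula:
  fixes U :: "real^'n::finite \<Rightarrow> real"
  assumes m: "m \<ge> 1" "CARD('n) \<ge> 2 * m"
    and U: "Ck (2 * m) (- {0}) U" "csupp U" "integrable lborel U"
    and F: "integrable lborel (\<lambda>y. norm y powr real (2 * m) * polylap m U y)"
    and x: "x \<noteq> 0"
  shows "integrable lborel (\<lambda>y. (phi m (x - y) - taylor_phi m x y) * polylap m U y)"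
    and "(\<integral>y. (phi m (x - y) - taylor_phi m x y) * polylap m U y \<partial>lborel) = U x"
proof -
  have AE: "AE y :: real^'n in lborel. y \<noteq> 0" by (rule AE_lborel_singleton)
  have Fm [measurable]: "polylap m U \<in> borel_measurable borel"
    using U(1) by (intro borel_measurable_continuous_off_0 continuous_on_polylap) auto
  define \<Psi> where "\<Psi> y = phi m (x - y) - taylor_phi m x y" for y
  have Tm [measurable]: "taylor_phi m x \<in> borel_measurable borel"
    by (intro borel_measurable_continuous_onI Ck_continuous_on[OF Ck_taylor_phi[of 0]])
  have Pm [measurable]: "\<Psi> \<in> borel_measurable borel" unfolding \<Psi>_def[abs_def] by measurable
  \<comment> \<open>\<open>\<eta>\<close> is 0 from radius \<open>2 * d\<close> on, which is half of
    |x|, so the pole is cut away from \<open>\<Theta>\<close>.\<close>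
  define d where "d = norm x / 4"
  have d: "d > 0" using x by (simp add: d_def)
  define \<eta> :: "real^'n \<Rightarrow> real" where "\<eta> = cutoff (2 * m) d (2 * d)"
  have \<eta>1: "\<eta> y = 1" if "norm y \<le> d" for y using that d by (simp add: \<eta>_def cutoff_eq_1)
  have \<eta>0: "\<eta> y = 0" if "2 * d \<le> norm y" for y using that d by (simp add: \<eta>_def cutoff_eq_0)
  have C\<eta>: "Ck (2 * m) UNIV \<eta>" unfolding \<eta>_def by (rule Ck_cutoff)
  have \<eta>m [measurable]: "\<eta> \<in> borel_measurable borel" by (intro borel_measurable_continuous_onI Ck_continuous_on[OF C\<eta>])
  define \<Theta> where "\<Theta> y = \<eta> y * \<Psi> y" for y
  have CP: "Ck k (- {x}) \<Psi>" for k
  proof -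
    have "Ck k {y. x + (- 1) *\<^sub>R y \<in> - {0}} (\<lambda>y. phi m (x + (- 1) *\<^sub>R y))"
      by (rule Ck_affine[OF open_Compl_0]) (rule Cinf_Ck[OF Cinf_phi])
    moreover have "{y. x + (- 1) *\<^sub>R y \<in> - {0}} = - {x}" by (auto simp: algebra_simps)
    ultimately have "Ck k (- {x}) (\<lambda>y. phi m (x - y))" by simp
    then show ?thesis unfolding \<Psi>_def[abs_def]
      by (intro Ck_diff Ck_subset[OF Ck_taylor_phi] open_Compl) auto
  qed
  have CT: "Ck (2 * m) UNIV \<Theta>"
  proof (rule Ck_local)
    fix z
    show "\<exists>T. open T \<and> z \<in> T \<and> Ck (2 * m) T \<Theta>"
    proof (cases "z = x")
      case True
      have "Ck (2 * m) {y. 2 * d < norm y} \<Theta>"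
        by (rule Ck_cong[OF open_norm_gt _ Ck_const[of _ _ 0]]) (simp add: \<Theta>_def \<eta>0)
      moreover have "2 * d < norm x" using d by (simp add: d_def)
      ultimately show ?thesis using True open_norm_gt by blast
    next
      case False
      have op: "open (- {x})" by (simp add: open_Compl)
      have "Ck (2 * m) (- {x}) \<Theta>" unfolding \<Theta>_def[abs_def]
        by (intro Ck_mult CP Ck_subset[OF C\<eta>] op) auto
      then show ?thesis using False op by blast
    qed
  qed
  have sT: "csupp \<Theta>" unfolding \<Theta>_def[abs_def] \<eta>_def by (intro csupp_mult_right csupp_cutoff) (use d in auto)
  have "foldr pd w \<Theta> 0 = 0" if "length w < 2 * m" for w
  proof -
    have "foldr pd w \<Theta> 0 = foldr pd w \<Psi> 0"
      by (rule foldr_pd_cong[of "ball 0 d"]) (use d in \<open>auto simp: \<Theta>_def \<eta>1 less_imp_le\<close>)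
    then show ?thesis using foldr_pd_taylor_phi_at_0[OF x that] by (simp add: \<Psi>_def[abs_def])
  qed
  then obtain K where K: "K \<ge> 0" "symb (2 * m) K (real (2 * m)) \<Theta>"
    using ex_symb_flat[OF CT sT] by blast
  have \<Theta>m [measurable]: "\<Theta> \<in> borel_measurable borel" by (intro borel_measurable_continuous_onI Ck_continuous_on[OF CT])
  have iT: "integrable lborel (\<lambda>y. \<Theta> y * polylap m U y)"
  proof (rule Bochner_Integration.integrable_bound[OF integrable_mult_right[OF F, of K]])
    show "AE y in lborel. norm (\<Theta> y * polylap m U y) \<le> norm (K * (norm y powr real (2 * m) * polylap m U y))"
      using AE
    proof eventually_elim
      case (elim y)
      have "\<bar>\<Theta> y\<bar> * \<bar>polylap m U y\<bar> \<le> (K * norm y powr real (2 * m)) * \<bar>polylap m U y\<bar>"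
        by (intro mult_right_mono symbD[OF K(2) elim]) auto
      then show ?case using K(1) by (simp add: abs_mult mult.assoc)
    qed
  qed simp
  note weak = weak_identity_across_0[OF U CT sT K(2,1) iT]
  define V where "V e y = (1 - cutoff (2 * m) e (2 * e) y) * U y" for e y
  have CV: "Ck (2 * m) UNIV (V e)" and sV: "csupp (V e)" if "e > 0" for e
    unfolding V_def[abs_def] using Ck_inner_cutoff[OF U(1), of e "2 * e"] that by (auto intro: csupp_mult_left U(2))
  have LV: "continuous_on UNIV (polylap m (V e))" "csupp (polylap m (V e))" if "e > 0" for e
    by (intro continuous_on_polylap open_UNIV CV that) (intro csupp_polylap sV that)
  have far: "(1 - \<eta> y) * \<Psi> y * polylap m (V e) y = (1 - \<eta> y) * \<Psi> y * polylap m U y" if e: "e > 0" "2 * e < d" for e y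
  proof (cases "norm y \<le> d")
    case False
    then show ?thesis using polylap_inner_cutoff[of e "2 * e" y m "2 * m" U] e unfolding V_def[abs_def] by simp
  qed (simp add: \<eta>1)
  \<comment> \<open>For every small \<open>e\<close> the identity holds with the far term already
    written with \<open>U\<close>; \<open>e\<close> survives only in the term with
    \<open>\<Theta>\<close>.\<close>
  have main: "integrable lborel (\<lambda>y. (1 - \<eta> y) * \<Psi> y * polylap m U y) \<and>
      U x = (\<integral>y. polylap m \<Theta> y * V e y \<partial>lborel) + (\<integral>y. (1 - \<eta> y) * \<Psi> y * polylap m U y \<partial>lborel)"
    if e: "e > 0" "2 * e < d" for e
  proof -
    have i1: "integrable lborel (\<lambda>y. phi m (x - y) * polylap m (V e) y)"
    proof -
      obtain B where B: "\<And>y. \<bar>polylap m (V e) y\<bar> \<le> B" using bounded_continuous_csupp[OF LV[OF e(1)]] by blast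
      obtain R where R: "\<And>y. R \<le> norm y \<Longrightarrow> polylap m (V e) y = 0" using LV(2)[OF e(1)] by (auto simp: csupp_def)
      show ?thesis by (rule integrable_phi_times[OF m borel_measurable_continuous_onI[OF LV(1)[OF e(1)]] B R])
    qed
    have i2: "integrable lborel (\<lambda>y. taylor_phi m x y * polylap m (V e) y)"
      by (intro integrable_continuous_csupp continuous_on_mult csupp_mult_left LV e Ck_continuous_on[OF Ck_taylor_phi[of 0]])
    have i3: "integrable lborel (\<lambda>y. \<Theta> y * polylap m (V e) y)"
      by (intro integrable_continuous_csupp continuous_on_mult csupp_mult_left LV e Ck_continuous_on[OF CT])
    have i12: "integrable lborel (\<lambda>y. \<Psi> y * polylap m (V e) y)"
      using Bochner_Integration.integrable_diff[OF i1 i2] by (simp add: \<Psi>_def left_diff_distrib)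
    have i4: "integrable lborel (\<lambda>y. (1 - \<eta> y) * \<Psi> y * polylap m (V e) y)"
      using Bochner_Integration.integrable_diff[OF i12 i3] by (simp add: \<Theta>_def algebra_simps)
    have "(\<integral>y. taylor_phi m x y * polylap m (V e) y \<partial>lborel) = 0"
      using integral_by_parts_polylap[OF Ck_taylor_phi[of "2 * m" m x] CV[OF e(1)] sV[OF e(1)]] by (simp add: polylap_taylor_phi)
    moreover have "(\<integral>y. phi m (x - y) * polylap m (V e) y \<partial>lborel) = V e x"
      by (rule fundamental_solution[OF m CV[OF e(1)] sV[OF e(1)]])
    moreover have "V e x = U x" unfolding V_def using e d by (simp add: cutoff_eq_0 d_def)
    ultimately have "U x = (\<integral>y. \<Psi> y * polylap m (V e) y \<partial>lborel)"
      using i1 i2 by (simp add: \<Psi>_def left_diff_distrib)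
    also have "\<dots> = (\<integral>y. \<Theta> y * polylap m (V e) y + (1 - \<eta> y) * \<Psi> y * polylap m (V e) y \<partial>lborel)"
      by (intro Bochner_Integration.integral_cong) (auto simp: \<Theta>_def algebra_simps)
    also have "\<dots> = (\<integral>y. \<Theta> y * polylap m (V e) y \<partial>lborel) + (\<integral>y. (1 - \<eta> y) * \<Psi> y * polylap m (V e) y \<partial>lborel)"
      by (rule Bochner_Integration.integral_add[OF i3 i4])
    also have "(\<integral>y. \<Theta> y * polylap m (V e) y \<partial>lborel) = (\<integral>y. polylap m \<Theta> y * V e y \<partial>lborel)"
      by (rule integral_by_parts_polylap[OF CT CV[OF e(1)] sV[OF e(1)]])
    finally show ?thesis using i4 unfolding far[OF e] by simp
  qed
  \<comment> \<open>The factor d/4 secures \<open>2 * e k < d\<close> for every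
    \<open>k\<close>.\<close>
  define e where "e k = d / 4 * (1 / real (Suc k))" for k
  have e: "\<And>k. 0 < e k" "e \<longlonglongrightarrow> 0"
    using d tendsto_mult_right_zero[OF harmonic_seq(3), of "d / 4"] by (auto simp: e_def[abs_def])
  have e2: "2 * e k < d" for k
  proof -
    have "d / 4 * (1 / real (Suc k)) \<le> d / 4 * 1" using d by (intro mult_left_mono) auto
    then show ?thesis using d unfolding e_def by linarith
  qed
  have i5: "integrable lborel (\<lambda>y. (1 - \<eta> y) * \<Psi> y * polylap m U y)" using main[OF e(1) e2] by blast
  have "(\<lambda>k. (\<integral>y. polylap m \<Theta> y * V (e k) y \<partial>lborel) + (\<integral>y. (1 - \<eta> y) * \<Psi> y * polylap m U y \<partial>lborel))
    \<longlonglongrightarrow> (\<integral>y. polylap m \<Theta> y * U y \<partial>lborel) + (\<integral>y. (1 - \<eta> y) * \<Psi> y * polylap m U y \<partial>lborel)"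
    unfolding V_def by (intro tendsto_add tendsto_const weak(2) e)
  then have "U x = (\<integral>y. polylap m \<Theta> y * U y \<partial>lborel) + (\<integral>y. (1 - \<eta> y) * \<Psi> y * polylap m U y \<partial>lborel)"
    using main[OF e(1) e2] by (simp add: LIMSEQ_const_iff)
  also have "\<dots> = (\<integral>y. \<Theta> y * polylap m U y + (1 - \<eta> y) * \<Psi> y * polylap m U y \<partial>lborel)"
    using weak(1) iT i5 by simp
  also have "\<dots> = (\<integral>y. \<Psi> y * polylap m U y \<partial>lborel)"
    by (intro Bochner_Integration.integral_cong) (auto simp: \<Theta>_def algebra_simps)
  finally show "(\<integral>y. (phi m (x - y) - taylor_phi m x y) * polylap m U y \<partial>lborel) = U x" by (simp add: \<Psi>_def)
  have "integrable lborel (\<lambda>y. \<Theta> y * polylap m U y + (1 - \<eta> y) * \<Psi> y * polylap m U y)"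
    by (intro Bochner_Integration.integrable_add iT i5)
  moreover have "(\<lambda>y. \<Theta> y * polylap m U y + (1 - \<eta> y) * \<Psi> y * polylap m U y) = (\<lambda>y. \<Psi> y * polylap m U y)"
    by (auto simp: \<Theta>_def algebra_simps)
  ultimately show "integrable lborel (\<lambda>y. (phi m (x - y) - taylor_phi m x y) * polylap m U y)"
    by (simp add: \<Psi>_def)
qed

section \<open>Integrability near the origin\<close>

text \<open>Includes t < c, where the interval is empty and the integral 0.\<close>

lemma integral_ivl_bounds:
  fixes f :: "real \<Rightarrow> real"
  assumes "continuous_on {c..t} f" "\<And>x. x \<in> {c..t} \<Longrightarrow> 0 \<le> f x" "\<And>x. x \<in> {c..t} \<Longrightarrow> f x \<le> B" "0 \<le> c" "0 \<le> B" "0 \<le> t"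
  shows "0 \<le> integral {c..t} f" "integral {c..t} f \<le> t * B"
proof -
  have i: "f integrable_on {c..t}" using assms(1) by (rule integrable_continuous_real)
  show "0 \<le> integral {c..t} f" by (rule integral_nonneg[OF i]) (use assms in auto)
  have "integral {c..t} f \<le> integral {c..t} (\<lambda>_. B)"
    by (rule integral_le[OF i]) (use assms in auto)
  also have "\<dots> \<le> t * B" using assms by (cases "c \<le> t") (auto intro: mult_right_mono)
  finally show "integral {c..t} f \<le> t * B" .
qed

lemma DERIV_integral_upper:
  fixes f :: "real \<Rightarrow> real"
  assumes "continuous_on {c..} f" "c < t"
  shows "((\<lambda>t. integral {c..t} f) has_real_derivative f t) (at t)"
proof -
  have "((\<lambda>t. integral {c..t} f) has_real_derivative f t) (at t within {c..t + 1})"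
    by (rule integral_has_real_derivative) (use assms in \<open>auto intro: continuous_on_subset\<close>)
  moreover have "at t within {c..t + 1} = at t"
    using assms(2) by (intro at_within_interior) auto
  ultimately show ?thesis by simp
qed

text \<open>In the variable \<open>t = (norm y)\<^sup>2\<close> the Laplacian of a radial function \<open>g\<close> is \<open>4 t g'' + 2 n g'\<close>, and
  \<open>t powr (n / 2) * g'\<close> has derivative \<open>t powr (n / 2 - 1) * h / 4\<close> when this equals \<open>h\<close>.\<close>

lemma radial_poisson:
  fixes h :: "real \<Rightarrow> real"
  assumes n: "n \<ge> 2" and d: "d > 0" and h: "continuous_on UNIV h" "\<And>t. t \<le> d \<Longrightarrow> h t = 0"
    "\<And>t. 0 \<le> t \<Longrightarrow> 0 \<le> h t" "\<And>t. 0 \<le> t \<Longrightarrow> h t \<le> t ^ j"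
  shows "\<exists>g p q. (\<forall>t > d / 2. (g has_real_derivative p t) (at t) \<and> (p has_real_derivative q t) (at t)
      \<and> 4 * t * q t + 2 * n * p t = h t) \<and> continuous_on {d / 2<..} q \<and> (\<forall>t\<le>d. g t = 0)
      \<and> continuous_on UNIV g \<and> (\<forall>t\<ge>0. 0 \<le> g t \<and> g t \<le> t ^ Suc j)"
proof -
  \<comment> \<open>Integration starts strictly inside the region where \<open>h\<close> is 0, so
    near t = d the solutions are differentiable from both sides and vanish for t <= d.\<close>
  define c where "c = d / 2"
  have c: "0 < c" "c < d" using d by (auto simp: c_def)
  define f where "f x = x powr (n / 2 - 1) * h x / 4" for x
  have cf: "continuous_on {c..} f"
    unfolding f_def using c by (intro continuous_intros continuous_on_subset[OF h(1)]) auto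
  define I where "I t = integral {c..t} f" for t
  have DI: "(I has_real_derivative f t) (at t)" if "c < t" for t
    unfolding I_def using DERIV_integral_upper[OF cf that] .
  define p where "p t = t powr (- (n / 2)) * I t" for t
  define q where "q t = (- (n / 2)) * t powr (- (n / 2) - 1) * I t + t powr (- (n / 2)) * f t" for t
  have Dp: "(p has_real_derivative q t) (at t)" if "c < t" for t
  proof -
    have "0 < t" using that c by simp
    from DERIV_mult[OF has_real_derivative_powr[OF this, of "- (n / 2)"] DI[OF that]]
    show ?thesis unfolding p_def[abs_def] q_def by (rule DERIV_cong) simp
  qed
  have I_cont: "continuous_on {c..} I"
    unfolding I_def[abs_def] continuous_on_eq_continuous_within
  proof
    fix t assume t: "t \<in> {c..}"
    have "continuous_on {c..t + 1} (\<lambda>t. integral {c..t} f)"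
      by (intro indefinite_integral_continuous_1 integrable_continuous_real continuous_on_subset[OF cf]) auto
    then have "continuous (at t within {c..t + 1}) (\<lambda>t. integral {c..t} f)"
      using t by (simp add: continuous_on_eq_continuous_within)
    moreover have "at t within {c..t + 1} = at t within {c..}"
      by (rule at_within_nhd[of t "{..<t + 1}"]) auto
    ultimately show "continuous (at t within {c..}) (\<lambda>t. integral {c..t} f)" by simp
  qed
  have cp: "continuous_on {c..} p"
    unfolding p_def using c by (intro continuous_intros I_cont) auto
  define g where "g t = integral {c..t} p" for t
  have Dg: "(g has_real_derivative p t) (at t)" if "c < t" for t
    unfolding g_def using DERIV_integral_upper[OF cp that] .
  have eq: "4 * t * q t + 2 * n * p t = h t" if "c < t" for t
  proof -
    have t: "0 < t" using that c by simp
    have "t * t powr (- (n / 2) - 1) = t powr (- (n / 2))"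
      using t powr_add[of t 1 "- (n / 2) - 1"] by simp
    moreover have "t * t powr (- (n / 2)) * t powr (n / 2 - 1) = 1"
      using t powr_add[of t "1 - n / 2" "n / 2 - 1"] powr_add[of t 1 "- (n / 2)"] by simp
    moreover have "4 * t * q t = - 2 * n * (t * t powr (- (n / 2) - 1)) * I t + (t * t powr (- (n / 2)) * t powr (n / 2 - 1)) * h t"
      unfolding q_def f_def by (simp add: algebra_simps)
    ultimately show ?thesis by (simp add: p_def)
  qed
  have z: "f x = 0" if "x \<le> d" for x using h(2)[OF that] by (simp add: f_def)
  have I0: "I t = 0" if "t \<le> d" for t
  proof -
    have "I t = integral {c..t} (\<lambda>_. 0)" unfolding I_def by (rule integral_cong) (use that z in auto)
    then show ?thesis by simp
  qed
  have g0: "g t = 0" if "t \<le> d" for t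
  proof -
    have "g t = integral {c..t} (\<lambda>_. 0)" unfolding g_def by (rule integral_cong) (use that I0 p_def in auto)
    then show ?thesis by simp
  qed
  have Ib: "0 \<le> I t" "I t \<le> t * (t powr (n / 2 - 1) * t ^ j / 4)" if t: "0 \<le> t" for t
  proof -
    have u: "f x \<le> t powr (n / 2 - 1) * t ^ j / 4" if "x \<in> {c..t}" for x
    proof -
      have "0 \<le> x" "x \<le> t" using that c by auto
      moreover from this have "h x \<le> t ^ j" using h(4)[of x] power_mono[of x t j] by linarith
      ultimately show ?thesis unfolding f_def using n h(3)[of x]
        by (intro divide_right_mono mult_mono powr_mono2) auto
    qed
    have l: "0 \<le> f x" if "x \<in> {c..t}" for x using that c h(3)[of x] by (simp add: f_def)
    have "continuous_on {c..t} f" by (rule continuous_on_subset[OF cf]) auto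
    note b = integral_ivl_bounds[OF this l u]
    show "0 \<le> I t" "I t \<le> t * (t powr (n / 2 - 1) * t ^ j / 4)"
      unfolding I_def by (rule b; use t c in simp)+
  qed
  have pb: "0 \<le> p t \<and> p t \<le> t ^ j" if t: "0 < t" for t
  proof -
    have "p t \<le> t powr (- (n / 2)) * (t * (t powr (n / 2 - 1) * t ^ j / 4))"
      unfolding p_def using Ib[of t] t by (intro mult_left_mono) auto
    also have "\<dots> = (t * t powr (- (n / 2)) * t powr (n / 2 - 1)) * t ^ j / 4" by (simp add: mult_ac)
    also have "t * t powr (- (n / 2)) * t powr (n / 2 - 1) = 1"
      using t powr_add[of t "1 - n / 2" "n / 2 - 1"] powr_add[of t 1 "- (n / 2)"] by simp
    finally have "p t \<le> t ^ j / 4" by simp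
    moreover have "0 \<le> t ^ j" using t by simp
    moreover have "0 \<le> p t" unfolding p_def using t Ib(1)[of t] by simp
    ultimately show ?thesis by linarith
  qed
  have gb: "0 \<le> g t \<and> g t \<le> t ^ Suc j" if t: "0 \<le> t" for t
  proof -
    have u: "p x \<le> t ^ j" if "x \<in> {c..t}" for x
      using that c pb[of x] power_mono[of x t j] by auto
    have l: "0 \<le> p x" if "x \<in> {c..t}" for x using that c pb[of x] by auto
    have "continuous_on {c..t} p" by (rule continuous_on_subset[OF cp]) auto
    note b = integral_ivl_bounds[OF this l u]
    have "0 \<le> g t" "g t \<le> t * t ^ j"
      unfolding g_def by (rule b; use t c in simp)+
    then show ?thesis by simp
  qed
  have cg: "continuous_on UNIV g"
  proof (rule continuous_at_imp_continuous_on, rule ballI)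
    fix t :: real
    show "isCont g t"
    proof (cases "c < t")
      case True then show ?thesis using Dg DERIV_isCont by blast
    next
      case False
      then have "t < d" using c by simp
      then have "\<forall>\<^sub>F s in nhds t. g s = 0"
        using order_tendstoD(2)[OF filterlim_ident, of t d] g0 by (auto elim!: eventually_mono)
      then show ?thesis using isCont_cong[of g "\<lambda>_. 0" t] by simp
    qed
  qed
  have cq: "continuous_on {c<..} q"
  proof -
    have s: "{c<..} \<subseteq> {c..}" by auto
    show ?thesis unfolding q_def using c
      by (intro continuous_intros continuous_on_subset[OF I_cont s] continuous_on_subset[OF cf s]) auto
  qed
  show ?thesis
    by (rule exI[of _ g], rule exI[of _ p], rule exI[of _ q]) (use Dg Dp eq cq g0 cg gb in \<open>auto simp: c_def\<close>)
qed

lemma Ck_1_radial: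
  fixes S :: "(real^'n::finite) set"
  assumes S: "open S" and T: "\<And>y. y \<in> S \<Longrightarrow> (norm y)\<^sup>2 \<in> T"
    and p: "\<And>t. t \<in> T \<Longrightarrow> (p has_real_derivative q t) (at t)" and q: "continuous_on T q"
  shows "Ck (Suc 0) S (\<lambda>y. p ((norm y)\<^sup>2))"
proof (rule Ck_SucI[OF S, where d="\<lambda>i x. q ((norm x)\<^sup>2) * (2 * x $ i)"])
  have pc: "continuous_on T p" using p DERIV_isCont by (metis continuous_at_imp_continuous_on)
  show "continuous_on S (\<lambda>y. p ((norm y)\<^sup>2))"
    by (intro continuous_on_compose2[OF pc] continuous_intros) (use T in auto)
  show "has_pd (\<lambda>y. p ((norm y)\<^sup>2)) i (q ((norm x)\<^sup>2) * (2 * x $ i)) x" if "x \<in> S" for i x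
    by (intro has_pd_compose p T that has_pd_norm2)
  show "Ck 0 S (\<lambda>x. q ((norm x)\<^sup>2) * (2 * x $ i))" for i
    by (auto intro!: continuous_intros continuous_on_compose2[OF q] T)
qed

lemma Ck_2_radial:
  fixes S :: "(real^'n::finite) set"
  assumes S: "open S" and T: "\<And>y. y \<in> S \<Longrightarrow> (norm y)\<^sup>2 \<in> T"
    and g: "\<And>t. t \<in> T \<Longrightarrow> (g has_real_derivative p t) (at t)"
    and p: "\<And>t. t \<in> T \<Longrightarrow> (p has_real_derivative q t) (at t)" and q: "continuous_on T q"
  shows "Ck 2 S (\<lambda>y. g ((norm y)\<^sup>2))"
proof (rule Ck_le)
  show "Ck (Suc (Suc 0)) S (\<lambda>y. g ((norm y)\<^sup>2))"
  proof (rule Ck_SucI[OF S, where d="\<lambda>i x. p ((norm x)\<^sup>2) * (2 * x $ i)"])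
  have gc: "continuous_on T g" using g DERIV_isCont by (metis continuous_at_imp_continuous_on)
  show "continuous_on S (\<lambda>y. g ((norm y)\<^sup>2))"
    by (intro continuous_on_compose2[OF gc] continuous_intros) (use T in auto)
  show "has_pd (\<lambda>y. g ((norm y)\<^sup>2)) i (p ((norm x)\<^sup>2) * (2 * x $ i)) x" if "x \<in> S" for i x
    by (intro has_pd_compose g T that has_pd_norm2)
  show "Ck (Suc 0) S (\<lambda>x. p ((norm x)\<^sup>2) * (2 * x $ i))" for i
    by (intro Ck_mult Ck_cmult Ck_nth S Ck_1_radial[OF S T p q])
  qed
qed simp

text \<open>Each stage solves \<open>lap G = g\<close> rather than the equation with a minus sign:
  this keeps all functions nonnegative and accounts for (-1)^j. In |y| the bound reads |y|^(2j), the
  weight under which the m-fold Laplacian is integrable for j = m.\<close>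

lemma iterated_radial_poisson:
  assumes n: "CARD('n::finite) \<ge> 2" and d: "d > 0" and h: "continuous_on UNIV h" "\<And>t. t \<le> d \<Longrightarrow> h t = 0"
    "\<And>t. 0 \<le> t \<Longrightarrow> 0 \<le> h t" "\<And>t. 0 \<le> t \<Longrightarrow> h t \<le> 1"
  shows "\<exists>g. continuous_on UNIV g \<and> (\<forall>t\<le>d. g t = 0) \<and> (\<forall>t\<ge>0. 0 \<le> g t \<and> g t \<le> t ^ j) \<and>
    (\<forall>V :: real^'n \<Rightarrow> real. Ck (2 * j) UNIV V \<longrightarrow> csupp V \<longrightarrow>
      (\<integral>y. g ((norm y)\<^sup>2) * polylap j V y \<partial>lborel) = (- 1) ^ j * (\<integral>y. h ((norm y)\<^sup>2) * V y \<partial>lborel))"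
proof (induction j)
  case 0
  show ?case by (rule exI[of _ h]) (use h in auto)
next
  case (Suc j)
  then obtain g where g: "continuous_on UNIV g" "\<And>t. t \<le> d \<Longrightarrow> g t = 0" "\<And>t. 0 \<le> t \<Longrightarrow> 0 \<le> g t" "\<And>t. 0 \<le> t \<Longrightarrow> g t \<le> t ^ j"
    and V: "\<And>V :: real^'n \<Rightarrow> real. Ck (2 * j) UNIV V \<Longrightarrow> csupp V \<Longrightarrow>
      (\<integral>y. g ((norm y)\<^sup>2) * polylap j V y \<partial>lborel) = (- 1) ^ j * (\<integral>y. h ((norm y)\<^sup>2) * V y \<partial>lborel)" by blast
  have n': "2 \<le> real CARD('n)" using n by simp
  obtain G p q where G: "\<And>t. t > d / 2 \<Longrightarrow> (G has_real_derivative p t) (at t)" "\<And>t. t > d / 2 \<Longrightarrow> (p has_real_derivative q t) (at t)"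
      "\<And>t. t > d / 2 \<Longrightarrow> 4 * t * q t + 2 * real CARD('n) * p t = g t" "continuous_on {d / 2<..} q" "\<And>t. t \<le> d \<Longrightarrow> G t = 0"
      "continuous_on UNIV G" "\<And>t. t \<ge> 0 \<Longrightarrow> 0 \<le> G t \<and> G t \<le> t ^ Suc j"
    using radial_poisson[OF n' d g] by blast
  \<comment> \<open>Two overlapping open sets that cover the space: the radial equation holds on the
    first, \<open>G\<close> is 0 on the second.\<close>
  let ?S = "{y :: real^'n. d / 2 < (norm y)\<^sup>2}" and ?Z = "{y :: real^'n. (norm y)\<^sup>2 < d}"
  have opS: "open ?S" and opZ: "open ?Z" by (intro open_Collect_less continuous_intros)+
  have cov: "y \<in> ?S \<or> y \<in> ?Z" for y using d by auto
  let ?G = "\<lambda>y :: real^'n. G ((norm y)\<^sup>2)"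
  have C2: "Ck 2 UNIV ?G"
  proof (rule Ck_local)
    fix y :: "real^'n"
    have "Ck 2 ?S ?G" by (rule Ck_2_radial[OF opS, where T="{d / 2<..}"]) (use G in auto)
    moreover have "Ck 2 ?Z ?G" by (rule Ck_cong[OF opZ _ Ck_const[of _ _ 0]]) (use G in auto)
    ultimately show "\<exists>T. open T \<and> y \<in> T \<and> Ck 2 T ?G" using cov[of y] opS opZ by blast
  qed
  have lapG: "lap ?G y = g ((norm y)\<^sup>2)" for y
  proof (cases "y \<in> ?S")
    case True
    have "lap ?G y = 4 * (norm y)\<^sup>2 * q ((norm y)\<^sup>2) + 2 * real CARD('n) * p ((norm y)\<^sup>2)"
      by (rule lap_radial[OF opS True, where T="{d / 2<..}"]) (use G in auto)
    then show ?thesis using G(3) True by simp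
  next
    case False
    then have y: "y \<in> ?Z" using cov by blast
    have "lap ?G y = lap (\<lambda>_. 0) y" by (rule lap_cong[OF opZ y]) (use G in auto)
    then show ?thesis using g(2) y by simp
  qed
  have "(\<integral>y. ?G y * polylap (Suc j) V y \<partial>lborel) = (- 1) ^ Suc j * (\<integral>y. h ((norm y)\<^sup>2) * V y \<partial>lborel)"
    if V': "Ck (2 * Suc j) UNIV V" "csupp V" for V :: "real^'n \<Rightarrow> real"
  proof -
    have c: "Ck (2 * j + 2) UNIV V" "Ck (2 * j) UNIV V" using V'(1) Ck_le[OF V'(1), of "2 * j"] by simp_all
    have "(\<integral>y. ?G y * lap (polylap j V) y \<partial>lborel) = (\<integral>y. lap ?G y * polylap j V y \<partial>lborel)"
      by (intro integral_by_parts_lap C2 Ck_polylap c csupp_polylap V' open_UNIV)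
    then show ?thesis using V[OF c(2) V'(2)] by (simp add: polylap_Suc lapG)
  qed
  then show ?case using G by (intro exI[of _ G]) auto
qed

text \<open>Testing bounds the integral of \<open>h k\<close> times \<open>U\<close>, in absolute
  value, by the weighted integral \<open>C\<close> of the m-fold Laplacian, for all
  \<open>k\<close>. Writing the negative part as the positive part minus \<open>U\<close> gives the
  bound \<open>P + C\<close> for it, and Fatou's lemma removes \<open>h k\<close>.\<close>

theorem integrable_if_pos_part_integrable:
  fixes U :: "real^'n::finite \<Rightarrow> real"
  assumes n: "CARD('n) \<ge> 2"
    and U: "Ck (2 * m) (- {0}) U" "csupp U" "integrable lborel (\<lambda>y. max (U y) 0)"
    and F: "integrable lborel (\<lambda>y. norm y powr real (2 * m) * polylap m U y)"
  shows "integrable lborel U"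
proof -
  have AE: "AE y :: real^'n in lborel. y \<noteq> 0" by (rule AE_lborel_singleton)
  have Um [measurable]: "U \<in> borel_measurable borel"
    using U(1) by (intro borel_measurable_continuous_off_0 Ck_continuous_on)
  have Fm [measurable]: "polylap m U \<in> borel_measurable borel"
    using U(1) by (intro borel_measurable_continuous_off_0 continuous_on_polylap) auto
  define d where "d k = 1 / real (Suc k)" for k
  have d: "0 < d k" "d \<longlonglongrightarrow> 0" for k unfolding d_def[abs_def] using harmonic_seq by auto
  \<comment> \<open>A ramp in t = |y|^2: 0 up to \<open>d k\<close> and 1 from
    \<open>2 * d k\<close> on.\<close>
  define h where "h k t = min 1 (max 0 (t / d k - 1))" for k t
  have h: "continuous_on UNIV (h k)" "\<And>t. t \<le> d k \<Longrightarrow> h k t = 0" "\<And>t. 0 \<le> h k t" "\<And>t. h k t \<le> 1" for k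
  proof -
    have "d k \<noteq> 0" using d(1)[of k] by simp
    then show "continuous_on UNIV (h k)" unfolding h_def[abs_def] by (intro continuous_intros) auto
    show "h k t = 0" if "t \<le> d k" for t using that d(1)[of k] by (simp add: h_def)
  qed (auto simp: h_def)
  have hm [measurable]: "h k \<in> borel_measurable borel" for k using h(1) by (rule borel_measurable_continuous_onI)
  have h1: "(\<lambda>k. h k t) \<longlonglongrightarrow> 1" if "t > 0" for t
  proof (rule tendsto_eventually)
    have "\<forall>\<^sub>F k in sequentially. d k < t / 2" using order_tendstoD(2)[OF d(2), of "t / 2"] that by simp
    then show "\<forall>\<^sub>F k in sequentially. h k t = 1"
    proof eventually_elim
      case (elim k)
      then have "1 \<le> t / d k - 1" using d(1)[of k] by (simp add: field_simps)
      then show ?case by (simp add: h_def)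
    qed
  qed
  define C where "C = (\<integral>y. norm y powr real (2 * m) * \<bar>polylap m U y\<bar> \<partial>lborel)"
  have iF: "integrable lborel (\<lambda>y. norm y powr real (2 * m) * \<bar>polylap m U y\<bar>)"
    using Bochner_Integration.integrable_abs[OF F] by (simp add: abs_mult)
  define P where "P = (\<integral>y. max (U y) 0 \<partial>lborel)"
  have bound: "(\<integral>\<^sup>+ y. ennreal (h k ((norm y)\<^sup>2) * max (- U y) 0) \<partial>lborel) \<le> ennreal (P + C)" for k
  proof -
    obtain g where g: "continuous_on UNIV g" "\<And>t. t \<le> d k \<Longrightarrow> g t = 0" "\<And>t. 0 \<le> t \<Longrightarrow> 0 \<le> g t" "\<And>t. 0 \<le> t \<Longrightarrow> g t \<le> t ^ m"
      and gV: "\<And>V :: real^'n \<Rightarrow> real. Ck (2 * m) UNIV V \<Longrightarrow> csupp V \<Longrightarrow>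
        (\<integral>y. g ((norm y)\<^sup>2) * polylap m V y \<partial>lborel) = (- 1) ^ m * (\<integral>y. h k ((norm y)\<^sup>2) * V y \<partial>lborel)"
      using iterated_radial_poisson[OF n d(1) h(1,2) h(3) h(4), of k k m] by blast
    have gm [measurable]: "g \<in> borel_measurable borel" using g(1) by (rule borel_measurable_continuous_onI)
    \<comment> \<open>The truncation between radii \<open>r\<close> and \<open>2 * r\<close> acts
      only where |y|^2 is at most \<open>d k\<close>, hence where \<open>h k\<close> and
      \<open>g\<close> vanish.\<close>
    define r where "r = sqrt (d k) / 4"
    have r: "r > 0" using d(1)[of k] by (simp add: r_def)
    have near: "(norm y)\<^sup>2 \<le> d k" if "norm y \<le> 2 * r" for y :: "real^'n"
    proof -
      have "norm y \<le> sqrt (d k)" using that r unfolding r_def by linarith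
      then have "(norm y)\<^sup>2 \<le> (sqrt (d k))\<^sup>2" by (rule power_mono) simp
      then show ?thesis using d(1)[of k] by simp
    qed
    define V where "V y = (1 - cutoff (2 * m) r (2 * r) y) * U y" for y
    have V: "Ck (2 * m) UNIV V" "csupp V"
      unfolding V_def[abs_def] using Ck_inner_cutoff[OF U(1) r, of "2 * r"] r by (auto intro: csupp_mult_left U(2))
    have hV: "h k ((norm y)\<^sup>2) * V y = h k ((norm y)\<^sup>2) * U y" for y
      using near[of y] h(2) cutoff_eq_0[of r "2 * r" y "2 * m"] r by (cases "norm y \<le> 2 * r") (auto simp: V_def)
    have gVU: "g ((norm y)\<^sup>2) * polylap m V y = g ((norm y)\<^sup>2) * polylap m U y" for y
      using near[of y] g(2) polylap_inner_cutoff[of r "2 * r" y m "2 * m" U] r unfolding V_def[abs_def]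
      by (cases "norm y \<le> 2 * r") auto
    have ch: "continuous_on UNIV (\<lambda>y :: real^'n. h k ((norm y)\<^sup>2))"
      by (intro continuous_on_compose2[OF h(1)] continuous_intros) auto
    have hU: "integrable lborel (\<lambda>y. h k ((norm y)\<^sup>2) * U y)"
      unfolding hV[symmetric]
      by (intro integrable_continuous_csupp continuous_on_mult ch Ck_continuous_on[OF V(1)] csupp_mult_left V)
    have hP: "integrable lborel (\<lambda>y. h k ((norm y)\<^sup>2) * max (U y) 0)"
      by (rule Bochner_Integration.integrable_bound[OF U(3)]) (use h(3,4)[of k] in \<open>auto intro!: mult_left_le_one_le\<close>)
    have split: "h k ((norm y)\<^sup>2) * max (- U y) 0 = h k ((norm y)\<^sup>2) * max (U y) 0 - h k ((norm y)\<^sup>2) * U y" for y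
      by (auto simp: max_def)
    have hN: "integrable lborel (\<lambda>y. h k ((norm y)\<^sup>2) * max (- U y) 0)"
      unfolding split by (intro Bochner_Integration.integrable_diff hP hU)
    have "- (\<integral>y. h k ((norm y)\<^sup>2) * U y \<partial>lborel) \<le> \<bar>\<integral>y. h k ((norm y)\<^sup>2) * U y \<partial>lborel\<bar>" by simp
    also have "\<dots> = \<bar>\<integral>y. g ((norm y)\<^sup>2) * polylap m U y \<partial>lborel\<bar>"
      using gV[OF V] unfolding hV gVU by (simp add: abs_mult power_abs[symmetric])
    also have "\<dots> \<le> (\<integral>y. \<bar>g ((norm y)\<^sup>2) * polylap m U y\<bar> \<partial>lborel)"
      by (rule integral_abs_bound)
    also have "\<dots> \<le> C" unfolding C_def
    proof (rule integral_mono_AE')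
      show "AE y in lborel. \<bar>g ((norm y)\<^sup>2) * polylap m U y\<bar> \<le> norm y powr real (2 * m) * \<bar>polylap m U y\<bar>"
        using AE
      proof eventually_elim
        case (elim y)
        have "((norm y)\<^sup>2) ^ m = norm y powr real (2 * m)"
          using elim powr_realpow[of "norm y" "2 * m"] by (simp add: power_mult)
        then show ?case using g(3,4)[of "(norm y)\<^sup>2"] by (simp add: abs_mult mult_right_mono)
      qed
    qed (use iF in auto)
    finally have 1: "- (\<integral>y. h k ((norm y)\<^sup>2) * U y \<partial>lborel) \<le> C" .
    have 2: "(\<integral>y. h k ((norm y)\<^sup>2) * max (U y) 0 \<partial>lborel) \<le> P"
      unfolding P_def using h(3,4)[of k] by (intro integral_mono hP U(3)) (auto intro: mult_left_le_one_le)
    have "(\<integral>\<^sup>+ y. ennreal (h k ((norm y)\<^sup>2) * max (- U y) 0) \<partial>lborel) = ennreal (\<integral>y. h k ((norm y)\<^sup>2) * max (- U y) 0 \<partial>lborel)"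
      using hN h(3)[of k] by (intro nn_integral_eq_integral) auto
    also have "\<dots> \<le> ennreal (P + C)"
      unfolding split using 1 2 hP hU by (intro ennreal_leI) simp
    finally show ?thesis .
  qed
  have "(\<integral>\<^sup>+ y. ennreal (max (- U y) 0) \<partial>lborel) \<le> (\<integral>\<^sup>+ y. liminf (\<lambda>k. ennreal (h k ((norm y)\<^sup>2) * max (- U y) 0)) \<partial>lborel)"
  proof (rule nn_integral_mono_AE)
    show "AE y in lborel. ennreal (max (- U y) 0) \<le> liminf (\<lambda>k. ennreal (h k ((norm y)\<^sup>2) * max (- U y) 0))"
      using AE
    proof eventually_elim
      case (elim y)
      have "(\<lambda>k. h k ((norm y)\<^sup>2) * max (- U y) 0) \<longlonglongrightarrow> 1 * max (- U y) 0"
        using elim by (intro tendsto_mult_right h1) simp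
      then have "(\<lambda>k. ennreal (h k ((norm y)\<^sup>2) * max (- U y) 0)) \<longlonglongrightarrow> ennreal (max (- U y) 0)"
        by (intro tendsto_ennrealI) simp
      from lim_imp_Liminf[OF trivial_limit_sequentially this] show ?case by simp
    qed
  qed
  also have "\<dots> \<le> liminf (\<lambda>k. \<integral>\<^sup>+ y. ennreal (h k ((norm y)\<^sup>2) * max (- U y) 0) \<partial>lborel)"
    by (rule nn_integral_liminf) simp
  also have "\<dots> \<le> ennreal (P + C)"
    by (rule order_trans[OF Liminf_le_Limsup Limsup_bounded]) (use bound in auto)
  also have "\<dots> < \<infinity>" by simp
  finally have "(\<integral>\<^sup>+ y. ennreal (max (- U y) 0) \<partial>lborel) < \<infinity>" .
  then have "integrable lborel (\<lambda>y. max (- U y) 0)" by (intro integrableI_nonneg) auto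
  from Bochner_Integration.integrable_diff[OF U(3) this]
  have "integrable lborel (\<lambda>y. max (U y) 0 - max (- U y) 0)" .
  moreover have "(\<lambda>y. max (U y) 0 - max (- U y) 0) = U" by (auto simp: max_def)
  ultimately show ?thesis by simp
qed

section \<open>Decomposition of singular solutions\<close>

lemma Cinf_polylap: "open S \<Longrightarrow> Cinf S g \<Longrightarrow> Cinf S (polylap m g)"
  unfolding Cinf_def using Ck_polylap by blast

text \<open>Densities supported away from the open ball of radius \<open>R\<close>: on that ball the convolution with a kernel
  that is smooth off the origin never meets the singularity of the kernel.\<close>

locale exterior_density =
  fixes G :: "real^'n::finite \<Rightarrow> real" and R :: real
  assumes R_pos: "0 < R" and G_int: "integrable lborel G"
    and G_inner: "\<And>y. norm y < R \<Longrightarrow> G y = 0" and G_outer: "\<And>y. 1 < norm y \<Longrightarrow> G y = 0"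
begin

definition conv :: "(real^'n \<Rightarrow> real) \<Rightarrow> real^'n \<Rightarrow> real" where
  "conv \<kappa> x = (\<integral>y. \<kappa> (x - y) * G y \<partial>lborel)"

lemma G_measurable [measurable]: "G \<in> borel_measurable borel"
  using G_int by auto

text \<open>For |x| <= r < R <= |y| <= 1 the difference x - y stays in the compact annulus R - r <=
  |z| <= r + 1, away from the pole.\<close>

lemma kernel_bound:
  fixes \<kappa> :: "real^'n \<Rightarrow> real"
  assumes "continuous_on (- {0}) \<kappa>" "r < R"
  obtains B where "B \<ge> 0" "\<And>x y. norm x \<le> r \<Longrightarrow> R \<le> norm y \<Longrightarrow> norm y \<le> 1 \<Longrightarrow> \<bar>\<kappa> (x - y)\<bar> \<le> B"
proof -
  let ?A = "cball 0 (r + 1) - ball 0 (R - r) :: (real^'n) set"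
  have "compact ?A" by (intro compact_diff) auto
  moreover have "continuous_on ?A \<kappa>"
    by (rule continuous_on_subset[OF assms(1)]) (use assms(2) in auto)
  ultimately have "bounded (\<kappa> ` ?A)" by (intro compact_imp_bounded compact_continuous_image)
  then obtain B where "\<forall>z\<in>?A. \<bar>\<kappa> z\<bar> \<le> B" unfolding bounded_iff by auto
  then have B: "\<And>z. z \<in> ?A \<Longrightarrow> \<bar>\<kappa> z\<bar> \<le> B" by blast
  have "\<bar>\<kappa> (x - y)\<bar> \<le> max B 0" if "norm x \<le> r" "R \<le> norm y" "norm y \<le> 1" for x y
  proof -
    have "R - r \<le> norm (x - y)" using that norm_triangle_ineq2[of y x] by (simp add: norm_minus_commute)
    moreover have "norm (x - y) \<le> r + 1" using that norm_triangle_ineq4[of x y] by linarith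
    ultimately have "x - y \<in> ?A" by auto
    then show ?thesis using B by force
  qed
  then show ?thesis by (intro that[of "max B 0"]) auto
qed

lemma kernel_measurable:
  fixes \<kappa> :: "real^'n \<Rightarrow> real"
  assumes "continuous_on (- {0}) \<kappa>"
  shows "(\<lambda>y. \<kappa> (x - y) * G y) \<in> borel_measurable lborel"
proof -
  have [measurable]: "\<kappa> \<in> borel_measurable borel" by (rule borel_measurable_continuous_off_0[OF assms])
  show ?thesis by measurable
qed

lemma integrable_conv:
  fixes \<kappa> :: "real^'n \<Rightarrow> real"
  assumes \<kappa>: "continuous_on (- {0}) \<kappa>" and x: "norm x < R"
  shows "integrable lborel (\<lambda>y. \<kappa> (x - y) * G y)"
proof -
  obtain B where B: "B \<ge> 0" "\<And>z y. norm z \<le> norm x \<Longrightarrow> R \<le> norm y \<Longrightarrow> norm y \<le> 1 \<Longrightarrow> \<bar>\<kappa> (z - y)\<bar> \<le> B"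
    using kernel_bound[OF \<kappa> x] by blast
  show ?thesis
  proof (rule Bochner_Integration.integrable_bound[OF integrable_mult_right[OF G_int, of B] kernel_measurable[OF \<kappa>]], rule AE_I2)
    fix y
    show "norm (\<kappa> (x - y) * G y) \<le> norm (B * G y)"
    proof (cases "R \<le> norm y \<and> norm y \<le> 1")
      case True
      then show ?thesis using B(1) B(2)[of x y] by (simp add: abs_mult mult_right_mono)
    next
      case False
      then have "G y = 0" using G_inner G_outer by (meson not_le)
      then show ?thesis by simp
    qed
  qed
qed

lemma continuous_conv:
  fixes \<kappa> :: "real^'n \<Rightarrow> real"
  assumes \<kappa>: "continuous_on (- {0}) \<kappa>"
  shows "continuous_on (ball 0 R) (conv \<kappa>)"
proof (rule continuous_at_imp_continuous_on, rule ballI)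
  fix x :: "real^'n" assume x: "x \<in> ball 0 R"
  define r where "r = (norm x + R) / 2"
  have r: "norm x < r" "r < R" using x by (auto simp: r_def)
  obtain B where B: "B \<ge> 0" "\<And>z y. norm z \<le> r \<Longrightarrow> R \<le> norm y \<Longrightarrow> norm y \<le> 1 \<Longrightarrow> \<bar>\<kappa> (z - y)\<bar> \<le> B"
    using kernel_bound[OF \<kappa> r(2)] by blast
  have "continuous (at x within ball 0 r) (conv \<kappa>)"
    unfolding continuous_within tendsto_at_iff_sequentially comp_def conv_def
  proof (intro allI impI)
    fix X :: "nat \<Rightarrow> real^'n" assume X: "\<forall>i. X i \<in> ball 0 r - {x}" "X \<longlonglongrightarrow> x"
    show "(\<lambda>k. \<integral>y. \<kappa> (X k - y) * G y \<partial>lborel) \<longlonglongrightarrow> (\<integral>y. \<kappa> (x - y) * G y \<partial>lborel)"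
    proof (rule integral_dominated_convergence[where w="\<lambda>y. B * \<bar>G y\<bar>"])
      show "AE y in lborel. (\<lambda>k. \<kappa> (X k - y) * G y) \<longlonglongrightarrow> \<kappa> (x - y) * G y"
      proof (rule AE_I2)
        fix y
        show "(\<lambda>k. \<kappa> (X k - y) * G y) \<longlonglongrightarrow> \<kappa> (x - y) * G y"
        proof (cases "norm y < R")
          case False
          then have "x - y \<in> - {0}" using x by auto
          then have "isCont \<kappa> (x - y)"
            using \<kappa> continuous_on_eq_continuous_at[OF open_Compl_0] by blast
          then have "(\<lambda>k. \<kappa> (X k - y)) \<longlonglongrightarrow> \<kappa> (x - y)"
            by (rule isCont_tendsto_compose) (intro tendsto_intros X)
          then show ?thesis by (intro tendsto_mult_right)
        qed (simp add: G_inner)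
      qed
      show "AE y in lborel. norm (\<kappa> (X k - y) * G y) \<le> B * \<bar>G y\<bar>" for k
      proof (rule AE_I2)
        fix y
        show "norm (\<kappa> (X k - y) * G y) \<le> B * \<bar>G y\<bar>"
        proof (cases "R \<le> norm y \<and> norm y \<le> 1")
          case True
          have "norm (X k) \<le> r" using X(1)[rule_format, of k] by simp
          then show ?thesis using B(1) B(2)[of "X k" y] True by (simp add: abs_mult mult_right_mono)
        next
          case False
          then have "G y = 0" using G_inner G_outer by (meson not_le)
          then show ?thesis by simp
        qed
      qed
    qed (use G_int kernel_measurable[OF \<kappa>] in auto)
  qed
  moreover have "at x within ball 0 r = at x" using r by (intro at_within_interior) auto
  ultimately show "isCont (conv \<kappa>) x" by simp
qed

text \<open>Differentiation under the integral: the mean value inequality bounds the difference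
  quotients by a bound of \<open>pd i \<kappa>\<close> on a compact annulus, times |G|.\<close>

lemma has_pd_conv:
  fixes \<kappa> :: "real^'n \<Rightarrow> real"
  assumes \<kappa>: "Ck (Suc 0) (- {0}) \<kappa>" and x: "norm x < R"
  shows "has_pd (conv \<kappa>) i (conv (pd i \<kappa>) x) x"
proof -
  have c: "continuous_on (- {0}) \<kappa>" "continuous_on (- {0}) (pd i \<kappa>)"
    using Ck_continuous_on[OF \<kappa>] Ck_continuous_on[OF Ck_pd[OF \<kappa>]] .
  define r where "r = (norm x + R) / 2"
  have r: "norm x < r" "r < R" using x by (auto simp: r_def)
  obtain B where B: "B \<ge> 0" "\<And>z y. norm z \<le> r \<Longrightarrow> R \<le> norm y \<Longrightarrow> norm y \<le> 1 \<Longrightarrow> \<bar>pd i \<kappa> (z - y)\<bar> \<le> B"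
    using kernel_bound[OF c(2) r(2)] by blast
  \<comment> \<open>Shifts of length at most \<open>e\<close> stay in the ball of radius
    \<open>r\<close>, where the bound \<open>B\<close> is valid.\<close>
  define e where "e = r - norm x"
  have e: "e > 0" using r by (simp add: e_def)
  have near: "norm (x + t *\<^sub>R axis i 1) \<le> r" if "\<bar>t\<bar> \<le> e" for t
    using norm_triangle_ineq[of x "t *\<^sub>R axis i 1"] that by (simp add: e_def)
  have "((\<lambda>t. (conv \<kappa> (x + t *\<^sub>R axis i 1) - conv \<kappa> x) / t) \<longlongrightarrow> conv (pd i \<kappa>) x) (at 0 within {- e..e})"
    unfolding tendsto_at_iff_sequentially comp_def
  proof (intro allI impI)
    fix X :: "nat \<Rightarrow> real" assume A: "\<forall>k. X k \<in> {- e..e} - {0}" and X0: "X \<longlonglongrightarrow> 0"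
    have X: "\<bar>X k\<bar> \<le> e" "X k \<noteq> 0" for k using A[rule_format, of k] by (auto simp: abs_le_iff)
    have q: "(conv \<kappa> (x + X k *\<^sub>R axis i 1) - conv \<kappa> x) / X k
        = (\<integral>y. (\<kappa> (x - y + X k *\<^sub>R axis i 1) - \<kappa> (x - y)) / X k * G y \<partial>lborel)" for k
    proof -
      have n: "norm (x + X k *\<^sub>R axis i 1) < R" using near[OF X(1), of k] r by simp
      have "(conv \<kappa> (x + X k *\<^sub>R axis i 1) - conv \<kappa> x) / X k
        = (\<integral>y. \<kappa> (x + X k *\<^sub>R axis i 1 - y) * G y - \<kappa> (x - y) * G y \<partial>lborel) / X k"
        unfolding conv_def using integrable_conv[OF c(1) n] integrable_conv[OF c(1) x] by simp
      also have "\<dots> = (\<integral>y. (\<kappa> (x + X k *\<^sub>R axis i 1 - y) * G y - \<kappa> (x - y) * G y) / X k \<partial>lborel)" by simp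
      finally show ?thesis by (simp add: algebra_simps diff_divide_distrib)
    qed
    show "(\<lambda>k. (conv \<kappa> (x + X k *\<^sub>R axis i 1) - conv \<kappa> x) / X k) \<longlonglongrightarrow> conv (pd i \<kappa>) x"
      unfolding q unfolding conv_def
    proof (rule integral_dominated_convergence[where w="\<lambda>y. B * \<bar>G y\<bar>"])
      show "AE y in lborel. (\<lambda>k. (\<kappa> (x - y + X k *\<^sub>R axis i 1) - \<kappa> (x - y)) / X k * G y) \<longlonglongrightarrow> pd i \<kappa> (x - y) * G y"
      proof (rule AE_I2)
        fix y
        show "(\<lambda>k. (\<kappa> (x - y + X k *\<^sub>R axis i 1) - \<kappa> (x - y)) / X k * G y) \<longlonglongrightarrow> pd i \<kappa> (x - y) * G y"
        proof (cases "norm y < R")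
          case False
          then have "x - y \<in> - {0}" using x by auto
          then have "((\<lambda>t. (\<kappa> (x - y + t *\<^sub>R axis i 1) - \<kappa> (x - y)) / t) \<longlongrightarrow> pd i \<kappa> (x - y)) (at 0)"
            using Ck_Suc_has_pd[OF \<kappa>, of "x - y" i] unfolding has_pd_def DERIV_def by simp
          moreover have "filterlim X (at 0) sequentially"
            using X0 X(2) by (auto simp: filterlim_at)
          ultimately have "(\<lambda>k. (\<kappa> (x - y + X k *\<^sub>R axis i 1) - \<kappa> (x - y)) / X k) \<longlonglongrightarrow> pd i \<kappa> (x - y)"
            by (rule filterlim_compose)
          then show ?thesis by (intro tendsto_mult_right)
        qed (simp add: G_inner)
      qed
      show "AE y in lborel. norm ((\<kappa> (x - y + X k *\<^sub>R axis i 1) - \<kappa> (x - y)) / X k * G y) \<le> B * \<bar>G y\<bar>" for k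
      proof (rule AE_I2)
        fix y
        show "norm ((\<kappa> (x - y + X k *\<^sub>R axis i 1) - \<kappa> (x - y)) / X k * G y) \<le> B * \<bar>G y\<bar>"
        proof (cases "R \<le> norm y \<and> norm y \<le> 1")
          case True
          have "\<bar>\<kappa> (x - y + X k *\<^sub>R axis i 1) - \<kappa> (x - y) - 0 * X k\<bar> \<le> B * \<bar>X k\<bar>"
          proof (rule has_pd_line_bound[where d="\<lambda>t. pd i \<kappa> (x - y + t *\<^sub>R axis i 1)"])
            fix t assume "\<bar>t\<bar> \<le> \<bar>X k\<bar>"
            then have n: "norm (x + t *\<^sub>R axis i 1) \<le> r" using near[of t] X(1)[of k] by simp
            have eq: "x - y + t *\<^sub>R axis i 1 = x + t *\<^sub>R axis i 1 - y" by simp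
            have "x - y + t *\<^sub>R axis i 1 \<in> - {0}" using n True r unfolding eq by auto
            then show "has_pd \<kappa> i (pd i \<kappa> (x - y + t *\<^sub>R axis i 1)) (x - y + t *\<^sub>R axis i 1)"
              by (rule Ck_Suc_has_pd[OF \<kappa>])
            show "\<bar>pd i \<kappa> (x - y + t *\<^sub>R axis i 1) - 0\<bar> \<le> B"
              using B(2)[OF n, of y] True unfolding eq by simp
          qed
          then have "\<bar>(\<kappa> (x - y + X k *\<^sub>R axis i 1) - \<kappa> (x - y)) / X k\<bar> \<le> B"
            using X(2)[of k] by (simp add: field_simps)
          then show ?thesis unfolding norm_mult using B(1) by (intro mult_mono) auto
        qed (use G_inner[of y] G_outer[of y] in \<open>auto simp: not_le\<close>)
      qed
      show "(\<lambda>y. pd i \<kappa> (x - y) * G y) \<in> borel_measurable lborel" by (rule kernel_measurable[OF c(2)])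
      have [measurable]: "\<kappa> \<in> borel_measurable borel" by (rule borel_measurable_continuous_off_0[OF c(1)])
      show "(\<lambda>y. (\<kappa> (x - y + X k *\<^sub>R axis i 1) - \<kappa> (x - y)) / X k * G y) \<in> borel_measurable lborel" for k
        by measurable
    qed (use G_int in auto)
  qed
  moreover have "at 0 within {- e..e} = at (0::real)" using e by (intro at_within_interior) auto
  ultimately show ?thesis unfolding has_pd_def DERIV_def by simp
qed

lemma Cinf_conv:
  fixes \<kappa> :: "real^'n \<Rightarrow> real"
  assumes "Cinf (- {0}) \<kappa>"
  shows "Cinf (ball 0 R) (conv \<kappa>)"
  unfolding Cinf_def
proof
  fix k
  show "Ck k (ball 0 R) (conv \<kappa>)" using assms
  proof (induction k arbitrary: \<kappa>)
    case 0
    then show ?case by (simp add: continuous_conv[OF Ck_continuous_on[OF Cinf_Ck]])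
  next
    case (Suc k)
    show ?case
    proof (rule Ck_SucI[where d="\<lambda>i. conv (pd i \<kappa>)"])
      show "continuous_on (ball 0 R) (conv \<kappa>)" by (rule continuous_conv[OF Ck_continuous_on[OF Cinf_Ck[OF Suc.prems, of 0]]])
      show "has_pd (conv \<kappa>) i (conv (pd i \<kappa>) x) x" if "x \<in> ball 0 R" for i x
        using that by (intro has_pd_conv Cinf_Ck Suc.prems) simp
      show "Ck k (ball 0 R) (conv (pd i \<kappa>))" for i by (intro Suc.IH Cinf_pd Suc.prems)
    qed simp
  qed
qed

lemma lap_conv:
  fixes \<kappa> :: "real^'n \<Rightarrow> real"
  assumes \<kappa>: "Cinf (- {0}) \<kappa>" and x: "x \<in> ball 0 R"
  shows "lap (conv \<kappa>) x = conv (lap \<kappa>) x"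
proof -
  have 1: "pd i (conv \<kappa>) z = conv (pd i \<kappa>) z" if "Cinf (- {0}) \<kappa>" "z \<in> ball 0 R" for i z \<kappa>
    using that by (intro has_pd_imp_pd has_pd_conv Cinf_Ck) auto
  have 2: "pd i (pd i (conv \<kappa>)) x = conv (pd i (pd i \<kappa>)) x" for i
  proof -
    have "pd i (pd i (conv \<kappa>)) x = pd i (conv (pd i \<kappa>)) x"
      by (rule pd_cong[OF open_ball x]) (rule 1[OF \<kappa>])
    then show ?thesis using 1[OF Cinf_pd[OF \<kappa>] x] by simp
  qed
  have "(\<integral>y. lap \<kappa> (x - y) * G y \<partial>lborel) = (\<Sum>i\<in>UNIV. conv (pd i (pd i \<kappa>)) x)"
    unfolding lap_def sum_distrib_right conv_def
    by (intro Bochner_Integration.integral_sum integrable_conv Ck_continuous_on[OF Cinf_Ck[of _ _ 0]] Cinf_pd \<kappa>)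
       (use x in auto)
  then show ?thesis by (simp add: lap_def 2 conv_def)
qed

lemma polylap_conv:
  fixes \<kappa> :: "real^'n \<Rightarrow> real"
  assumes \<kappa>: "Cinf (- {0}) \<kappa>" and x: "x \<in> ball 0 R"
  shows "polylap m (conv \<kappa>) x = conv (polylap m \<kappa>) x"
  using x
proof (induction m arbitrary: x)
  case (Suc m)
  have "lap (polylap m (conv \<kappa>)) x = lap (conv (polylap m \<kappa>)) x"
    by (rule lap_cong[OF open_ball Suc.prems]) (rule Suc.IH)
  also have "\<dots> = conv (lap (polylap m \<kappa>)) x"
    by (intro lap_conv Cinf_polylap \<kappa> open_Compl_0 Suc.prems)
  also have "\<dots> = - conv (\<lambda>x. - lap (polylap m \<kappa>) x) x" by (simp add: conv_def)
  finally show ?case by (simp add: polylap_Suc)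
qed simp

text \<open>The integrand is 0: |x| < R keeps x off the support of \<open>G\<close>, and
  \<open>phi\<close> is polyharmonic off its pole.\<close>

lemma polylap_conv_phi:
  assumes "m \<ge> 1" "CARD('n) \<ge> 2 * m" and x: "x \<in> ball 0 R"
  shows "polylap m (conv (phi m)) x = 0"
proof -
  have z: "polylap m (phi m) (x - y) * G y = 0" for y
  proof (cases "norm y < R")
    case False
    then have "x - y \<noteq> 0" using x by auto
    then show ?thesis by (simp add: polylap_phi[OF assms(1,2)])
  qed (simp add: G_inner)
  show ?thesis unfolding polylap_conv[OF Cinf_phi x] conv_def z by simp
qed

end

section \<open>Truncations of the punctured solution and their moments\<close>

lemma mpow_le: "\<bar>mpow y \<beta>\<bar> \<le> norm (y :: real^'n::finite) ^ mabs \<beta>"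
proof -
  have "\<bar>mpow y \<beta>\<bar> = (\<Prod>i\<in>UNIV. \<bar>y $ i\<bar> ^ \<beta> i)" by (simp add: mpow_def abs_prod power_abs)
  also have "\<dots> \<le> (\<Prod>i\<in>UNIV. norm y ^ \<beta> i)"
    by (intro prod_mono conjI power_mono component_le_norm_cart) auto
  also have "\<dots> = norm y ^ mabs \<beta>" by (simp add: mabs_def power_sum)
  finally show ?thesis .
qed

lemma borel_measurable_mpow_uminus [measurable]: "(\<lambda>y :: real^'n::finite. mpow (- y) \<beta>) \<in> borel_measurable borel"
  by (intro borel_measurable_continuous_onI Ck_continuous_on[OF Ck_mpow_uminus[of 0]])

text \<open>Formulated for \<open>lborel\<close> and with \<open>polylap m u\<close> as the
  right-hand side, so that continuity off the origin yields Borel measurability.\<close>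

locale punctured_solution =
  fixes m s :: nat and u :: "real^'n::finite \<Rightarrow> real"
  assumes m: "m \<ge> 1" "CARD('n) \<ge> 2 * m" and s: "s \<le> 2 * m - 1"
    and u: "Ck (2 * m) (ball 0 1 - {0}) u"
    and int_f: "integrable lborel (\<lambda>y. indicator (ball 0 1 - {0}) y * (norm y ^ s * \<bar>polylap m u y\<bar>))"
    and int_u: "integrable lborel (\<lambda>y. indicator (ball 0 1 - {0}) y * max (u y) 0)"
begin

definition f :: "real^'n \<Rightarrow> real" where
  "f y = indicator (ball 0 1 - {0}) y * polylap m u y"

lemma f_measurable [measurable]: "f \<in> borel_measurable borel"
proof -
  have "continuous_on (ball 0 1 - {0}) (polylap m u)"
    by (intro continuous_on_polylap u open_Diff) auto
  then have "(\<lambda>y. indicator (ball 0 1 - {0}) y *\<^sub>R polylap m u y) \<in> borel_measurable borel"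
    by (rule borel_measurable_continuous_on_indicator[rotated]) (intro sets.Diff borel_open borel_closed; simp)
  then show ?thesis unfolding f_def[abs_def] by simp
qed

lemma integrable_weighted_f: "integrable lborel (\<lambda>y. norm y ^ s * \<bar>f y\<bar>)"
proof -
  have "(\<lambda>y. norm y ^ s * \<bar>f y\<bar>) = (\<lambda>y. indicator (ball 0 1 - {0}) y * (norm y ^ s * \<bar>polylap m u y\<bar>))"
    by (auto simp: f_def indicator_def fun_eq_iff)
  then show ?thesis using int_f by simp
qed

text \<open>The cutoff is 0 from radius \<open>(1 + R) / 2\<close> on, strictly before the unit
  sphere; the extension by 0 is therefore regular, and no value of \<open>u\<close> off the
  punctured ball enters.\<close>

definition U :: "real \<Rightarrow> real^'n \<Rightarrow> real" where
  "U R y = (if y \<in> ball 0 1 - {0} then cutoff (2 * m) R ((1 + R) / 2) y * u y else 0)"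

definition F :: "real \<Rightarrow> real^'n \<Rightarrow> real" where
  "F R = polylap m (U R)"

text \<open>\<open>F R\<close> and \<open>f\<close> agree on the punctured ball of radius \<open>R\<close>; the case distinction only discards the
  meaningless value of \<open>F R\<close> at the origin.\<close>

definition G :: "real \<Rightarrow> real^'n \<Rightarrow> real" where
  "G R y = (if norm y < R then 0 else F R y - f y)"

lemma Ck_U:
  assumes R: "0 < R" "R < 1"
  shows "Ck (2 * m) (- {0}) (U R)"
proof (rule Ck_local)
  fix y :: "real^'n" assume y: "y \<in> - {0}"
  let ?S = "ball 0 1 - {0} :: (real^'n) set"
  have opS: "open ?S" by (intro open_Diff) auto
  have "Ck (2 * m) ?S (\<lambda>y. cutoff (2 * m) R ((1 + R) / 2) y * u y)"
    by (intro Ck_mult opS u Ck_subset[OF Ck_cutoff]) simp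
  then have 1: "Ck (2 * m) ?S (U R)" by (rule Ck_cong[OF opS, rotated]) (simp add: U_def)
  have 2: "Ck (2 * m) {y. (1 + R) / 2 < norm y} (U R)"
    by (rule Ck_cong[OF open_norm_gt _ Ck_const[of _ _ 0]]) (use R in \<open>simp add: U_def cutoff_eq_0\<close>)
  show "\<exists>T. open T \<and> y \<in> T \<and> Ck (2 * m) T (U R)"
  proof (cases "norm y < 1")
    case True
    then show ?thesis using y 1 opS by (intro exI[of _ ?S]) auto
  next
    case False
    then show ?thesis using R
      by (intro exI[of _ "{y. (1 + R) / 2 < norm y}"] conjI open_norm_gt 2) simp
  qed
qed

lemma csupp_U: "csupp (U R)"
  unfolding csupp_def by (intro exI[of _ 1]) (auto simp: U_def)

lemma U_eq_u: "0 < R \<Longrightarrow> R < 1 \<Longrightarrow> norm y < R \<Longrightarrow> y \<noteq> 0 \<Longrightarrow> U R y = u y"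
  by (simp add: U_def cutoff_eq_1)

lemma F_eq_f: 
  assumes "0 < R" "R < 1" "norm y < R" "y \<noteq> 0"
  shows "F R y = f y"
proof -
  have "polylap m (U R) y = polylap m u y"
    by (rule polylap_cong[of "ball 0 R - {0}"]) (use assms in \<open>auto simp: U_eq_u intro!: open_Diff\<close>)
  then show ?thesis using assms by (simp add: F_def f_def)
qed

lemma F_outer:
  assumes "0 < R" "R < 1" "1 \<le> norm y"
  shows "F R y = 0"
proof -
  have "polylap m (U R) y = polylap m (\<lambda>_. 0) y"
    by (rule polylap_cong[OF open_norm_gt[of "(1 + R) / 2"]]) (use assms in \<open>auto simp: U_def cutoff_eq_0\<close>)
  then show ?thesis using m by (simp add: F_def polylap_const)
qed

lemma F_continuous: "0 < R \<Longrightarrow> R < 1 \<Longrightarrow> continuous_on (- {0}) (F R)"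
  unfolding F_def by (intro continuous_on_polylap Ck_U open_Compl_0)

lemma F_measurable: "0 < R \<Longrightarrow> R < 1 \<Longrightarrow> F R \<in> borel_measurable borel"
  by (intro borel_measurable_continuous_off_0 F_continuous)

lemma F_bound:
  assumes "0 < R" "R < 1"
  obtains B where "B \<ge> 0" "\<And>y. R \<le> norm y \<Longrightarrow> \<bar>F R y\<bar> \<le> B * indicator (cball 0 1) y"
proof -
  let ?A = "cball 0 1 - ball 0 R :: (real^'n) set"
  have "compact (F R ` ?A)"
    using assms by (intro compact_continuous_image continuous_on_subset[OF F_continuous] compact_diff) auto
  then have "bounded (F R ` ?A)" by (rule compact_imp_bounded)
  then obtain B where "\<forall>y\<in>?A. \<bar>F R y\<bar> \<le> B" unfolding bounded_iff by auto
  then have B: "\<And>y. y \<in> ?A \<Longrightarrow> \<bar>F R y\<bar> \<le> B" by blast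
  have "\<bar>F R y\<bar> \<le> max B 0 * indicator (cball 0 1) y" if "R \<le> norm y" for y
    using B[of y] that F_outer[OF assms, of y] by (cases "norm y \<le> 1") auto
  then show ?thesis by (intro that[of "max B 0"]) auto
qed

text \<open>Near 0 the density is \<open>f\<close>, whose singularity the decay of \<open>q\<close>
  absorbs; on the rest of the unit ball it is bounded.\<close>

lemma integrable_times_F:
  assumes R: "0 < R" "R < 1" and q: "q \<in> borel_measurable borel"
    and b: "0 \<le> C" "\<And>y. norm y \<le> 1 \<Longrightarrow> \<bar>q y\<bar> \<le> C * norm y ^ s"
  shows "integrable lborel (\<lambda>y. q y * F R y)"
proof -
  note [measurable] = q F_measurable[OF R]
  obtain B where B: "B \<ge> 0" "\<And>y. R \<le> norm y \<Longrightarrow> \<bar>F R y\<bar> \<le> B * indicator (cball 0 1) y"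
    using F_bound[OF R] by blast
  have AE: "AE y :: real^'n in lborel. y \<noteq> 0" by (rule AE_lborel_singleton)
  have int: "integrable lborel (\<lambda>y. C * (norm y ^ s * \<bar>f y\<bar>) + (C * B) * indicator (cball 0 1) y)"
    by (intro Bochner_Integration.integrable_add integrable_mult_right integrable_weighted_f integrable_indicator_cball)
  show ?thesis
  proof (rule Bochner_Integration.integrable_bound[OF int])
    show "AE y in lborel. norm (q y * F R y) \<le> norm (C * (norm y ^ s * \<bar>f y\<bar>) + (C * B) * indicator (cball 0 1) y)"
      using AE
    proof eventually_elim
      case (elim y)
      have nn: "0 \<le> C * (norm y ^ s * \<bar>f y\<bar>)" "0 \<le> (C * B) * indicator (cball 0 1) y" using b B by auto
      have "\<bar>q y * F R y\<bar> \<le> C * (norm y ^ s * \<bar>f y\<bar>) + (C * B) * indicator (cball 0 1) y"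
      proof (cases "norm y < R")
        case True
        have "\<bar>q y\<bar> * \<bar>F R y\<bar> \<le> (C * norm y ^ s) * \<bar>f y\<bar>"
          unfolding F_eq_f[OF R True elim] using True R by (intro mult_right_mono b) auto
        then show ?thesis using nn by (simp add: abs_mult mult.assoc)
      next
        case False
        show ?thesis
        proof (cases "norm y \<le> 1")
          case True
          have "norm y ^ s \<le> 1" using True by (simp add: power_le_one)
          then have "C * norm y ^ s \<le> C" using b(1) by (simp add: mult_left_le)
          then have "\<bar>q y\<bar> \<le> C" using b(2)[OF True] by simp
          then have "\<bar>q y\<bar> * \<bar>F R y\<bar> \<le> C * (B * indicator (cball 0 1) y)"
            using B(2)[of y] False b(1) by (intro mult_mono) auto
          then show ?thesis using nn by (simp add: abs_mult mult.assoc)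
        next
          case False
          then show ?thesis using F_outer[OF R, of y] nn by simp
        qed
      qed
      then show ?case using nn by simp
    qed
  qed measurable
qed

lemma G_exterior:
  assumes R: "0 < R" "R < 1"
  shows "exterior_density (G R) R"
proof
  note [measurable] = F_measurable[OF R]
  obtain B where B: "B \<ge> 0" "\<And>y. R \<le> norm y \<Longrightarrow> \<bar>F R y\<bar> \<le> B * indicator (cball 0 1) y"
    using F_bound[OF R] by blast
  have int: "integrable lborel (\<lambda>y :: real^'n. B * indicator (cball 0 1) y + (1 / R ^ s) * (norm y ^ s * \<bar>f y\<bar>))"
    by (intro Bochner_Integration.integrable_add integrable_mult_right integrable_weighted_f integrable_indicator_cball)
  show "integrable lborel (G R)"
  proof (rule Bochner_Integration.integrable_bound[OF int])
    show "G R \<in> borel_measurable lborel" unfolding G_def[abs_def] by measurable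
    show "AE y in lborel. norm (G R y) \<le> norm (B * indicator (cball 0 1) y + (1 / R ^ s) * (norm y ^ s * \<bar>f y\<bar>))"
    proof (rule AE_I2)
      fix y
      have nn: "0 \<le> B * indicator (cball 0 1) y" "0 \<le> (1 / R ^ s) * (norm y ^ s * \<bar>f y\<bar>)" using B R by auto
      have "\<bar>G R y\<bar> \<le> B * indicator (cball 0 1) y + (1 / R ^ s) * (norm y ^ s * \<bar>f y\<bar>)"
      proof (cases "norm y < R")
        case False
        then have "R ^ s \<le> norm y ^ s" using R by (intro power_mono) auto
        then have "1 \<le> norm y ^ s / R ^ s" using R by simp
        then have "1 * \<bar>f y\<bar> \<le> norm y ^ s / R ^ s * \<bar>f y\<bar>" by (intro mult_right_mono) auto
        then show ?thesis using False B(2)[of y] by (simp add: G_def)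
      qed (use nn in \<open>simp add: G_def\<close>)
      then show "norm (G R y) \<le> norm (B * indicator (cball 0 1) y + (1 / R ^ s) * (norm y ^ s * \<bar>f y\<bar>))"
        using nn by simp
    qed
  qed
  show "G R y = 0" if "1 < norm y" for y
    using that F_outer[OF R, of y] by (simp add: G_def f_def)
qed (use R in \<open>auto simp: G_def\<close>)

lemma integrable_powr_F:
  assumes R: "0 < R" "R < 1"
  shows "integrable lborel (\<lambda>y. norm y powr real (2 * m) * F R y)"
proof (rule integrable_times_F[OF R, where C=1])
  show "\<bar>norm y powr real (2 * m)\<bar> \<le> 1 * norm y ^ s" if "norm y \<le> 1" for y :: "real^'n"
  proof (cases "y = 0")
    case False
    then have "norm y powr real (2 * m) = norm y ^ (2 * m)" by (intro powr_realpow) simp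
    then show ?thesis using that s m by (simp add: power_decreasing)
  qed (use m in simp)
qed auto

text \<open>A factor between 0 and 1 does not enlarge the positive part, so the hypothesis on
  \<open>u\<close> passes to \<open>U R\<close>.\<close>

lemma integrable_U:
  assumes R: "0 < R" "R < 1"
  shows "integrable lborel (U R)"
proof (rule integrable_if_pos_part_integrable[of m])
  show "2 \<le> CARD('n)" using m by linarith
  have [measurable]: "U R \<in> borel_measurable borel"
    by (intro borel_measurable_continuous_off_0 Ck_continuous_on[OF Ck_U[OF R]])
  show "integrable lborel (\<lambda>y. max (U R y) 0)"
  proof (rule Bochner_Integration.integrable_bound[OF int_u])
    show "AE y in lborel. norm (max (U R y) 0) \<le> norm (indicator (ball 0 1 - {0}) y * max (u y) 0)"
    proof (rule AE_I2)
      fix y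
      have le: "max (c * v) 0 \<le> max v 0" if "0 \<le> c" "c \<le> 1" for c v :: real
        using that by (cases "v \<ge> 0") (auto simp: mult_left_le_one_le mult_nonneg_nonpos max_def)
      have "max (cutoff (2 * m) R ((1 + R) / 2) y * u y) 0 \<le> max (u y) 0"
        by (rule le[OF cutoff_nonneg cutoff_le_1])
      then show "norm (max (U R y) 0) \<le> norm (indicator (ball 0 1 - {0}) y * max (u y) 0)"
        by (simp add: U_def)
    qed
  qed simp
  show "integrable lborel (\<lambda>y. norm y powr real (2 * m) * polylap m (U R) y)"
    using integrable_powr_F[OF R] by (simp add: F_def)
qed (intro Ck_U csupp_U R)+

lemma integrable_mpow_F:
  assumes R: "0 < R" "R < 1" and \<beta>: "s \<le> mabs \<beta>"
  shows "integrable lborel (\<lambda>y. mpow (- y) \<beta> * F R y)"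
proof (rule integrable_times_F[OF R borel_measurable_mpow_uminus, where C=1])
  show "\<bar>mpow (- y) \<beta>\<bar> \<le> 1 * norm y ^ s" if "norm y \<le> 1" for y
    using mpow_le[of "- y" \<beta>] power_decreasing[OF \<beta>, of "norm y"] that by simp
qed simp

lemma integrable_mpow_G:
  assumes R: "0 < R" "R < 1"
  shows "integrable lborel (\<lambda>y. mpow (- y) \<beta> * G R y)"
proof -
  interpret exterior_density "G R" R by (rule G_exterior[OF R])
  show ?thesis
  proof (rule Bochner_Integration.integrable_bound[OF G_int])
    show "AE y in lborel. norm (mpow (- y) \<beta> * G R y) \<le> norm (G R y)"
    proof (rule AE_I2)
      fix y
      show "norm (mpow (- y) \<beta> * G R y) \<le> norm (G R y)"
      proof (cases "norm y \<le> 1")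
        case True
        then have "\<bar>mpow (- y) \<beta>\<bar> \<le> 1"
          using mpow_le[of "- y" \<beta>] power_le_one[of "norm y" "mabs \<beta>"] by simp
        then show ?thesis by (simp add: abs_mult mult_left_le_one_le)
      qed (simp add: G_outer not_le)
    qed
  qed simp
qed

text \<open>Orders from \<open>s\<close> on occur in \<open>taylor_phi\<close> but not in
  \<open>psi\<close>, leaving a moment of \<open>F R\<close>, finite thanks to the weight. Lower
  orders are subtracted in \<open>psi\<close> as well; passing from \<open>F R\<close> to
  \<open>f\<close> then leaves a moment of the exterior density \<open>G R\<close>.\<close>

definition coef :: "real \<Rightarrow> ('n \<Rightarrow> nat) \<Rightarrow> real" where
  "coef R \<beta> = - ((\<integral>y. mpow (- y) \<beta> * (if mabs \<beta> < s then G R y else F R y) \<partial>lborel) / mfact \<beta>)"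

definition rest :: "real \<Rightarrow> real^'n \<Rightarrow> real" where
  "rest R = exterior_density.conv (G R) (phi m)"

definition pot :: "real^'n \<Rightarrow> real" where
  "pot x = (\<integral>y. psi m s x y * f y \<partial>lborel)"

text \<open>All terms are rearranged under one integral sign, into groups that are separately
  integrable, and only then integrated.\<close>

lemma representation:
  assumes R: "0 < R" "R < 1" and x: "norm x < R" "x \<noteq> 0"
  shows "integrable lborel (\<lambda>y. psi m s x y * f y)"
    and "u x = pot x + rest R x + (\<Sum>\<beta>\<in>{\<beta>. mabs \<beta> \<le> 2 * m - 1}. coef R \<beta> * Dm \<beta> (phi m) x)"
proof -
  interpret exterior_density "G R" R by (rule G_exterior[OF R])
  note [measurable] = F_measurable[OF R]
  let ?L = "{\<beta> :: 'n \<Rightarrow> nat. mabs \<beta> < s}" and ?M = "{\<beta> :: 'n \<Rightarrow> nat. s \<le> mabs \<beta> \<and> mabs \<beta> < 2 * m}"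
  let ?c = "\<lambda>\<beta>. Dm \<beta> (phi m) x / mfact \<beta>"
  have ms: "s \<le> 2 * m" "s < 2 * m" using s m by auto
  have un: "{\<beta> :: 'n \<Rightarrow> nat. mabs \<beta> < 2 * m} = ?L \<union> ?M" using ms by auto
  have un': "{\<beta> :: 'n \<Rightarrow> nat. mabs \<beta> \<le> 2 * m - 1} = ?L \<union> ?M" using ms by auto
  have fin: "finite ?L" "finite ?M" using finite_mabs_less[where 'n='n and k=s] finite_subset[OF _ finite_mabs_less[where 'n='n and k="2*m"], of ?M] by auto
  have dis: "?L \<inter> ?M = {}" by auto
  have psi: "psi m s x y = phi m (x - y) - (\<Sum>\<beta>\<in>?L. ?c \<beta> * mpow (- y) \<beta>)" for y
    unfolding psi_def by (intro arg_cong2[where f="(-)"] refl sum.cong) simp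
  have tay: "taylor_phi m x y = (\<Sum>\<beta>\<in>?L. ?c \<beta> * mpow (- y) \<beta>) + (\<Sum>\<beta>\<in>?M. ?c \<beta> * mpow (- y) \<beta>)" for y
    unfolding taylor_phi_alt un by (rule sum.union_disjoint[OF fin dis])
  have w: "integrable lborel (\<lambda>y. norm y powr real (2 * m) * polylap m (U R) y)"
    using integrable_powr_F[OF R] by (simp add: F_def)
  note rep = representation_formula[OF m Ck_U[OF R] csupp_U integrable_U[OF R] w x(2), folded F_def]
  have iM: "integrable lborel (\<lambda>y. \<Sum>\<beta>\<in>?M. ?c \<beta> * (mpow (- y) \<beta> * F R y))"
    by (intro Bochner_Integration.integrable_sum integrable_mult_right integrable_mpow_F[OF R]) auto
  have iL: "integrable lborel (\<lambda>y. \<Sum>\<beta>\<in>?L. ?c \<beta> * (mpow (- y) \<beta> * G R y))"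
    by (intro Bochner_Integration.integrable_sum integrable_mult_right integrable_mpow_G[OF R])
  have iG: "integrable lborel (\<lambda>y. phi m (x - y) * G R y)"
    by (rule integrable_conv[OF Ck_continuous_on[OF Cinf_Ck[OF Cinf_phi, of 0]] x(1)])
  let ?H = "\<lambda>y. (phi m (x - y) - taylor_phi m x y) * F R y + (\<Sum>\<beta>\<in>?M. ?c \<beta> * (mpow (- y) \<beta> * F R y))
      - (phi m (x - y) * G R y - (\<Sum>\<beta>\<in>?L. ?c \<beta> * (mpow (- y) \<beta> * G R y)))"
  have iH: "integrable lborel ?H"
    by (intro Bochner_Integration.integrable_diff Bochner_Integration.integrable_add rep(1) iM iL iG)
  \<comment> \<open>From \<open>f = F R - G R\<close> off the origin: \<open>psi\<close> against
    \<open>F R\<close> is completed by the Taylor terms of orders s to 2m - 1, \<open>psi\<close>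
    against \<open>G R\<close> is expanded.\<close>
  have eq: "psi m s x y * f y = ?H y" if "y \<noteq> 0" for y
  proof -
    have "G R y = F R y - f y" using F_eq_f[OF R _ that] by (auto simp: G_def)
    then have f: "f y = F R y - G R y" by simp
    have 1: "(phi m (x - y) - taylor_phi m x y) * F R y + (\<Sum>\<beta>\<in>?M. ?c \<beta> * (mpow (- y) \<beta> * F R y)) = psi m s x y * F R y"
      unfolding tay psi mult.assoc[symmetric] sum_distrib_right[symmetric] by (simp add: algebra_simps)
    have 2: "phi m (x - y) * G R y - (\<Sum>\<beta>\<in>?L. ?c \<beta> * (mpow (- y) \<beta> * G R y)) = psi m s x y * G R y"
      unfolding psi mult.assoc[symmetric] sum_distrib_right[symmetric] by (simp add: algebra_simps)
    show ?thesis unfolding 1 2 f by (simp add: algebra_simps)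
  qed
  have AE: "AE y :: real^'n in lborel. y \<noteq> 0" by (rule AE_lborel_singleton)
  have AEeq: "AE y in lborel. psi m s x y * f y = ?H y" using AE by eventually_elim (rule eq)
  have [measurable]: "(\<lambda>y. psi m s x y) \<in> borel_measurable borel"
    unfolding psi by measurable
  have pm: "(\<lambda>y. psi m s x y * f y) \<in> borel_measurable lborel" by measurable
  have Hm: "?H \<in> borel_measurable lborel" using iH by (rule borel_measurable_integrable)
  show "integrable lborel (\<lambda>y. psi m s x y * f y)"
    using iH integrable_cong_AE[OF pm Hm AEeq] by simp
  have "pot x = (\<integral>y. ?H y \<partial>lborel)"
    unfolding pot_def by (rule integral_cong_AE[OF pm Hm AEeq])
  also have "\<dots> = (\<integral>y. (phi m (x - y) - taylor_phi m x y) * F R y \<partial>lborel) + (\<integral>y. (\<Sum>\<beta>\<in>?M. ?c \<beta> * (mpow (- y) \<beta> * F R y)) \<partial>lborel)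
      - ((\<integral>y. phi m (x - y) * G R y \<partial>lborel) - (\<integral>y. (\<Sum>\<beta>\<in>?L. ?c \<beta> * (mpow (- y) \<beta> * G R y)) \<partial>lborel))"
    using rep(1) iM iL iG by simp
  also have "(\<integral>y. (phi m (x - y) - taylor_phi m x y) * F R y \<partial>lborel) = u x"
    using rep(2) U_eq_u[OF R x] by simp
  also have "(\<integral>y. phi m (x - y) * G R y \<partial>lborel) = rest R x" by (simp add: rest_def conv_def)
  also have "(\<integral>y. (\<Sum>\<beta>\<in>?M. ?c \<beta> * (mpow (- y) \<beta> * F R y)) \<partial>lborel) = (\<Sum>\<beta>\<in>?M. - (coef R \<beta> * Dm \<beta> (phi m) x))"
    using integrable_mpow_F[OF R] by (subst Bochner_Integration.integral_sum) (auto simp: coef_def intro!: sum.cong)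
  also have "(\<integral>y. (\<Sum>\<beta>\<in>?L. ?c \<beta> * (mpow (- y) \<beta> * G R y)) \<partial>lborel) = (\<Sum>\<beta>\<in>?L. - (coef R \<beta> * Dm \<beta> (phi m) x))"
    using integrable_mpow_G[OF R] by (subst Bochner_Integration.integral_sum) (auto simp: coef_def intro!: sum.cong)
  finally show "u x = pot x + rest R x + (\<Sum>\<beta>\<in>{\<beta>. mabs \<beta> \<le> 2 * m - 1}. coef R \<beta> * Dm \<beta> (phi m) x)"
    unfolding un' sum.union_disjoint[OF fin dis] by (simp add: sum_negf)
qed

text \<open>Both truncations equal \<open>u\<close> on the smaller punctured ball, so their
  difference \<open>E\<close> is regular on the whole space and compactly supported. Integration by
  parts puts the m-fold Laplacian on a monomial of degree below 2m, which it annihilates.\<close>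

lemma coef_mono_eq:
  assumes R: "0 < R" "R \<le> S" "S < 1" and \<beta>: "mabs \<beta> < 2 * m"
  shows "coef S \<beta> = coef R \<beta>"
proof -
  have S: "0 < S" "S < 1" and R1: "0 < R" "R < 1" using R by auto
  have AE: "AE y :: real^'n in lborel. y \<noteq> 0" by (rule AE_lborel_singleton)
  define E where "E y = U S y - U R y" for y
  have op: "open (- {0 :: real^'n})" by simp
  have CE: "Ck (2 * m) UNIV E"
  proof (rule Ck_local)
    fix y :: "real^'n"
    have 1: "Ck (2 * m) (- {0}) E" unfolding E_def[abs_def] by (intro Ck_diff Ck_U S R1 op)
    have 2: "Ck (2 * m) (ball 0 R) E"
      by (rule Ck_cong[OF open_ball _ Ck_const[of _ _ 0]])
         (use R S in \<open>auto simp: E_def U_def cutoff_eq_1\<close>)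
    show "\<exists>T. open T \<and> y \<in> T \<and> Ck (2 * m) T E"
    proof (cases "y = 0")
      case True then show ?thesis using 2 R by (intro exI[of _ "ball 0 R"]) auto
    next
      case False then show ?thesis using 1 op by (intro exI[of _ "- {0}"]) auto
    qed
  qed
  have sE: "csupp E" unfolding csupp_def by (intro exI[of _ 1]) (auto simp: E_def U_def)
  have LE: "polylap m E y = F S y - F R y" if "y \<noteq> 0" for y
    unfolding E_def[abs_def] F_def using that by (intro polylap_diff[OF op] Ck_U S R1) simp
  have z: "(\<integral>y. mpow (- y) \<beta> * polylap m E y \<partial>lborel) = 0"
    using integral_by_parts_polylap[OF Ck_mpow_uminus CE sE] by (simp add: polylap_mpow_uminus[OF \<beta>])
  have Em: "(\<lambda>y. mpow (- y) \<beta> * polylap m E y) \<in> borel_measurable lborel"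
  proof -
    have [measurable]: "polylap m E \<in> borel_measurable borel"
      by (intro borel_measurable_continuous_onI continuous_on_polylap CE open_UNIV)
    show ?thesis by measurable
  qed
  have key: "(\<integral>y. mpow (- y) \<beta> * P y \<partial>lborel) = (\<integral>y. mpow (- y) \<beta> * Q y \<partial>lborel)"
    if P: "integrable lborel (\<lambda>y. mpow (- y) \<beta> * P y)" and Q: "integrable lborel (\<lambda>y. mpow (- y) \<beta> * Q y)"
      and eq: "\<And>y. y \<noteq> 0 \<Longrightarrow> P y - Q y = polylap m E y" for P Q
  proof -
    have "(\<integral>y. mpow (- y) \<beta> * P y \<partial>lborel) - (\<integral>y. mpow (- y) \<beta> * Q y \<partial>lborel)
      = (\<integral>y. mpow (- y) \<beta> * P y - mpow (- y) \<beta> * Q y \<partial>lborel)"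
      using P Q by simp
    also have "\<dots> = (\<integral>y. mpow (- y) \<beta> * polylap m E y \<partial>lborel)"
    proof (rule integral_cong_AE)
      show "(\<lambda>y. mpow (- y) \<beta> * P y - mpow (- y) \<beta> * Q y) \<in> borel_measurable lborel"
        by (intro borel_measurable_diff borel_measurable_integrable P Q)
      show "AE y in lborel. mpow (- y) \<beta> * P y - mpow (- y) \<beta> * Q y = mpow (- y) \<beta> * polylap m E y"
        using AE by eventually_elim (simp add: eq[symmetric] right_diff_distrib)
    qed (rule Em)
    finally show ?thesis using z by simp
  qed
  show ?thesis
  proof (cases "mabs \<beta> < s")
    case True
    \<comment> \<open>Holds for |y| < S too, although \<open>G S\<close> is 0 there, because
      \<open>F S\<close> equals \<open>f\<close> in that region.\<close>
    have "G S y - G R y = polylap m E y" if "y \<noteq> 0" for y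
      unfolding LE[OF that] using F_eq_f[OF S _ that] F_eq_f[OF R1 _ that] R by (auto simp: G_def)
    then show ?thesis using True key[OF integrable_mpow_G[OF S] integrable_mpow_G[OF R1]] by (simp add: coef_def)
  next
    case False
    then have b: "s \<le> mabs \<beta>" by simp
    show ?thesis using False key[OF integrable_mpow_F[OF S b] integrable_mpow_F[OF R1 b]] by (simp add: coef_def LE)
  qed
qed

lemma coef_eq:
  assumes "0 < R" "R < 1" "mabs \<beta> < 2 * m"
  shows "coef R \<beta> = coef (1 / 2) \<beta>"
  using coef_mono_eq[of R "1 / 2" \<beta>] coef_mono_eq[of "1 / 2" R \<beta>] assms by (cases "R \<le> 1 / 2") auto

lemma Cinf_rest: "0 < R \<Longrightarrow> R < 1 \<Longrightarrow> Cinf (ball 0 R) (rest R)"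
  unfolding rest_def by (rule exterior_density.Cinf_conv[OF G_exterior Cinf_phi])

lemma polylap_rest: "0 < R \<Longrightarrow> R < 1 \<Longrightarrow> x \<in> ball 0 R \<Longrightarrow> polylap m (rest R) x = 0"
  unfolding rest_def by (rule exterior_density.polylap_conv_phi[OF G_exterior m])

text \<open>Off the origin all other terms of the representation are independent of the
  radius.\<close>

lemma rest_eq:
  assumes R: "0 < R" "R < 1" "norm x < R" and S: "0 < S" "S < 1" "norm x < S"
  shows "rest R x = rest S x"
proof -
  have ne: "rest R z = rest S z" if z: "z \<noteq> 0" "norm z < R" "norm z < S" for z
  proof -
    have "(\<Sum>\<beta>\<in>{\<beta> :: 'n \<Rightarrow> nat. mabs \<beta> \<le> 2 * m - 1}. coef R \<beta> * Dm \<beta> (phi m) z)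
       = (\<Sum>\<beta>\<in>{\<beta>. mabs \<beta> \<le> 2 * m - 1}. coef S \<beta> * Dm \<beta> (phi m) z)"
      using m coef_eq[OF R(1,2)] coef_eq[OF S(1,2)] by (intro sum.cong refl arg_cong2[where f="(*)"]) auto
    then show ?thesis using representation(2)[OF R(1,2) z(2,1)] representation(2)[OF S(1,2) z(3,1)] by simp
  qed
  show ?thesis
  proof (cases "x = 0")
    \<comment> \<open>The representation says nothing at 0; the values there agree by
      continuity.\<close>
    case True
    let ?D = "\<lambda>z. rest R z - rest S z"
    have "isCont (rest R) 0" "isCont (rest S) 0"
      using Ck_continuous_on[OF Cinf_Ck[OF Cinf_rest[OF R(1,2)], of 0]] Ck_continuous_on[OF Cinf_Ck[OF Cinf_rest[OF S(1,2)], of 0]]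
        R(1) S(1) continuous_on_eq_continuous_at[OF open_ball] centre_in_ball by blast+
    then have "isCont ?D 0" by (intro continuous_intros)
    then have 1: "(?D \<longlongrightarrow> ?D 0) (at 0)" by (simp add: isCont_def)
    have "\<forall>\<^sub>F z in at 0. ?D z = 0"
      unfolding eventually_at using R(1) S(1) ne by (intro exI[of _ "min R S"]) auto
    then have "(?D \<longlongrightarrow> 0) (at 0)" by (rule tendsto_eventually)
    from tendsto_unique[OF _ 1 this] show ?thesis using True by simp
  qed (use ne R S in simp)
qed

theorem decomposition:
  "\<exists>h. Cinf (ball 0 1) h \<and> (\<forall>x\<in>ball 0 1. polylap m h x = 0) \<and>
     (\<forall>x\<in>ball 0 1 - {0}. u x = pot x + h x + (\<Sum>\<beta>\<in>{\<beta>. mabs \<beta> \<le> 2 * m - 1}. coef (1 / 2) \<beta> * Dm \<beta> (phi m) x))"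
proof -
  \<comment> \<open>Any radius strictly between |x| and 1 would give the same value by
    \<open>rest_eq\<close>; the midpoint is a choice depending on x alone.\<close>
  define h where "h x = rest ((1 + norm x) / 2) x" for x
  have h: "h x = rest R x" if R: "0 < R" "R < 1" "norm x < R" for x R
    unfolding h_def by (rule rest_eq) (use R in \<open>auto intro: add_pos_nonneg\<close>)
  have loc: "\<exists>R. 0 < R \<and> R < 1 \<and> x \<in> ball 0 R" if "x \<in> ball 0 1" for x :: "real^'n"
    by (rule exI[of _ "(1 + norm x) / 2"]) (use that in \<open>auto intro: add_pos_nonneg\<close>)
  have "Cinf (ball 0 1) h"
    unfolding Cinf_def
  proof (intro allI Ck_local)
    fix k and x :: "real^'n" assume "x \<in> ball 0 1"
    then obtain R where R: "0 < R" "R < 1" "x \<in> ball 0 R" using loc by blast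
    have "Ck k (ball 0 R) h"
      by (rule Ck_cong[OF open_ball _ Cinf_Ck[OF Cinf_rest[OF R(1,2)]]]) (use h R in auto)
    then show "\<exists>T. open T \<and> x \<in> T \<and> Ck k T h" using R by blast
  qed
  moreover have "polylap m h x = 0" if "x \<in> ball 0 1" for x
  proof -
    obtain R where R: "0 < R" "R < 1" "x \<in> ball 0 R" using loc[OF \<open>x \<in> ball 0 1\<close>] by blast
    have "polylap m h x = polylap m (rest R) x"
      by (rule polylap_cong[OF open_ball R(3)]) (use h R in auto)
    then show ?thesis using polylap_rest[OF R] by simp
  qed
  moreover have "u x = pot x + h x + (\<Sum>\<beta>\<in>{\<beta>. mabs \<beta> \<le> 2 * m - 1}. coef (1 / 2) \<beta> * Dm \<beta> (phi m) x)"
    if x: "x \<in> ball 0 1 - {0}" for x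
  proof -
    obtain R where R: "0 < R" "R < 1" "x \<in> ball 0 R" using loc x by blast
    have "(\<Sum>\<beta>\<in>{\<beta> :: 'n \<Rightarrow> nat. mabs \<beta> \<le> 2 * m - 1}. coef R \<beta> * Dm \<beta> (phi m) x)
       = (\<Sum>\<beta>\<in>{\<beta>. mabs \<beta> \<le> 2 * m - 1}. coef (1 / 2) \<beta> * Dm \<beta> (phi m) x)"
      using m coef_eq[OF R(1,2)] by (intro sum.cong refl arg_cong2[where f="(*)"]) auto
    then show ?thesis using representation(2)[OF R(1,2), of x] R x h[OF R(1,2), of x] by simp
  qed
  ultimately show ?thesis by blast
qed

lemma integrable_psi_f:
  assumes "x \<in> ball 0 1 - {0}"
  shows "integrable lborel (\<lambda>y. psi m s x y * f y)"
  by (rule representation(1)[of "(1 + norm x) / 2"]) (use assms in \<open>auto intro: add_pos_nonneg\<close>)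

end

section \<open>Passage from the Borel setting to absolute integrability on the punctured
  ball\<close>

theorem theorem1p4:
  fixes m s :: nat and u f :: "real^'n::finite \<Rightarrow> real"
  assumes "m \<ge> 1" and "CARD('n) \<ge> 2*m"
    and "s \<le> 2*m - 1"
    and "Ck (2*m) (ball 0 1 - {0}) u"
    and "\<forall>x\<in>ball 0 1 - {0}. polylap m u x = f x"
    and "(\<lambda>x. norm x ^ s * \<bar>f x\<bar>) absolutely_integrable_on (ball 0 1 - {0})"
    and "(\<lambda>x. max (u x) 0) absolutely_integrable_on (ball 0 1 - {0})"
  shows "\<exists>a :: ('n \<Rightarrow> nat) \<Rightarrow> real. \<exists>h :: real^'n \<Rightarrow> real.
           Cinf (ball 0 1) h \<and> (\<forall>x\<in>ball 0 1. polylap m h x = 0) \<and>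
           (\<forall>x\<in>ball 0 1 - {0}. u x = Npot m s f x + h x
               + (\<Sum>\<beta>\<in>{\<beta>::'n\<Rightarrow>nat. mabs \<beta> \<le> 2*m - 1}. a \<beta> * Dm \<beta> (phi m) x))"
proof -
  let ?B = "ball 0 1 - {0} :: (real^'n) set"
  have op: "open ?B" by (intro open_Diff) auto
  \<comment> \<open>Absolute integrability refers to the completed measure. Continuity on an open
    set provides a Borel measurable integrand, for which integrability descends to
    \<open>lborel\<close>.\<close>
  have lift: "integrable lborel (\<lambda>y. indicator ?B y * g y)"
    if c: "continuous_on ?B g" and i: "g absolutely_integrable_on ?B" for g :: "real^'n \<Rightarrow> real"
  proof -
    have "(\<lambda>y. indicator ?B y *\<^sub>R g y) \<in> borel_measurable lborel"
      using borel_measurable_continuous_on_indicator[OF _ c] op by auto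
    from integrable_completion[OF this] show ?thesis
      using i unfolding set_integrable_def by simp
  qed
  have cu: "continuous_on ?B u" and cL: "continuous_on ?B (polylap m u)"
    by (intro Ck_continuous_on[OF assms(4)] continuous_on_polylap assms(4) op)+
  interpret P: punctured_solution m s u
  proof
    have "(\<lambda>x. norm x ^ s * \<bar>polylap m u x\<bar>) absolutely_integrable_on ?B"
      using assms(6) by (rule absolutely_integrable_spike[where S="{}"]) (use assms(5) in auto)
    then show "integrable lborel (\<lambda>y. indicator ?B y * (norm y ^ s * \<bar>polylap m u y\<bar>))"
      by (intro lift continuous_intros cL)
    show "integrable lborel (\<lambda>y. indicator ?B y * max (u y) 0)"
      by (intro lift continuous_intros cu assms(7))
  qed (use assms in auto)
  have N: "Npot m s f x = P.pot x" if x: "x \<in> ?B" for x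
  proof -
    have "((\<lambda>y. psi m s x y * P.f y) has_integral P.pot x) UNIV"
      unfolding P.pot_def by (rule has_integral_integral_lborel[OF P.integrable_psi_f[OF x]])
    then have "((\<lambda>y. if y \<in> cball 0 1 then psi m s x y * f y else 0) has_integral P.pot x) UNIV"
    proof (rule has_integral_spike[rotated 2])
      \<comment> \<open>\<open>P.f\<close> is 0 at the origin and on the unit sphere, where the
        values of \<open>f\<close> are arbitrary; both sets are negligible.\<close>
      show "negligible (insert 0 (sphere 0 1 :: (real^'n) set))"
        using negligible_sphere[of "0 :: real^'n" 1] by (simp add: negligible_insert)
      show "(if y \<in> cball 0 1 then psi m s x y * f y else 0) = psi m s x y * P.f y"
        if "y \<in> UNIV - insert 0 (sphere 0 1)" for y :: "real^'n"
        using that assms(5) by (auto simp: P.f_def)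
    qed
    then have "((\<lambda>y. psi m s x y * f y) has_integral P.pot x) (cball 0 1)"
      using has_integral_restrict_UNIV by blast
    then show ?thesis unfolding Npot_def by (rule integral_unique)
  qed
  from P.decomposition N show ?thesis by (intro exI[of _ "P.coef (1 / 2)"]) fastforce
qed

end
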